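(* Let $\beta>0$, let $b\geq 2$ be an integer, and fix $\theta\in[0,2\pi)$. For $N\in\mathbb{N}$ let $(\theta_1,\dots,\theta_N)$ be distributed according to the circular $\beta$-ensemble, let $D_{N,\beta}(\theta)=\prod_{j=1}^N(e^{i\theta}-e^{i\theta_j})$, and write the base-$b$ expansion $|D_{N,\beta}(\theta)|=\big(\sum_{k=1}^\infty d_{k,N}\,b^{1-k}\big)b^{M}$ with $M\in\mathbb{Z}$, $d_{k,N}\in\{0,1,\dots,b-1\}$ and $d_{1,N}\neq0$. Let $L\in\mathbb{N}$ and, for $\ell=1,\dots,L$, let $m_\ell:\mathbb{N}\to\mathbb{N}$ be functions with $m_\ell(N)\to\infty$ as $N\to\infty$ and $m_i(N)<m_j(N)$ for $i<j$. Then for all $k_1,\dots,k_L\in\{0,1,\dots,b-1\}$ and every $\varepsilon>0$, $$\left|\mathbb{P}\big(d_{m_1(N),N}=k_1,\dots,d_{m_L(N),N}=k_L\big)-\frac{1}{b^L}\right|=\mathcal{O}\Big(\frac{1}{(\log N)^{3/2-\varepsilon}}+\frac{1}{b^{m_1(N)}}\Big)\quad\text{as }N\to\infty.$$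
   Context: The circular $\beta$-ensemble (C$\beta$E) with $N$ points is the random vector $(\theta_1,\dots,\theta_N)\in[0,2\pi)^N$ whose law has density proportional to $\prod_{1\leq j<k\leq N}|e^{i\theta_j}-e^{i\theta_k}|^\beta$ with respect to Lebesgue measure. *)

theory Defs
  imports "HOL-Probability.Probability" "HOL-Library.Landau_Symbols"
begin

definition cbe_weight :: "nat \<Rightarrow> real \<Rightarrow> (nat \<Rightarrow> real) \<Rightarrow> real" where
  "cbe_weight N \<beta> \<theta>s =
     (\<Prod>j<N. \<Prod>k\<in>{j<..<N}. cmod (cis (\<theta>s j) - cis (\<theta>s k)) powr \<beta>)"

definition cbe_ref :: "nat \<Rightarrow> (nat \<Rightarrow> real) measure" where
  "cbe_ref N = PiM {..<N} (\<lambda>_. restrict_space lborel {0..<2*pi})"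

definition cbe_norm :: "nat \<Rightarrow> real \<Rightarrow> real" where
  "cbe_norm N \<beta> = integral\<^sup>L (cbe_ref N) (cbe_weight N \<beta>)"

definition cbe :: "nat \<Rightarrow> real \<Rightarrow> (nat \<Rightarrow> real) measure" where
  "cbe N \<beta> = density (cbe_ref N) (\<lambda>\<theta>s. ennreal (cbe_weight N \<beta> \<theta>s / cbe_norm N \<beta>))"

definition char_poly :: "nat \<Rightarrow> real \<Rightarrow> (nat \<Rightarrow> real) \<Rightarrow> complex" where
  "char_poly N \<theta> \<theta>s = (\<Prod>j<N. cis \<theta> - cis (\<theta>s j))"

text \<open>k-th base-b digit (k >= 1) of x > 0: x = (sum_k d_k b^(1-k)) b^M with d_1 \<noteq> 0,
  M = floor (log_b x); digits taken from the standard (greedy) expansion.\<close>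
definition digit :: "nat \<Rightarrow> nat \<Rightarrow> real \<Rightarrow> nat" where
  "digit b k x = (let M = \<lfloor>log (real b) x\<rfloor> in
     nat (\<lfloor>x * real b powr (real k - 1 - real_of_int M)\<rfloor> mod int b))"

end

theory Submission
  imports Defs "HOL-Real_Asymp.Real_Asymp"
begin

text \<open>No regularity is tracked for the law left over once the exponentials have been split
  off, so an \<open>L2\<close> bound on the smoothed digit function cannot be integrated against it.
  This shapes the use of the exponentials: one is spent on turning the discontinuous indicator of a
  digit pattern into a continuous function, one on turning an \<open>L2\<close> bound into a bound
  at every point, and all others shrink the \<open>L2\<close> norm.

  The power of \<open>N\<close> arises as follows. Point \<open>j\<close> yields about \<xi>/2
  exponentials, all with rates between \<xi>/2 and \<xi>, where \<xi> grows linearly in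
  \<open>j\<close>. A rate \<rho> contributes a factor 1 + 1/(\<rho>T)^2, so point \<open>j\<close>
  contributes about 1 + const/j, and the product of these over \<open>j < N\<close> grows like a
  power of \<open>N\<close>.

  The digit count is exact on full periods of the pattern. Its error comes only from the decrease of
  the logarithmic weights ln(1 + 1/q), which telescopes.\<close>

text \<open>
  Put \<open>X = |D|\<^sup>2 / 4\<^sup>N \<in> [0,1]\<close> and \<open>\<xi>\<^sub>j = 1 + j\<beta>/2\<close>.  Aomoto's integration by parts on the torus gives
  every integer moment of \<open>X\<close>: they are the moments of a product of independent variables
  \<open>Beta(\<xi>\<^sub>j/2, \<xi>\<^sub>j/2) \<cdot> Beta((\<xi>\<^sub>j+1)/2, (\<xi>\<^sub>j-1)/2)\<close>, \<open>j < N\<close>, and since \<open>X\<close> is bounded its law is that of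
  the product.  For an integer \<open>m \<le> q\<close>, \<open>- ln Beta(p, q)\<close> is \<open>- ln Beta(p + m, q - m)\<close> plus independent
  exponential variables with rates \<open>p, p + 1, \<dots>, p + m - 1\<close>, so \<open>- ln X\<close> contains an independent sum of
  exponentials whose total variance grows like \<open>ln N\<close>.

  The digits of \<open>|D|\<close> are a function of \<open>- ln X\<close> with period \<open>T = 2 ln b\<close>.  Adding an exponential variable of
  rate \<open>\<rho>\<close> replaces a \<open>T\<close>-periodic function \<open>f\<close> by the periodic solution \<open>g\<close> of \<open>g' = \<rho>(g - f)\<close>; the
  energy identity and Poincare's inequality shrink the \<open>L\<^sup>2\<close> norm of mean-zero functions by
  \<open>(1 + (\<rho>T)\<^sup>-\<^sup>2)\<^sup>-\<^sup>1\<^sup>/\<^sup>2\<close>.  Altogether the digits differ from those of \<open>b\<^sup>U\<close>, \<open>U\<close> uniform on \<open>[0,1]\<close>, by a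
  power of \<open>1/N\<close>, which is better than the required power of \<open>1/ln N\<close>.  The digits of \<open>b\<^sup>U\<close> are counted in
  blocks of consecutive integers and give the term \<open>b\<^sup>-\<^sup>m\<close>.
\<close>

section \<open>Integration over the torus\<close>

abbreviation arc_measure :: "real measure" where
  "arc_measure \<equiv> restrict_space lborel {0..<2*pi}"

lemma emeasure_arc: "A \<in> sets arc_measure \<Longrightarrow> emeasure arc_measure A = emeasure lborel A"
  by (subst emeasure_restrict_space) (auto simp: sets_restrict_space)

lemma finite_measure_arc: "finite_measure arc_measure"
  by (rule finite_measureI) (auto simp: emeasure_restrict_space space_restrict_space)

interpretation arc_measure: finite_measure arc_measure
  by (rule finite_measure_arc)

interpretation arcs: product_sigma_finite "\<lambda>_::nat. arc_measure"
  by unfold_locales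

lemma space_cbe_ref: "space (cbe_ref N) = {..<N} \<rightarrow>\<^sub>E {0..<2*pi}"
  by (simp add: cbe_ref_def space_PiM space_restrict_space)

lemma measurable_component_cbe_ref [measurable]:
  "j < N \<Longrightarrow> (\<lambda>x. x j) \<in> borel_measurable (cbe_ref N)"
proof -
  assume "j < N"
  then have "(\<lambda>x. x j) \<in> measurable (cbe_ref N) arc_measure"
    unfolding cbe_ref_def by (intro measurable_component_singleton) simp
  then show ?thesis
    by (subst (asm) measurable_restrict_space2_iff) auto
qed

lemma finite_measure_cbe_ref: "finite_measure (cbe_ref N)"
proof (rule finite_measureI)
  have "emeasure (cbe_ref N) (space (cbe_ref N)) = (\<Prod>i<N. emeasure arc_measure {0..<2*pi})"
    unfolding space_cbe_ref unfolding cbe_ref_def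
    by (subst arcs.emeasure_PiM) (auto simp: sets_restrict_space)
  also have "\<dots> \<noteq> \<infinity>"
    by (auto simp: emeasure_restrict_space ennreal_power)
  finally show "emeasure (cbe_ref N) (space (cbe_ref N)) \<noteq> \<infinity>" .
qed

text \<open>The points are exchangeable under the reference measure. As the weight is symmetric too,
  this supplies every symmetrisation in Aomoto's argument.\<close>

lemma integral_cbe_ref_transpose:
  fixes f :: "(nat \<Rightarrow> real) \<Rightarrow> 'a::{banach, second_countable_topology}"
  assumes [measurable]: "f \<in> borel_measurable (cbe_ref N)" and "i < N" "j < N"
  shows "integral\<^sup>L (cbe_ref N) f = (\<integral>x. f (\<lambda>n. x (Transposition.transpose i j n)) \<partial>cbe_ref N)"
proof -
  let ?t = "Transposition.transpose i j"
  let ?T = "\<lambda>x::nat \<Rightarrow> real. \<lambda>n\<in>{..<N}. x (?t n)"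
  have t_less: "?t n < N" if "n < N" for n
    using that assms by (auto simp: Transposition.transpose_def)
  have T [measurable]: "?T \<in> measurable (cbe_ref N) (cbe_ref N)"
    unfolding cbe_ref_def by (rule measurable_restrict) (auto intro!: measurable_component_singleton t_less)
  have "distr (cbe_ref N) (cbe_ref N) ?T = cbe_ref N"
    unfolding cbe_ref_def
  proof (rule arcs.PiM_eqI)
    fix A assume A: "\<And>i. i \<in> {..<N} \<Longrightarrow> A i \<in> sets arc_measure"
    have "?T -` (Pi\<^sub>E {..<N} A) \<inter> space (cbe_ref N) = Pi\<^sub>E {..<N} (\<lambda>n. A (?t n))"
    proof (intro equalityI subsetI)
      fix x assume x: "x \<in> ?T -` (Pi\<^sub>E {..<N} A) \<inter> space (cbe_ref N)"
      then have *: "x (?t n) \<in> A n" if "n < N" for n using that by (auto simp: PiE_iff)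
      have "x n \<in> A (?t n)" if "n < N" for n
        using *[of "?t n"] t_less[OF that] by simp
      with x show "x \<in> Pi\<^sub>E {..<N} (\<lambda>n. A (?t n))" by (auto simp: space_cbe_ref PiE_iff)
    next
      fix x assume x: "x \<in> Pi\<^sub>E {..<N} (\<lambda>n. A (?t n))"
      have *: "x (?t n) \<in> A n" if "n < N" for n
        using PiE_mem[OF x, of "?t n"] t_less[OF that] by simp
      have "x n \<in> {0..<2*pi}" if "n < N" for n
        using *[of "?t n"] sets.sets_into_space[OF A[of "?t n"]] t_less[OF that]
        by (auto simp: space_restrict_space)
      then have "?T x \<in> Pi\<^sub>E {..<N} A" "x \<in> space (cbe_ref N)"
        using x * by (auto simp: space_cbe_ref PiE_iff)
      then show "x \<in> ?T -` (Pi\<^sub>E {..<N} A) \<inter> space (cbe_ref N)" by blast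
    qed
    then have "emeasure (distr (Pi\<^sub>M {..<N} (\<lambda>_. arc_measure)) (Pi\<^sub>M {..<N} (\<lambda>_. arc_measure)) ?T) (Pi\<^sub>E {..<N} A)
        = emeasure (Pi\<^sub>M {..<N} (\<lambda>_. arc_measure)) (Pi\<^sub>E {..<N} (\<lambda>n. A (?t n)))"
      using A T by (subst emeasure_distr) (auto simp: cbe_ref_def intro!: sets_PiM_I_finite)
    also have "\<dots> = (\<Prod>n<N. emeasure arc_measure (A (?t n)))"
      using A t_less by (intro arcs.emeasure_PiM) auto
    also have "\<dots> = (\<Prod>n<N. emeasure arc_measure (A n))"
      by (rule prod.reindex_bij_witness[of _ ?t ?t]) (use t_less in auto)
    finally show "emeasure (distr (Pi\<^sub>M {..<N} (\<lambda>_. arc_measure)) (Pi\<^sub>M {..<N} (\<lambda>_. arc_measure)) ?T) (Pi\<^sub>E {..<N} A)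
        = (\<Prod>n<N. emeasure arc_measure (A n))" .
  qed auto
  then have "integral\<^sup>L (cbe_ref N) f = integral\<^sup>L (distr (cbe_ref N) (cbe_ref N) ?T) f"
    by simp
  also have "\<dots> = (\<integral>x. f (?T x) \<partial>cbe_ref N)"
    by (rule integral_distr) auto
  also have "\<dots> = (\<integral>x. f (\<lambda>n. x (?t n)) \<partial>cbe_ref N)"
  proof (intro Bochner_Integration.integral_cong refl arg_cong[of _ _ f] ext)
    fix x n assume "x \<in> space (cbe_ref N)"
    then show "?T x n = x (?t n)"
      using assms by (cases "n < N") (auto simp: space_cbe_ref PiE_iff extensional_def Transposition.transpose_def)
  qed
  finally show ?thesis .
qed

text \<open>On a circle integration by parts has no boundary terms. Fubini isolates the angle
  \<open>q\<close>, and the fundamental theorem of calculus makes the inner integral vanish.\<close>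

lemma integral_cbe_ref_periodic_derivative:
  fixes F F' :: "(nat \<Rightarrow> real) \<Rightarrow> complex"
  assumes q: "q < N" and int: "integrable (cbe_ref N) F'"
    and der: "\<And>x y. ((\<lambda>y. F (x(q := y))) has_vector_derivative F' (x(q := y))) (at y)"
    and cont: "\<And>x. continuous_on UNIV (\<lambda>y. F' (x(q := y)))"
    and per: "\<And>x. F (x(q := 2*pi)) = F (x(q := 0))"
  shows "integral\<^sup>L (cbe_ref N) F' = 0"
proof -
  have N: "{..<N} = insert q ({..<N} - {q})" using q by auto
  have inner: "(\<integral>y. F' (x(q := y)) \<partial>arc_measure) = 0" for x
  proof -
    have c: "continuous_on {0..2*pi} (\<lambda>y. F' (x(q := y)))"
      using cont continuous_on_subset by blast
    have "(\<integral>y. F' (x(q := y)) \<partial>arc_measure) = (\<integral>y. indicator {0..<2*pi} y *\<^sub>R F' (x(q := y)) \<partial>lborel)"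
      by (subst integral_restrict_space) (auto simp: set_lebesgue_integral_def)
    \<comment> \<open>The half-open arc is closed at the cost of one null point, to fit the
      fundamental theorem.\<close>
    also have "\<dots> = (\<integral>y. indicator {0..2*pi} y *\<^sub>R F' (x(q := y)) \<partial>lborel)"
    proof (rule integral_cong_AE)
      show "AE y in lborel. indicator {0..<2*pi} y *\<^sub>R F' (x(q := y)) = indicator {0..2*pi} y *\<^sub>R F' (x(q := y))"
        by (rule eventually_mono[OF AE_lborel_singleton[of "2*pi"]]) (auto simp: indicator_def)
    qed (use borel_measurable_continuous_onI[OF cont, of x] in \<open>auto intro!: borel_measurable_scaleR\<close>)
    also have "\<dots> = F (x(q := 2*pi)) - F (x(q := 0))"
      using c by (intro integral_FTC_Icc has_vector_derivative_at_within[OF der]) auto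
    finally show ?thesis using per by simp
  qed
  have "integral\<^sup>L (cbe_ref N) F' = integral\<^sup>L (PiM (insert q ({..<N} - {q})) (\<lambda>_. arc_measure)) F'"
    unfolding cbe_ref_def using N by presburger
  also have "\<dots> = (\<integral>x. (\<integral>y. F' (x(q := y)) \<partial>arc_measure) \<partial>PiM ({..<N} - {q}) (\<lambda>_. arc_measure))"
    using int unfolding cbe_ref_def by (intro arcs.product_integral_insert) (auto simp: insert_absorb q)
  finally show ?thesis by (simp add: inner)
qed

section \<open>Aomoto recursion and the moments of the characteristic polynomial\<close>

text \<open>Boundedness is required on all functions, not only on the torus, so that the closure
  rules carry no side conditions. The reference measure being finite, integrability follows.\<close>

definition bounded_measurable :: "nat \<Rightarrow> ((nat \<Rightarrow> real) \<Rightarrow> complex) \<Rightarrow> bool" where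
  "bounded_measurable N f \<longleftrightarrow> f \<in> borel_measurable (cbe_ref N) \<and> bounded (range f)"

lemma bounded_measurableI:
  "f \<in> borel_measurable (cbe_ref N) \<Longrightarrow> (\<And>x. norm (f x) \<le> C) \<Longrightarrow> bounded_measurable N f"
  by (auto simp: bounded_measurable_def bounded_iff)

lemma bounded_measurable_integrable: "bounded_measurable N f \<Longrightarrow> integrable (cbe_ref N) f"
  unfolding bounded_measurable_def bounded_iff
  by (auto intro!: finite_measure.integrable_const_bound[OF finite_measure_cbe_ref])

lemma bounded_measurable_const: "bounded_measurable N (\<lambda>_. c)"
  by (rule bounded_measurableI[of _ _ "norm c"]) auto

lemma bounded_measurable_mult:
  assumes "bounded_measurable N f" "bounded_measurable N g"
  shows "bounded_measurable N (\<lambda>x. f x * g x)"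
proof -
  from assms obtain C D where "\<And>x. norm (f x) \<le> C" "\<And>x. norm (g x) \<le> D"
    by (auto simp: bounded_measurable_def bounded_iff)
  then show ?thesis using assms
    by (intro bounded_measurableI[of _ _ "C * D"])
       (auto simp: bounded_measurable_def norm_mult intro!: mult_mono intro: order_trans[OF norm_ge_zero])
qed

lemma bounded_measurable_add:
  assumes "bounded_measurable N f" "bounded_measurable N g"
  shows "bounded_measurable N (\<lambda>x. f x + g x)"
proof -
  from assms obtain C D where "\<And>x. norm (f x) \<le> C" "\<And>x. norm (g x) \<le> D"
    by (auto simp: bounded_measurable_def bounded_iff)
  then show ?thesis using assms
    by (intro bounded_measurableI[of _ _ "C + D"])
       (auto simp: bounded_measurable_def intro!: norm_add_rule_thm)
qed

lemma bounded_measurable_diff: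
  assumes "bounded_measurable N f" "bounded_measurable N g"
  shows "bounded_measurable N (\<lambda>x. f x - g x)"
  using bounded_measurable_add[OF assms(1) bounded_measurable_mult[OF bounded_measurable_const[of N "-1"] assms(2)]]
  by simp

lemma bounded_measurable_prod:
  "(\<And>i. i \<in> I \<Longrightarrow> bounded_measurable N (f i)) \<Longrightarrow> bounded_measurable N (\<lambda>x. \<Prod>i\<in>I. f i x)"
  by (induction I rule: infinite_finite_induct)
     (auto intro!: bounded_measurable_mult bounded_measurable_const)

lemma bounded_measurable_sum:
  "(\<And>i. i \<in> I \<Longrightarrow> bounded_measurable N (f i)) \<Longrightarrow> bounded_measurable N (\<lambda>x. \<Sum>i\<in>I. f i x)"
  by (induction I rule: infinite_finite_induct)
     (auto intro!: bounded_measurable_add bounded_measurable_const)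

lemma bounded_measurable_power:
  "bounded_measurable N f \<Longrightarrow> bounded_measurable N (\<lambda>x. f x ^ n)"
  by (induction n) (auto intro!: bounded_measurable_mult bounded_measurable_const)

lemmas bounded_measurable_intros =
  bounded_measurable_const bounded_measurable_mult bounded_measurable_add bounded_measurable_diff
  bounded_measurable_prod bounded_measurable_sum bounded_measurable_power

lemma bounded_measurable_cis:
  "j < N \<Longrightarrow> bounded_measurable N (\<lambda>x. cis (x j - t))" "j < N \<Longrightarrow> bounded_measurable N (\<lambda>x. cis (t - x j))"
proof -
  have [measurable]: "cis \<in> borel_measurable borel"
    by (rule borel_measurable_continuous_onI) (intro continuous_intros)
  show "j < N \<Longrightarrow> bounded_measurable N (\<lambda>x. cis (x j - t))" "j < N \<Longrightarrow> bounded_measurable N (\<lambda>x. cis (t - x j))"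
    by (auto intro!: bounded_measurableI[of _ _ 1] measurable_compose[OF _ \<open>cis \<in> borel_measurable borel\<close>]
        borel_measurable_diff)
qed

section \<open>Regularised weight and charged products\<close>

definition pairs :: "nat \<Rightarrow> (nat \<times> nat) set" where
  "pairs N = {p. fst p < N \<and> snd p < N \<and> fst p \<noteq> snd p}"

lemma finite_pairs [simp]: "finite (pairs N)"
  by (rule finite_subset[of _ "{..<N} \<times> {..<N}"]) (auto simp: pairs_def)

text \<open>The shift by \<open>\<delta> > 0\<close> makes the weight smooth, so that integration by parts meets no singularity even
  for \<open>\<beta> < 1\<close>.  The product runs over ordered pairs, and \<open>2 - 2 cos u\<close> is a squared distance,
  whence the exponent \<open>\<beta>/4\<close>.\<close>

definition reg_weight :: "nat \<Rightarrow> real \<Rightarrow> real \<Rightarrow> (nat \<Rightarrow> real) \<Rightarrow> real" where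
  "reg_weight N \<beta> \<delta> x = (\<Prod>p\<in>pairs N. (2 - 2 * cos (x (fst p) - x (snd p)) + \<delta>) powr (\<beta> / 4))"

text \<open>The first \<open>q\<close> points carry one additional factor \<open>1 - z\<^sub>j\<close>; Aomoto's recursion is in \<open>q\<close>.\<close>

definition charge :: "nat \<Rightarrow> real \<Rightarrow> nat \<Rightarrow> nat \<Rightarrow> nat \<Rightarrow> (nat \<Rightarrow> real) \<Rightarrow> complex" where
  "charge N \<theta> a b q x =
     (\<Prod>j<N. (1 - cis (x j - \<theta>)) ^ (a + of_bool (j < q)) * (1 - cis (\<theta> - x j)) ^ b)"

text \<open>At \<open>\<delta> = 0\<close> this is \<open>cot (u/2)\<close>, the logarithmic derivative of \<open>2 - 2 cos u\<close>.\<close>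

definition cot_kernel :: "real \<Rightarrow> real \<Rightarrow> real" where
  "cot_kernel \<delta> u = 2 * sin u / (2 - 2 * cos u + \<delta>)"

lemma cot_kernel_minus: "cot_kernel \<delta> (- u) = - cot_kernel \<delta> u"
  by (simp add: cot_kernel_def)

lemma cmod_cis_diff_squared: "(cmod (cis s - cis t))\<^sup>2 = 2 - 2 * cos (s - t)"
proof -
  have "(cmod (cis s - cis t))\<^sup>2 = (cos s - cos t)\<^sup>2 + (sin s - sin t)\<^sup>2"
    by (simp add: cmod_power2)
  also have "\<dots> = ((cos s)\<^sup>2 + (sin s)\<^sup>2) + ((cos t)\<^sup>2 + (sin t)\<^sup>2) - 2 * (cos s * cos t + sin s * sin t)"
    by (simp only: power2_diff) (simp add: algebra_simps)
  finally show ?thesis by (simp add: cos_diff)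
qed

lemma reg_weight_0: "reg_weight N \<beta> 0 x = cbe_weight N \<beta> x"
proof -
  \<comment> \<open>Coincident points need their own case: both sides are then a power of
    \<open>0\<close>, which \<open>powr\<close> sets to \<open>0\<close>.\<close>
  have powr: "(2 - 2 * cos (s - t)) powr (\<beta> / 4) = cmod (cis s - cis t) powr (\<beta> / 2)" for s t
  proof (cases "cis s = cis t")
    case True
    then show ?thesis using cmod_cis_diff_squared[of s t] by simp
  next
    case False
    then have "(cmod (cis s - cis t)) powr (\<beta> / 2) = ((cmod (cis s - cis t)) powr 2) powr (\<beta> / 4)"
      by (subst powr_powr) simp
    also have "(cmod (cis s - cis t)) powr 2 = 2 - 2 * cos (s - t)"
      using False by (simp add: cmod_cis_diff_squared)
    finally show ?thesis ..
  qed
  let ?f = "\<lambda>j k. cmod (cis (x j) - cis (x k)) powr (\<beta> / 2)"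
  \<comment> \<open>The ordered pairs are the increasing ones and their mirror images. Both halves
    give the same product of powers \<beta>/2, so together they give the exponent \<beta>.\<close>
  let ?U = "SIGMA j:{..<N}. {j<..<N}"
  have pairs: "pairs N = ?U \<union> prod.swap ` ?U" "?U \<inter> prod.swap ` ?U = {}"
    by (force simp: pairs_def)+
  have "reg_weight N \<beta> 0 x = (\<Prod>p\<in>pairs N. ?f (fst p) (snd p))"
    by (simp add: reg_weight_def powr)
  also have "\<dots> = (\<Prod>p\<in>?U. ?f (fst p) (snd p)) * (\<Prod>p\<in>prod.swap ` ?U. ?f (fst p) (snd p))"
    unfolding pairs(1) by (rule prod.union_disjoint) (use pairs(2) in auto)
  also have "(\<Prod>p\<in>prod.swap ` ?U. ?f (fst p) (snd p)) = (\<Prod>p\<in>?U. ?f (fst p) (snd p))"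
    by (subst prod.reindex) (auto simp: inj_on_def norm_minus_commute)
  also have "(\<Prod>p\<in>?U. ?f (fst p) (snd p)) * (\<Prod>p\<in>?U. ?f (fst p) (snd p))
      = (\<Prod>p\<in>?U. ?f (fst p) (snd p) * ?f (fst p) (snd p))"
    by (simp add: prod.distrib)
  also have "\<dots> = (\<Prod>p\<in>?U. cmod (cis (x (fst p)) - cis (x (snd p))) powr \<beta>)"
    by (intro prod.cong refl) (simp flip: powr_add)
  also have "\<dots> = cbe_weight N \<beta> x"
    unfolding cbe_weight_def by (subst prod.Sigma) (auto simp: case_prod_unfold)
  finally show ?thesis .
qed

lemma reg_weight_transpose:
  assumes "i < N" "j < N"
  shows "reg_weight N \<beta> \<delta> (\<lambda>n. x (Transposition.transpose i j n)) = reg_weight N \<beta> \<delta> x"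
  unfolding reg_weight_def
  by (rule prod.reindex_bij_witness[of _ "map_prod (Transposition.transpose i j) (Transposition.transpose i j)"
        "map_prod (Transposition.transpose i j) (Transposition.transpose i j)"])
     (use assms in \<open>auto simp: pairs_def Transposition.transpose_def split: if_splits\<close>)

lemma charge_transpose:
  assumes "i < N" "j < N" "i < q \<longleftrightarrow> j < q"
  shows "charge N \<theta> a b q (\<lambda>n. x (Transposition.transpose i j n)) = charge N \<theta> a b q x"
  unfolding charge_def
  by (rule prod.reindex_bij_witness[of _ "Transposition.transpose i j" "Transposition.transpose i j"])
     (use assms in \<open>auto simp: Transposition.transpose_def split: if_splits\<close>)

lemma charge_Suc:
  assumes "q < N"
  shows "charge N \<theta> a b (Suc q) x = (1 - cis (x q - \<theta>)) * charge N \<theta> a b q x"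
  unfolding charge_def using assms
  by (subst (1 2) prod.remove[of _ q]) (auto intro!: prod.cong simp: less_Suc_eq)

text \<open>This closes one round of the recursion: when all \<open>N\<close> points carry the
  additional factor, the exponent \<open>a\<close> has risen by one.\<close>

lemma charge_shift: "charge N \<theta> a b N x = charge N \<theta> (Suc a) b 0 x"
  unfolding charge_def by (rule prod.cong) auto

lemma bounded_measurable_charge: "bounded_measurable N (charge N \<theta> a b q)"
  unfolding charge_def by (intro bounded_measurable_intros bounded_measurable_cis) auto

lemma cos_gap_nonneg: "0 \<le> 2 - 2 * cos (u::real)"
  by simp

lemma bounded_measurable_reg_weight:
  assumes "\<beta> > 0" "\<delta> \<ge> 0"
  shows "bounded_measurable N (\<lambda>x. complex_of_real (reg_weight N \<beta> \<delta> x))"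
proof -
  have "bounded_measurable N (\<lambda>x. complex_of_real ((2 - 2 * cos (x (fst p) - x (snd p)) + \<delta>) powr (\<beta> / 4)))"
    if "p \<in> pairs N" for p
  proof (rule bounded_measurableI[of _ _ "(4 + \<delta>) powr (\<beta> / 4)"])
    have [measurable]: "fst p < N" "snd p < N" using that by (auto simp: pairs_def)
    show "(\<lambda>x. complex_of_real ((2 - 2 * cos (x (fst p) - x (snd p)) + \<delta>) powr (\<beta> / 4))) \<in> borel_measurable (cbe_ref N)"
      by measurable
    fix x
    show "cmod (complex_of_real ((2 - 2 * cos (x (fst p) - x (snd p)) + \<delta>) powr (\<beta> / 4))) \<le> (4 + \<delta>) powr (\<beta> / 4)"
    proof -
      have "0 \<le> 2 - 2 * cos (x (fst p) - x (snd p)) + \<delta>" "2 - 2 * cos (x (fst p) - x (snd p)) + \<delta> \<le> 4 + \<delta>"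
        using assms cos_ge_minus_one[of "x (fst p) - x (snd p)"] cos_gap_nonneg[of "x (fst p) - x (snd p)"]
        by linarith+
      with assms(1) show ?thesis by (simp only: norm_of_real abs_of_nonneg powr_ge_zero) (intro powr_mono2, auto)
    qed
  qed
  then show ?thesis
    unfolding reg_weight_def of_real_prod by (intro bounded_measurable_prod) auto
qed

lemma bounded_measurable_kernel:
  assumes "\<delta> > 0" "i < N" "j < N"
  shows "bounded_measurable N (\<lambda>x. complex_of_real (cot_kernel \<delta> (x i - x j)))"
proof (rule bounded_measurableI[of _ _ "2 / \<delta>"])
  show "(\<lambda>x. complex_of_real (cot_kernel \<delta> (x i - x j))) \<in> borel_measurable (cbe_ref N)"
    unfolding cot_kernel_def using assms(2,3) by measurable
  fix x
  have "\<bar>2 * sin (x i - x j)\<bar> \<le> 2" "\<bar>2 - 2 * cos (x i - x j) + \<delta>\<bar> \<ge> \<delta>"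
    using assms(1) cos_gap_nonneg[of "x i - x j"] abs_sin_le_one[of "x i - x j"] by linarith+
  with assms(1) have "\<bar>2 * sin (x i - x j)\<bar> / \<bar>2 - 2 * cos (x i - x j) + \<delta>\<bar> \<le> 2 / \<delta>"
    by (intro frac_le) auto
  then show "norm (complex_of_real (cot_kernel \<delta> (x i - x j))) \<le> 2 / \<delta>"
    by (simp only: cot_kernel_def norm_of_real abs_divide)
qed

section \<open>Derivatives in one angle and the loop equation\<close>

lemma continuous_on_fun_upd [continuous_intros]:
  "continuous_on S (\<lambda>y. (x(q := y)) j)" for x :: "nat \<Rightarrow> real"
  by (cases "j = q") auto

text \<open>The weight is the exponential of a sum over ordered pairs. Each \<open>k\<close> other
  than \<open>q\<close> occurs in \<open>(q, k)\<close> and in \<open>(k, q)\<close>; since the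
  kernel is odd the two contributions agree, which turns \<beta>/4 into \<beta>/2.\<close>

lemma has_real_derivative_reg_weight:
  assumes "\<delta> > 0" "q < N"
  defines "X \<equiv> \<lambda>x y. x(q := y)"
  shows "((\<lambda>y. reg_weight N \<beta> \<delta> (X x y)) has_real_derivative
     reg_weight N \<beta> \<delta> (X x y) * (\<beta> / 2 * (\<Sum>k\<in>{..<N}-{q}. cot_kernel \<delta> (X x y q - X x y k)))) (at y)"
proof -
  have pos: "2 - 2 * cos u + \<delta> > 0" for u
    using assms(1) cos_gap_nonneg[of u] by linarith
  define h where "h u = \<beta> / 4 * ln (2 - 2 * cos u + \<delta>)" for u
  \<comment> \<open>\<open>s p\<close> is the derivative of the angle difference \<open>d p\<close>
    in the angle \<open>q\<close>: one of 1, -1 and 0.\<close>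
  define s :: "nat \<times> nat \<Rightarrow> real" where "s p = of_bool (fst p = q) - of_bool (snd p = q)" for p
  define d where "d p y = X x y (fst p) - X x y (snd p)" for p y
  have w: "reg_weight N \<beta> \<delta> z = exp (\<Sum>p\<in>pairs N. h (z (fst p) - z (snd p)))" for z
    unfolding reg_weight_def exp_sum[OF finite_pairs] h_def
    by (rule prod.cong) (auto simp: powr_def pos[THEN less_imp_neq, symmetric])
  have h: "(h has_real_derivative \<beta> / 4 * cot_kernel \<delta> u) (at u)" for u
    unfolding h_def cot_kernel_def using pos[of u] by (auto intro!: derivative_eq_intros simp: field_simps)
  have d: "(d p has_real_derivative s p) (at y)" if "p \<in> pairs N" for p
    unfolding d_def X_def s_def fun_upd_def
    by (cases "fst p = q"; cases "snd p = q") (auto intro!: derivative_eq_intros)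
  have hd: "((\<lambda>y. h (d p y)) has_real_derivative \<beta> / 4 * cot_kernel \<delta> (d p y) * s p) (at y)" if "p \<in> pairs N" for p
    by (rule DERIV_chain2[OF h d[OF that]])
  have eq: "(\<Sum>p\<in>pairs N. \<beta> / 4 * cot_kernel \<delta> (d p y) * s p)
      = \<beta> / 2 * (\<Sum>k\<in>{..<N}-{q}. cot_kernel \<delta> (X x y q - X x y k))"
  proof -
    have 1: "(\<Sum>p\<in>pairs N. cot_kernel \<delta> (d p y) * of_bool (fst p = q)) = (\<Sum>k\<in>{..<N}-{q}. cot_kernel \<delta> (X x y q - X x y k))"
    proof -
      have "(\<Sum>p\<in>pairs N. cot_kernel \<delta> (d p y) * of_bool (fst p = q)) = (\<Sum>p\<in>(\<lambda>k. (q, k)) ` ({..<N}-{q}). cot_kernel \<delta> (d p y))"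
        by (rule sum.mono_neutral_cong_right) (use assms(2) finite_pairs[of N] in \<open>auto simp: pairs_def\<close>)
      then show ?thesis by (simp add: sum.reindex inj_on_def d_def)
    qed
    have 2: "(\<Sum>p\<in>pairs N. cot_kernel \<delta> (d p y) * of_bool (snd p = q)) = (\<Sum>k\<in>{..<N}-{q}. - cot_kernel \<delta> (X x y q - X x y k))"
    proof -
      have "(\<Sum>p\<in>pairs N. cot_kernel \<delta> (d p y) * of_bool (snd p = q)) = (\<Sum>p\<in>(\<lambda>k. (k, q)) ` ({..<N}-{q}). cot_kernel \<delta> (d p y))"
        by (rule sum.mono_neutral_cong_right) (use assms(2) finite_pairs[of N] in \<open>auto simp: pairs_def\<close>)
      then show ?thesis by (simp add: sum.reindex inj_on_def d_def flip: cot_kernel_minus)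
    qed
    have "(\<Sum>p\<in>pairs N. \<beta> / 4 * cot_kernel \<delta> (d p y) * s p)
       = \<beta> / 4 * ((\<Sum>p\<in>pairs N. cot_kernel \<delta> (d p y) * of_bool (fst p = q)) - (\<Sum>p\<in>pairs N. cot_kernel \<delta> (d p y) * of_bool (snd p = q)))"
      unfolding sum_subtractf[symmetric] sum_distrib_left s_def by (intro sum.cong refl) (simp add: algebra_simps)
    then show ?thesis unfolding 1 2 by (simp add: sum_negf)
  qed
  show ?thesis
    unfolding w
    using DERIV_fun_exp[OF DERIV_sum[of "pairs N" "\<lambda>y p. h (d p y)", OF hd]]
    unfolding eq unfolding d_def .
qed

text \<open>For a point z on the unit circle, conj(z) (1 - z) = - (1 - conj(z)). Differentiating the
  conjugate factor costs a power of 1 - conj(z), and this identity buys it back with the additional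
  factor 1 - z. Hence the derivative is a multiple of the charge at \<open>q\<close>, without a
  negative power.\<close>

lemma has_vector_derivative_charge:
  assumes "q < N"
  shows "((\<lambda>y. charge N \<theta> a b (Suc q) (x(q := y))) has_vector_derivative
     - \<i> * (of_nat (Suc a) * cis (y - \<theta>) + of_nat b) * charge N \<theta> a b q (x(q := y))) (at y)"
proof -
  define C where "C = (\<Prod>j\<in>{..<N}-{q}. (1 - cis (x j - \<theta>)) ^ (a + of_bool (j < q)) * (1 - cis (\<theta> - x j)) ^ b)"
  have ch: "charge N \<theta> a b (Suc q) (x(q := y)) = (1 - cis (y - \<theta>)) ^ Suc a * (1 - cis (\<theta> - y)) ^ b * C"
           "charge N \<theta> a b q (x(q := y)) = (1 - cis (y - \<theta>)) ^ a * (1 - cis (\<theta> - y)) ^ b * C" for y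
    unfolding charge_def C_def using assms
    by (subst prod.remove[of _ q]; auto intro!: prod.cong simp: less_Suc_eq)+
  \<comment> \<open>Both factors are extended to entire functions of a complex angle, so that the
    rules for complex derivatives apply; the result is then restricted to real angles.\<close>
  define e where "e w = exp (\<i> * (w - of_real \<theta>))" for w
  define e' where "e' w = exp (- \<i> * (w - of_real \<theta>))" for w
  have cis_e: "cis (y - \<theta>) = e (of_real y)" "cis (\<theta> - y) = e' (of_real y)" for y
    by (simp_all add: cis_conv_exp e_def e'_def algebra_simps)
  have ee: "e w * e' w = 1" for w by (simp add: e_def e'_def exp_minus_inverse)
  have [derivative_intros]: "(e has_field_derivative \<i> * e w) (at w)" "(e' has_field_derivative - \<i> * e' w) (at w)" for w
    unfolding e_def e'_def by (auto intro!: derivative_eq_intros)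
  have "((\<lambda>w. (1 - e w) ^ Suc a * (1 - e' w) ^ b * C) has_field_derivative
      - \<i> * (of_nat (Suc a) * e w + of_nat b) * ((1 - e w) ^ a * (1 - e' w) ^ b * C)) (at w)" for w
  proof -
    have 1: "((\<lambda>w. (1 - e w) ^ Suc a) has_field_derivative of_nat (Suc a) * (1 - e w) ^ a * (- \<i> * e w)) (at w)"
      by (rule derivative_eq_intros refl)+ simp
    have 2: "((\<lambda>w. (1 - e' w) ^ b) has_field_derivative of_nat b * (1 - e' w) ^ (b - 1) * (\<i> * e' w)) (at w)"
      by (rule derivative_eq_intros refl)+ simp
    \<comment> \<open>The lost power of \<open>1 - e' w\<close> is recovered from the surplus factor
      \<open>1 - e w\<close>. For \<open>b = 0\<close> both sides are \<open>0\<close>.\<close>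
    have 3: "of_nat b * (1 - e' w) ^ (b - 1) * (\<i> * e' w) * (1 - e w) ^ Suc a
        = - \<i> * of_nat b * (1 - e w) ^ a * (1 - e' w) ^ b"
    proof (cases b)
      case (Suc c)
      have "(1 - e w) * e' w = - (1 - e' w)" using ee[of w] by (simp add: algebra_simps)
      then have *: "(1 - e w) ^ a * (of_nat b * (1 - e' w) ^ c * \<i> * ((1 - e w) * e' w))
         = (1 - e w) ^ a * (of_nat b * (1 - e' w) ^ c * \<i> * (- (1 - e' w)))" by simp
      have "of_nat b * (1 - e' w) ^ c * (\<i> * e' w) * (1 - e w) ^ Suc a
          = (1 - e w) ^ a * (of_nat b * (1 - e' w) ^ c * \<i> * ((1 - e w) * e' w))"
        by (simp only: power_Suc mult_ac)
      also note *
      also have "(1 - e w) ^ a * (of_nat b * (1 - e' w) ^ c * \<i> * (- (1 - e' w)))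
          = - \<i> * of_nat b * (1 - e w) ^ a * (1 - e' w) ^ Suc c"
        by (simp only: power_Suc mult_ac mult_minus_left mult_minus_right)
      finally show ?thesis using Suc by simp
    qed simp
    show ?thesis
      by (rule DERIV_cong[OF DERIV_cmult_right[OF DERIV_mult[OF 1 2], of C]])
         (simp only: 3, simp only: ring_distribs mult_ac mult_minus_left mult_minus_right)
  qed
  from has_vector_derivative_real_field[OF this, of y]
  show ?thesis unfolding ch cis_e .
qed

text \<open>The derivative of charge times weight in the angle \<open>q\<close> integrates to zero.
  The first term comes from the charge, the sum from the weight; \<open>\<delta> > 0\<close> keeps
  the kernels bounded, so the terms may be integrated separately.\<close>

lemma loop_equation_reg:
  assumes "\<beta> > 0" "\<delta> > 0" "q < N"
  shows "(\<integral>x. - \<i> * (of_nat (Suc a) * cis (x q - \<theta>) + of_nat b) * charge N \<theta> a b q x * reg_weight N \<beta> \<delta> x \<partial>cbe_ref N)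
    + \<beta> / 2 * (\<Sum>k\<in>{..<N}-{q}. \<integral>x. charge N \<theta> a b (Suc q) x * reg_weight N \<beta> \<delta> x * cot_kernel \<delta> (x q - x k) \<partial>cbe_ref N) = 0"
proof -
  define A where "A x = - \<i> * (of_nat (Suc a) * cis (x q - \<theta>) + of_nat b) * charge N \<theta> a b q x * reg_weight N \<beta> \<delta> x" for x
  define B where "B k x = charge N \<theta> a b (Suc q) x * reg_weight N \<beta> \<delta> x * cot_kernel \<delta> (x q - x k)" for k x
  define F' where "F' x = A x + \<beta> / 2 * (\<Sum>k\<in>{..<N}-{q}. B k x)" for x
  have A: "bounded_measurable N A"
    unfolding A_def using assms
    by (intro bounded_measurable_intros bounded_measurable_cis bounded_measurable_charge bounded_measurable_reg_weight) auto
  have B: "bounded_measurable N (B k)" if "k < N" for k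
    unfolding B_def using assms that
    by (intro bounded_measurable_intros bounded_measurable_charge bounded_measurable_reg_weight bounded_measurable_kernel) auto
  have "bounded_measurable N F'"
    unfolding F'_def by (intro bounded_measurable_intros A B) auto
  then have int: "integrable (cbe_ref N) F'"
    by (rule bounded_measurable_integrable)
  have pos: "2 - 2 * cos u + \<delta> \<noteq> 0" for u
    using assms(2) cos_gap_nonneg[of u] by linarith
  have "integral\<^sup>L (cbe_ref N) F' = 0"
  proof (rule integral_cbe_ref_periodic_derivative[where F = "\<lambda>x. charge N \<theta> a b (Suc q) x * reg_weight N \<beta> \<delta> x"])
    fix x :: "nat \<Rightarrow> real" and y :: real
    have "((\<lambda>y. charge N \<theta> a b (Suc q) (x(q := y)) * complex_of_real (reg_weight N \<beta> \<delta> (x(q := y)))) has_vector_derivative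
       charge N \<theta> a b (Suc q) (x(q := y)) * complex_of_real (reg_weight N \<beta> \<delta> (x(q := y)) *
          (\<beta> / 2 * (\<Sum>k\<in>{..<N}-{q}. cot_kernel \<delta> ((x(q := y)) q - (x(q := y)) k))))
       + - \<i> * (of_nat (Suc a) * cis (y - \<theta>) + of_nat b) * charge N \<theta> a b q (x(q := y)) * complex_of_real (reg_weight N \<beta> \<delta> (x(q := y)))) (at y)"
      by (intro has_vector_derivative_mult has_vector_derivative_charge assms
          has_vector_derivative_of_real[OF has_real_derivative_reg_weight])
    also have "charge N \<theta> a b (Suc q) (x(q := y)) * complex_of_real (reg_weight N \<beta> \<delta> (x(q := y)) *
          (\<beta> / 2 * (\<Sum>k\<in>{..<N}-{q}. cot_kernel \<delta> ((x(q := y)) q - (x(q := y)) k))))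
       + - \<i> * (of_nat (Suc a) * cis (y - \<theta>) + of_nat b) * charge N \<theta> a b q (x(q := y)) * complex_of_real (reg_weight N \<beta> \<delta> (x(q := y)))
       = F' (x(q := y))"
      unfolding F'_def A_def B_def sum_distrib_left[symmetric] of_real_mult of_real_sum by simp
    finally show "((\<lambda>y. charge N \<theta> a b (Suc q) (x(q := y)) * complex_of_real (reg_weight N \<beta> \<delta> (x(q := y)))) has_vector_derivative
        F' (x(q := y))) (at y)" .
    show "continuous_on UNIV (\<lambda>y. F' (x(q := y)))"
      unfolding F'_def A_def B_def charge_def reg_weight_def cot_kernel_def
      by (intro continuous_intros ballI) (use pos in auto)
    have cis: "cis (2 * pi - \<theta>) = cis (- \<theta>)" "cis (\<theta> - 2 * pi) = cis \<theta>"
      by (simp_all add: complex_eq_iff cos_diff sin_diff)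
    have eq: "charge N \<theta> a b (Suc q) (x(q := 2 * pi)) = charge N \<theta> a b (Suc q) (x(q := 0))"
      unfolding charge_def by (intro prod.cong refl) (auto simp: cis)
    have "reg_weight N \<beta> \<delta> (x(q := 2 * pi)) = reg_weight N \<beta> \<delta> (x(q := 0))"
      unfolding reg_weight_def by (intro prod.cong refl) (auto simp: cos_diff)
    with eq show "charge N \<theta> a b (Suc q) (x(q := 2 * pi)) * complex_of_real (reg_weight N \<beta> \<delta> (x(q := 2 * pi))) =
      charge N \<theta> a b (Suc q) (x(q := 0)) * complex_of_real (reg_weight N \<beta> \<delta> (x(q := 0)))" by simp
  qed (use assms int in auto)
  also have "integral\<^sup>L (cbe_ref N) F' = integral\<^sup>L (cbe_ref N) A + \<beta> / 2 * (\<Sum>k\<in>{..<N}-{q}. integral\<^sup>L (cbe_ref N) (B k))"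
  proof -
    have "integral\<^sup>L (cbe_ref N) F' = integral\<^sup>L (cbe_ref N) A + (\<integral>x. \<beta> / 2 * (\<Sum>k\<in>{..<N}-{q}. B k x) \<partial>cbe_ref N)"
      unfolding F'_def
      by (intro Bochner_Integration.integral_add bounded_measurable_integrable bounded_measurable_intros A B) auto
    moreover have "(\<integral>x. (\<Sum>k\<in>{..<N}-{q}. B k x) \<partial>cbe_ref N) = (\<Sum>k\<in>{..<N}-{q}. integral\<^sup>L (cbe_ref N) (B k))"
      by (intro Bochner_Integration.integral_sum bounded_measurable_integrable B) auto
    ultimately show ?thesis by (simp only: integral_mult_right_zero)
  qed
  finally show ?thesis unfolding A_def B_def by (simp only: of_real_divide of_real_numeral)
qed

text \<open>In \<open>charge N \<theta> a b (Suc q)\<close> both \<open>k\<close> and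
  \<open>q\<close> carry the additional factor, so exchanging them changes only the sign of the odd
  kernel.\<close>

lemma kernel_integral_below:
  assumes "\<beta> > 0" "\<delta> > 0" "q < N" "k < q"
  shows "(\<integral>x. charge N \<theta> a b (Suc q) x * reg_weight N \<beta> \<delta> x * cot_kernel \<delta> (x q - x k) \<partial>cbe_ref N) = 0" (is "?I = 0")
proof -
  have "bounded_measurable N (\<lambda>x. charge N \<theta> a b (Suc q) x * reg_weight N \<beta> \<delta> x * cot_kernel \<delta> (x q - x k))"
    using assms
    by (intro bounded_measurable_intros bounded_measurable_charge bounded_measurable_reg_weight bounded_measurable_kernel) auto
  then have "?I = (\<integral>x. charge N \<theta> a b (Suc q) (\<lambda>n. x (Transposition.transpose q k n))
     * reg_weight N \<beta> \<delta> (\<lambda>n. x (Transposition.transpose q k n)) * cot_kernel \<delta> (x k - x q) \<partial>cbe_ref N)"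
    using assms by (subst integral_cbe_ref_transpose[of _ N q k]) (auto simp: bounded_measurable_def)
  also have "\<dots> = (\<integral>x. - (charge N \<theta> a b (Suc q) x * reg_weight N \<beta> \<delta> x * cot_kernel \<delta> (x q - x k)) \<partial>cbe_ref N)"
    using assms by (subst charge_transpose) (auto simp: reg_weight_transpose cot_kernel_minus[of _ "x q - x k" for x, simplified])
  finally show ?thesis by simp
qed

text \<open>Now \<open>q\<close> carries the additional factor and \<open>k\<close> does not.
  Averaging the integrand with its image under the exchange leaves a difference of the two points,
  and this zero will cancel the singularity of the kernel at \<delta> = 0.\<close>

lemma kernel_integral_above:
  assumes "\<beta> > 0" "\<delta> > 0" "q < k" "k < N"
  shows "(\<integral>x. charge N \<theta> a b (Suc q) x * reg_weight N \<beta> \<delta> x * cot_kernel \<delta> (x q - x k) \<partial>cbe_ref N)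
    = (\<integral>x. charge N \<theta> a b q x * reg_weight N \<beta> \<delta> x * ((cis (x k - \<theta>) - cis (x q - \<theta>)) * cot_kernel \<delta> (x q - x k)) \<partial>cbe_ref N) / 2"
    (is "?I = ?J / 2")
proof -
  define f where "f i j x = charge N \<theta> a b q x * reg_weight N \<beta> \<delta> x * ((1 - cis (x i - \<theta>)) * cot_kernel \<delta> (x i - x j))" for i j x
  have f: "bounded_measurable N (f i j)" if "i < N" "j < N" for i j
    unfolding f_def using assms that
    by (intro bounded_measurable_intros bounded_measurable_charge bounded_measurable_reg_weight bounded_measurable_kernel
        bounded_measurable_cis) auto
  have I: "?I = integral\<^sup>L (cbe_ref N) (f q k)"
    unfolding f_def using assms by (simp add: charge_Suc mult_ac)
  also have "\<dots> = (\<integral>x. f q k (\<lambda>n. x (Transposition.transpose q k n)) \<partial>cbe_ref N)"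
    using assms f[of q k] by (intro integral_cbe_ref_transpose) (auto simp: bounded_measurable_def)
  also have "\<dots> = integral\<^sup>L (cbe_ref N) (f k q)"
    unfolding f_def using assms by (subst charge_transpose) (auto simp: reg_weight_transpose)
  finally have "?I + ?I = (\<integral>x. f q k x + f k q x \<partial>cbe_ref N)"
    using I assms by (subst Bochner_Integration.integral_add) (auto intro!: bounded_measurable_integrable f)
  also have "\<dots> = ?J"
  proof (intro Bochner_Integration.integral_cong refl)
    fix x
    have "cot_kernel \<delta> (x k - x q) = - cot_kernel \<delta> (x q - x k)"
      using cot_kernel_minus[of \<delta> "x q - x k"] by simp
    then show "f q k x + f k q x = charge N \<theta> a b q x * reg_weight N \<beta> \<delta> x * ((cis (x k - \<theta>) - cis (x q - \<theta>)) * cot_kernel \<delta> (x q - x k))"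
      by (simp add: f_def algebra_simps)
  qed
  finally show ?thesis by (simp add: mult_2_right)
qed

section \<open>Removing the regularisation\<close>

lemma reg_weight_nonneg: "0 \<le> reg_weight N \<beta> \<delta> x"
  unfolding reg_weight_def by (intro prod_nonneg) auto

text \<open>The \<open>5\<close> is the largest squared distance \<open>4\<close> plus a shift of at
  most \<open>1\<close>. The bound is uniform in \<delta> and serves as dominating constant.\<close>

lemma reg_weight_le:
  assumes "\<beta> > 0" "0 \<le> \<delta>" "\<delta> \<le> 1"
  shows "reg_weight N \<beta> \<delta> x \<le> (5 powr (\<beta> / 4)) ^ card (pairs N)"
  unfolding reg_weight_def prod_constant[symmetric]
proof (intro prod_mono conjI powr_ge_zero powr_mono2)
  fix p
  show "0 \<le> 2 - 2 * cos (x (fst p) - x (snd p)) + \<delta>" "2 - 2 * cos (x (fst p) - x (snd p)) + \<delta> \<le> 5"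
    using assms cos_ge_minus_one[of "x (fst p) - x (snd p)"] cos_gap_nonneg[of "x (fst p) - x (snd p)"]
    by linarith+
qed (use assms in auto)

lemma tendsto_reg_weight:
  assumes "\<beta> > 0"
  shows "(\<lambda>n. reg_weight N \<beta> (inverse (real (Suc n))) x) \<longlonglongrightarrow> reg_weight N \<beta> 0 x"
  unfolding reg_weight_def
proof (intro tendsto_prod tendsto_powr' tendsto_add tendsto_const LIMSEQ_inverse_real_of_nat)
  fix p
  have "0 \<le> 2 - 2 * cos (x (fst p) - x (snd p)) + inverse (real (Suc n))" for n
    using cos_gap_nonneg[of "x (fst p) - x (snd p)"] by (intro add_nonneg_nonneg) auto
  \<comment> \<open>At coincident angles the base tends to \<open>0\<close> through nonnegative
    values, where a positive exponent keeps \<open>powr\<close> continuous; this is the second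
    disjunct.\<close>
  then show "2 - 2 * cos (x (fst p) - x (snd p)) + 0 \<noteq> 0 \<or> 0 < \<beta> / 4 \<and>
      (\<forall>\<^sub>F n in sequentially. 0 \<le> 2 - 2 * cos (x (fst p) - x (snd p)) + inverse (real (Suc n)))"
    using assms by auto
qed

text \<open>With m the distance of the two points, m^2 - sin^2 = (1 - cos)^2 gives |sin| at most m.
  The product is then at most 2 m^2 / (m^2 + \<delta>), a bound independent of \<delta>, as
  dominated convergence requires.\<close>

lemma norm_cis_diff_kernel_le:
  assumes "\<delta> > 0"
  shows "norm ((cis (s - \<theta>) - cis (t - \<theta>)) * cot_kernel \<delta> (t - s)) \<le> 2"
proof -
  define m where "m = cmod (cis (s - \<theta>) - cis (t - \<theta>))"
  have m2: "m\<^sup>2 = 2 - 2 * cos (t - s)"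
    unfolding m_def cmod_cis_diff_squared by (simp add: cos_diff mult_ac)
  have "(sin (t - s))\<^sup>2 \<le> m\<^sup>2"
    using zero_le_power2[of "1 - cos (t - s)"] unfolding m2 sin_squared_eq
    by (simp add: power2_eq_square algebra_simps)
  then have sin: "\<bar>sin (t - s)\<bar> \<le> m"
    by (rule power2_le_imp_le[of "\<bar>sin (t - s)\<bar>", simplified]) (simp add: m_def)
  have "norm ((cis (s - \<theta>) - cis (t - \<theta>)) * cot_kernel \<delta> (t - s)) = m * (2 * \<bar>sin (t - s)\<bar>) / (m\<^sup>2 + \<delta>)"
    unfolding norm_mult cot_kernel_def m2 using assms cos_gap_nonneg[of "t - s"]
    by (simp only: m_def[symmetric] norm_of_real abs_divide abs_mult) simp
  also have "\<dots> \<le> m * (2 * m) / (m\<^sup>2 + \<delta>)"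
    using sin assms by (intro divide_right_mono mult_left_mono) (auto simp: m_def)
  also have "\<dots> \<le> 2"
    using assms by (simp add: field_simps power2_eq_square add_pos_nonneg add_nonneg_pos)
  finally show ?thesis .
qed

text \<open>For u = t - s this is (1 - exp(iu)) cot(u/2) = - i (1 + exp(iu)). The singular kernel
  disappears, so the limiting loop equation contains charge integrals only.\<close>

lemma cis_diff_kernel:
  assumes "cos (t - s) \<noteq> 1"
  shows "(cis (s - \<theta>) - cis (t - \<theta>)) * cot_kernel 0 (t - s) = - \<i> * (cis (t - \<theta>) + cis (s - \<theta>))"
proof -
  define u where "u = t - s"
  have t: "cis (t - \<theta>) = cis (s - \<theta>) * cis u" by (simp add: cis_mult u_def)
  have u: "cos u * cos u + sin u * sin u = 1" using sin_cos_squared_add[of u] by (simp add: power2_eq_square)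
  then have u2: "cos u * (cos u * 2) + sin u * (sin u * 2) = 2" by linarith
  have "(1 - cis u) * (2 * sin u) = - \<i> * (1 + cis u) * (2 - 2 * cos u)"
    using u2 by (simp add: complex_eq_iff algebra_simps)
  moreover have "2 - 2 * complex_of_real (cos u) \<noteq> 0"
    using assms by (simp add: u_def complex_eq_iff)
  ultimately have "(1 - cis u) * cot_kernel 0 u = - \<i> * (1 + cis u)"
    by (simp add: cot_kernel_def field_simps)
  then have "cis (s - \<theta>) * ((1 - cis u) * cot_kernel 0 u) = cis (s - \<theta>) * (- \<i> * (1 + cis u))" by simp
  then show ?thesis unfolding t u_def[symmetric] by (simp add: algebra_simps)
qed

lemma tendsto_integral_reg_weight:
  assumes "\<beta> > 0" "bounded_measurable N f"
  shows "(\<lambda>n. \<integral>x. f x * reg_weight N \<beta> (inverse (real (Suc n))) x \<partial>cbe_ref N)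
      \<longlonglongrightarrow> (\<integral>x. f x * reg_weight N \<beta> 0 x \<partial>cbe_ref N)"
proof -
  obtain C where C: "\<And>x. norm (f x) \<le> C"
    using assms by (auto simp: bounded_measurable_def bounded_iff)
  have [measurable]: "f \<in> borel_measurable (cbe_ref N)"
    using assms by (simp add: bounded_measurable_def)
  have [measurable]: "(\<lambda>x. complex_of_real (reg_weight N \<beta> \<delta> x)) \<in> borel_measurable (cbe_ref N)" if "\<delta> \<ge> 0" for \<delta>
    using bounded_measurable_reg_weight[of \<beta> \<delta> N] assms that by (simp add: bounded_measurable_def)
  show ?thesis
  proof (rule integral_dominated_convergence[where w = "\<lambda>_. C * (5 powr (\<beta> / 4)) ^ card (pairs N)"])
    show "integrable (cbe_ref N) (\<lambda>_. C * (5 powr (\<beta> / 4)) ^ card (pairs N))"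
      by (rule finite_measure.integrable_const[OF finite_measure_cbe_ref])
    show "AE x in cbe_ref N. (\<lambda>n. f x * reg_weight N \<beta> (inverse (real (Suc n))) x) \<longlonglongrightarrow> f x * reg_weight N \<beta> 0 x"
      by (intro AE_I2 tendsto_intros tendsto_reg_weight assms)
    fix n
    have "norm (f x * reg_weight N \<beta> (inverse (real (Suc n))) x) \<le> C * (5 powr (\<beta> / 4)) ^ card (pairs N)" for x
      unfolding norm_mult using C reg_weight_nonneg assms(1)
      by (intro mult_mono) (auto simp: field_simps intro!: reg_weight_le order_trans[OF norm_ge_zero C])
    then show "AE x in cbe_ref N. norm (f x * reg_weight N \<beta> (inverse (real (Suc n))) x) \<le> C * (5 powr (\<beta> / 4)) ^ card (pairs N)"
      by simp
  qed auto
qed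

lemma tendsto_integral_reg_weight_kernel:
  assumes "\<beta> > 0" "bounded_measurable N f" "q < N" "k < N" "q \<noteq> k"
  defines "\<delta> \<equiv> \<lambda>n. inverse (real (Suc n))"
  shows "(\<lambda>n. \<integral>x. f x * reg_weight N \<beta> (\<delta> n) x * ((cis (x k - \<theta>) - cis (x q - \<theta>)) * cot_kernel (\<delta> n) (x q - x k)) \<partial>cbe_ref N)
      \<longlonglongrightarrow> (\<integral>x. f x * reg_weight N \<beta> 0 x * (- \<i> * (cis (x q - \<theta>) + cis (x k - \<theta>))) \<partial>cbe_ref N)"
proof -
  obtain C where C: "\<And>x. norm (f x) \<le> C"
    using assms by (auto simp: bounded_measurable_def bounded_iff)
  let ?C = "(C * (5 powr (\<beta> / 4)) ^ card (pairs N)) * 2"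
  have \<delta>: "\<delta> n > 0" "\<delta> n \<le> 1" for n by (auto simp: \<delta>_def field_simps)
  show ?thesis
  proof (rule integral_dominated_convergence[where w = "\<lambda>_. ?C"])
    show "integrable (cbe_ref N) (\<lambda>_. ?C)"
      by (rule finite_measure.integrable_const[OF finite_measure_cbe_ref])
    show "AE x in cbe_ref N. (\<lambda>n. f x * reg_weight N \<beta> (\<delta> n) x * ((cis (x k - \<theta>) - cis (x q - \<theta>)) * cot_kernel (\<delta> n) (x q - x k)))
       \<longlonglongrightarrow> f x * reg_weight N \<beta> 0 x * (- \<i> * (cis (x q - \<theta>) + cis (x k - \<theta>)))"
    proof (rule AE_I2)
      fix x
      show "(\<lambda>n. f x * reg_weight N \<beta> (\<delta> n) x * ((cis (x k - \<theta>) - cis (x q - \<theta>)) * cot_kernel (\<delta> n) (x q - x k)))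
       \<longlonglongrightarrow> f x * reg_weight N \<beta> 0 x * (- \<i> * (cis (x q - \<theta>) + cis (x k - \<theta>)))"
      proof (cases "cos (x q - x k) = 1")
        case True
        then have "(cmod (cis (x k - \<theta>) - cis (x q - \<theta>)))\<^sup>2 = 0"
          unfolding cmod_cis_diff_squared by (simp add: cos_diff mult_ac)
        then have 1: "cis (x k - \<theta>) - cis (x q - \<theta>) = 0" by simp
        have "reg_weight N \<beta> 0 x = 0"
          unfolding reg_weight_def using assms True
          by (intro prod_zero) (auto simp: pairs_def intro!: bexI[of _ "(q, k)"] finite_pairs[unfolded pairs_def])
        with 1 show ?thesis by simp
      next
        case False
        then have nz: "2 - 2 * cos (x q - x k) + 0 \<noteq> 0" by simp
        have "(\<lambda>n. cot_kernel (\<delta> n) (x q - x k)) \<longlonglongrightarrow> cot_kernel 0 (x q - x k)"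
          unfolding cot_kernel_def \<delta>_def by (intro tendsto_intros LIMSEQ_inverse_real_of_nat nz)
        then show ?thesis
          unfolding cis_diff_kernel[OF False, symmetric] \<delta>_def
          by (intro tendsto_intros tendsto_reg_weight assms(1))
      qed
    qed
    fix n
    have "norm (f x * reg_weight N \<beta> (\<delta> n) x * ((cis (x k - \<theta>) - cis (x q - \<theta>)) * cot_kernel (\<delta> n) (x q - x k))) \<le> ?C" for x
    proof -
      have "norm (f x * reg_weight N \<beta> (\<delta> n) x) \<le> C * (5 powr (\<beta> / 4)) ^ card (pairs N)"
        unfolding norm_mult using C reg_weight_nonneg assms(1) \<delta>[of n]
        by (intro mult_mono) (auto intro!: reg_weight_le order_trans[OF norm_ge_zero C])
      then show ?thesis
        unfolding norm_mult[of "f x * reg_weight N \<beta> (\<delta> n) x"]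
        by (intro mult_mono norm_cis_diff_kernel_le \<delta>) (auto intro: order_trans[OF norm_ge_zero])
    qed
    then show "AE x in cbe_ref N. norm (f x * reg_weight N \<beta> (\<delta> n) x * ((cis (x k - \<theta>) - cis (x q - \<theta>)) * cot_kernel (\<delta> n) (x q - x k))) \<le> ?C"
      by simp
    have "bounded_measurable N (\<lambda>x. f x * reg_weight N \<beta> (\<delta> n) x * ((cis (x k - \<theta>) - cis (x q - \<theta>)) * cot_kernel (\<delta> n) (x q - x k)))"
      using \<delta>[of n] assms(1-4)
      by (intro bounded_measurable_intros bounded_measurable_cis bounded_measurable_reg_weight bounded_measurable_kernel) auto
    then show "(\<lambda>x. f x * reg_weight N \<beta> (\<delta> n) x * ((cis (x k - \<theta>) - cis (x q - \<theta>)) * cot_kernel (\<delta> n) (x q - x k)))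
        \<in> borel_measurable (cbe_ref N)"
      by (simp add: bounded_measurable_def)
    have "bounded_measurable N (\<lambda>x. f x * reg_weight N \<beta> 0 x * (- \<i> * (cis (x q - \<theta>) + cis (x k - \<theta>))))"
      using assms(1-4) by (intro bounded_measurable_intros bounded_measurable_cis bounded_measurable_reg_weight) auto
    then show "(\<lambda>x. f x * reg_weight N \<beta> 0 x * (- \<i> * (cis (x q - \<theta>) + cis (x k - \<theta>)))) \<in> borel_measurable (cbe_ref N)"
      by (simp add: bounded_measurable_def)
  qed
qed

text \<open>The loop equation is taken to the limit \<delta> = 0. The \<open>N - Suc q\<close>
  points above \<open>q\<close> do not carry the additional factor, so they are exchangeable with
  \<open>q\<close>, and inserting any one of them into the integral gives
  \<open>A q - A (Suc q)\<close>. All terms are thus combinations of \<open>A q\<close> and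
  \<open>A (Suc q)\<close>.\<close>

lemma charge_integral_recursion:
  fixes \<theta> :: real and a b :: nat and A :: "nat \<Rightarrow> complex"
  assumes "\<beta> > 0" "q < N"
  defines "A \<equiv> \<lambda>q. \<integral>x. charge N \<theta> a b q x * cbe_weight N \<beta> x \<partial>cbe_ref N"
  shows "(real (Suc a) + \<beta> / 2 * real (N - Suc q)) * A (Suc q) = (real (Suc (a + b)) + \<beta> / 2 * real (N - Suc q)) * A q"
proof -
  define z where "z j x = cis (x j - \<theta>)" for j and x :: "nat \<Rightarrow> real"
  define G where "G = charge N \<theta> a b q"
  define W where "W = reg_weight N \<beta> 0"
  define \<delta> where "\<delta> n = inverse (real (Suc n))" for n
  define I :: "((nat \<Rightarrow> real) \<Rightarrow> complex) \<Rightarrow> complex" where "I = integral\<^sup>L (cbe_ref N)"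
  have bm: "bounded_measurable N G" "\<And>j. j < N \<Longrightarrow> bounded_measurable N (z j)" "bounded_measurable N (\<lambda>x. W x)"
    unfolding G_def z_def[abs_def] W_def using assms(1)
    by (auto intro!: bounded_measurable_charge bounded_measurable_cis bounded_measurable_reg_weight)
  have A: "A q = I (\<lambda>x. G x * W x)" "A (Suc q) = I (\<lambda>x. (1 - z q x) * G x * W x)"
    unfolding A_def G_def W_def reg_weight_0 z_def I_def using assms(2) by (simp_all add: charge_Suc)
  have zq: "I (\<lambda>x. G x * W x * z q x) = A q - A (Suc q)"
  proof -
    have "I (\<lambda>x. G x * W x - (1 - z q x) * G x * W x) = A q - A (Suc q)"
      unfolding A I_def using assms(2)
      by (intro Bochner_Integration.integral_diff bounded_measurable_integrable bounded_measurable_intros bm)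
    moreover have "(\<lambda>x. G x * W x - (1 - z q x) * G x * W x) = (\<lambda>x. G x * W x * z q x)"
      by (auto simp: algebra_simps)
    ultimately show ?thesis by simp
  qed
  have zk: "I (\<lambda>x. G x * W x * z k x) = I (\<lambda>x. G x * W x * z q x)" if "k < N" "q < k" for k
  proof -
    have "bounded_measurable N (\<lambda>x. G x * W x * z k x)" using that by (intro bounded_measurable_intros bm)
    then have "I (\<lambda>x. G x * W x * z k x) = I (\<lambda>x. G (\<lambda>n. x (Transposition.transpose q k n)) * W (\<lambda>n. x (Transposition.transpose q k n)) * z q x)"
      unfolding I_def using that assms(2)
      by (subst integral_cbe_ref_transpose[of _ N q k]) (auto simp: bounded_measurable_def z_def)
    then show ?thesis
      using that assms(2) by (simp add: G_def W_def charge_transpose reg_weight_transpose)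
  qed
  define P where "P n = I (\<lambda>x. - \<i> * (of_nat (Suc a) * z q x + of_nat b) * G x * reg_weight N \<beta> (\<delta> n) x)" for n
  define Q where "Q k n = I (\<lambda>x. G x * reg_weight N \<beta> (\<delta> n) x * ((z k x - z q x) * cot_kernel (\<delta> n) (x q - x k)))" for k n
  have loop: "P n + \<beta> / 2 * (\<Sum>k\<in>{q<..<N}. Q k n / 2) = 0" for n
  proof -
    have \<delta>: "\<delta> n > 0" by (simp add: \<delta>_def)
    have "(\<Sum>k\<in>{..<N}-{q}. I (\<lambda>x. charge N \<theta> a b (Suc q) x * reg_weight N \<beta> (\<delta> n) x * cot_kernel (\<delta> n) (x q - x k)))
       = (\<Sum>k\<in>{q<..<N}. Q k n / 2)"
    proof (rule sum.mono_neutral_cong_right)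
      show "\<forall>k\<in>{..<N} - {q} - {q<..<N}. I (\<lambda>x. charge N \<theta> a b (Suc q) x * reg_weight N \<beta> (\<delta> n) x * cot_kernel (\<delta> n) (x q - x k)) = 0"
        unfolding I_def by (intro ballI kernel_integral_below \<delta> assms(1,2)) auto
      fix k assume "k \<in> {q<..<N}"
      then show "I (\<lambda>x. charge N \<theta> a b (Suc q) x * reg_weight N \<beta> (\<delta> n) x * cot_kernel (\<delta> n) (x q - x k)) = Q k n / 2"
        unfolding I_def Q_def G_def z_def by (intro kernel_integral_above \<delta> assms(1)) auto
    qed (use assms(2) in auto)
    then show ?thesis
      using loop_equation_reg[OF assms(1) \<delta> assms(2), of a \<theta> b]
      unfolding P_def G_def z_def I_def by simp
  qed
  have P: "P \<longlonglongrightarrow> I (\<lambda>x. - \<i> * (of_nat (Suc a) * z q x + of_nat b) * G x * W x)"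
    unfolding P_def I_def W_def \<delta>_def
    by (intro tendsto_integral_reg_weight assms(1) bounded_measurable_intros bm assms(2))
  have Q0: "Q k \<longlonglongrightarrow> I (\<lambda>x. G x * W x * (- \<i> * (z q x + z k x)))" if "k \<in> {q<..<N}" for k
    unfolding Q_def I_def W_def z_def \<delta>_def using that assms(2)
    by (intro tendsto_integral_reg_weight_kernel assms(1) bm) auto
  have Q': "I (\<lambda>x. G x * W x * (- \<i> * (z q x + z k x))) = - 2 * \<i> * (A q - A (Suc q))" if "k \<in> {q<..<N}" for k
  proof -
    have "I (\<lambda>x. G x * W x * (- \<i> * (z q x + z k x))) = I (\<lambda>x. - \<i> * (G x * W x * z q x + G x * W x * z k x))"
      by (simp add: algebra_simps)
    also have "\<dots> = - \<i> * (I (\<lambda>x. G x * W x * z q x) + I (\<lambda>x. G x * W x * z k x))"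
      unfolding I_def using that assms(2)
      by (subst integral_mult_right_zero, subst Bochner_Integration.integral_add)
         (auto intro!: bounded_measurable_integrable bounded_measurable_intros bm)
    finally show ?thesis using zk[of k] zq that by simp
  qed
  have Q: "Q k \<longlonglongrightarrow> - 2 * \<i> * (A q - A (Suc q))" if "k \<in> {q<..<N}" for k
    using Q0[OF that] unfolding Q'[OF that] .
  have P': "I (\<lambda>x. - \<i> * (of_nat (Suc a) * z q x + of_nat b) * G x * W x)
      = - \<i> * (of_nat (Suc a) * (A q - A (Suc q)) + of_nat b * A q)"
  proof -
    have "I (\<lambda>x. - \<i> * (of_nat (Suc a) * z q x + of_nat b) * G x * W x)
       = I (\<lambda>x. - \<i> * (of_nat (Suc a) * (G x * W x * z q x) + of_nat b * (G x * W x)))"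
      by (intro arg_cong[of _ _ I] ext) (simp add: algebra_simps)
    also have "\<dots> = - \<i> * (of_nat (Suc a) * I (\<lambda>x. G x * W x * z q x) + of_nat b * I (\<lambda>x. G x * W x))"
      unfolding I_def using assms(2)
      by (subst integral_mult_right_zero, subst Bochner_Integration.integral_add)
         (auto intro!: bounded_measurable_integrable bounded_measurable_intros bm)
    finally show ?thesis using zq A by simp
  qed
  have "(\<lambda>n. P n + \<beta> / 2 * (\<Sum>k\<in>{q<..<N}. Q k n / 2)) \<longlonglongrightarrow>
      - \<i> * (of_nat (Suc a) * (A q - A (Suc q)) + of_nat b * A q)
        + \<beta> / 2 * (\<Sum>k\<in>{q<..<N}. (- 2 * \<i> * (A q - A (Suc q))) / 2)"
    using P Q unfolding P' by (intro tendsto_intros) auto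
  then have "- \<i> * (of_nat (Suc a) * (A q - A (Suc q)) + of_nat b * A q)
        + \<beta> / 2 * (\<Sum>k\<in>{q<..<N}. (- 2 * \<i> * (A q - A (Suc q))) / 2) = 0"
    unfolding loop by (simp add: LIMSEQ_const_iff)
  then have "- \<i> * (of_nat (Suc a) * (A q - A (Suc q)) + of_nat b * A q
      + \<beta> / 2 * of_nat (N - Suc q) * (A q - A (Suc q))) = 0"
    by (simp add: algebra_simps)
  then have "of_nat (Suc a) * (A q - A (Suc q)) + of_nat b * A q + \<beta> / 2 * of_nat (N - Suc q) * (A q - A (Suc q)) = 0"
    by (simp only: mult_eq_0_iff) simp
  then have "(of_nat (Suc a) + of_nat b + \<beta> / 2 * of_nat (N - Suc q)) * A q - (of_nat (Suc a) + \<beta> / 2 * of_nat (N - Suc q)) * A (Suc q) = 0"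
    by (simp only: of_real_add of_real_of_nat_eq) algebra
  then show ?thesis by (simp add: add.assoc)
qed

section \<open>Moments from the recursion\<close>

definition charge_integral :: "nat \<Rightarrow> real \<Rightarrow> real \<Rightarrow> nat \<Rightarrow> nat \<Rightarrow> complex" where
  "charge_integral N \<beta> \<theta> a b = (\<integral>x. charge N \<theta> a b 0 x * cbe_weight N \<beta> x \<partial>cbe_ref N)"

text \<open>One round of the recursion through all points, closed by \<open>charge_shift\<close>.
  Its factors come in decreasing order of \<open>j = N - Suc q\<close>, so the product is reversed
  at the end.\<close>

lemma charge_integral_Suc:
  assumes "\<beta> > 0"
  shows "charge_integral N \<beta> \<theta> (Suc a) b =
    of_real (\<Prod>j<N. (real (Suc (a + b)) + \<beta> / 2 * real j) / (real (Suc a) + \<beta> / 2 * real j)) * charge_integral N \<beta> \<theta> a b"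
proof -
  define A where "A q = (\<integral>x. charge N \<theta> a b q x * cbe_weight N \<beta> x \<partial>cbe_ref N)" for q
  define r where "r j = (real (Suc (a + b)) + \<beta> / 2 * real j) / (real (Suc a) + \<beta> / 2 * real j)" for j
  have step: "A (Suc q) = of_real (r (N - Suc q)) * A q" if "q < N" for q
  proof -
    have pos: "real (Suc a) + \<beta> / 2 * real (N - Suc q) > 0"
      using assms by (intro add_pos_nonneg) auto
    have "(real (Suc a) + \<beta> / 2 * real (N - Suc q)) * A (Suc q) = (real (Suc (a + b)) + \<beta> / 2 * real (N - Suc q)) * A q"
      using charge_integral_recursion[OF assms that, of a \<theta> b] unfolding A_def .
    moreover have "complex_of_real (real (Suc a) + \<beta> / 2 * real (N - Suc q)) \<noteq> 0"
      using pos by (simp only: of_real_eq_0_iff)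
    ultimately show ?thesis
      unfolding r_def of_real_divide times_divide_eq_left by (subst eq_divide_eq) (simp only: mult.commute if_True not_False_eq_True)
  qed
  have "A q = of_real (\<Prod>j<q. r (N - Suc j)) * A 0" if "q \<le> N" for q
    using that by (induction q) (auto simp: step mult_ac)
  from this[of N] have "A N = of_real (\<Prod>j<N. r (N - Suc j)) * A 0" by simp
  also have "(\<Prod>j<N. r (N - Suc j)) = (\<Prod>j<N. r j)"
    by (rule prod.nat_diff_reindex)
  finally show ?thesis
    by (simp add: A_def charge_integral_def r_def charge_shift)
qed

lemma cnj_charge_integral: "cnj (charge_integral N \<beta> \<theta> a b) = charge_integral N \<beta> \<theta> b a"
proof -
  have "cnj (charge N \<theta> a b 0 x * cbe_weight N \<beta> x) = charge N \<theta> b a 0 x * cbe_weight N \<beta> x" for x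
    by (simp add: charge_def cis_cnj mult_ac)
  then have "charge_integral N \<beta> \<theta> b a = (\<integral>x. cnj (charge N \<theta> a b 0 x * cbe_weight N \<beta> x) \<partial>cbe_ref N)"
    unfolding charge_integral_def by (simp only:)
  then show ?thesis by (simp only: Bochner_Integration.integral_cnj charge_integral_def)
qed

text \<open>The recursion raises only the first exponent, and complex conjugation exchanges the two.
  The route is (k, k) to (k+1, k), by conjugation to (k, k+1), and on to (k+1, k+1); the factors are
  real, so conjugation leaves them alone.\<close>

lemma charge_integral_diag_Suc:
  assumes "\<beta> > 0"
  shows "charge_integral N \<beta> \<theta> (Suc k) (Suc k) =
    of_real (\<Prod>j<N. (real (2 * k + 1) + \<beta> / 2 * real j) * (real (2 * k + 2) + \<beta> / 2 * real j) / (real (k + 1) + \<beta> / 2 * real j)\<^sup>2)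
      * charge_integral N \<beta> \<theta> k k"
proof -
  have "charge_integral N \<beta> \<theta> k (Suc k) = cnj (charge_integral N \<beta> \<theta> (Suc k) k)"
    by (simp add: cnj_charge_integral)
  also have "\<dots> = of_real (\<Prod>j<N. (real (Suc (k + k)) + \<beta> / 2 * real j) / (real (Suc k) + \<beta> / 2 * real j)) * charge_integral N \<beta> \<theta> k k"
    unfolding charge_integral_Suc[OF assms] by (simp add: cnj_charge_integral)
  finally have 1: "charge_integral N \<beta> \<theta> k (Suc k) = \<dots>" .
  have "(\<Prod>j<N. (real (Suc (k + Suc k)) + \<beta> / 2 * real j) / (real (Suc k) + \<beta> / 2 * real j)) *
      (\<Prod>j<N. (real (Suc (k + k)) + \<beta> / 2 * real j) / (real (Suc k) + \<beta> / 2 * real j)) =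
      (\<Prod>j<N. (real (2 * k + 1) + \<beta> / 2 * real j) * (real (2 * k + 2) + \<beta> / 2 * real j) / (real (k + 1) + \<beta> / 2 * real j)\<^sup>2)"
    unfolding prod.distrib[symmetric]
  proof (intro prod.cong refl)
    fix j
    have eq: "Suc (k + Suc k) = 2 * k + 2" "Suc (k + k) = 2 * k + 1" by simp_all
    show "(real (Suc (k + Suc k)) + \<beta> / 2 * real j) / (real (Suc k) + \<beta> / 2 * real j) *
         ((real (Suc (k + k)) + \<beta> / 2 * real j) / (real (Suc k) + \<beta> / 2 * real j)) =
         (real (2 * k + 1) + \<beta> / 2 * real j) * (real (2 * k + 2) + \<beta> / 2 * real j) / (real (k + 1) + \<beta> / 2 * real j)\<^sup>2"
      unfolding eq unfolding times_divide_times_eq power2_eq_square Suc_eq_plus1 by (simp only: mult.commute)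
  qed
  then show ?thesis
    unfolding charge_integral_Suc[OF assms, of N \<theta> k "Suc k"] 1 mult.assoc[symmetric] of_real_mult[symmetric] by simp
qed

section \<open>The ensemble as a probability space\<close>

lemma cbe_weight_nonneg: "0 \<le> cbe_weight N \<beta> x"
  unfolding cbe_weight_def by (intro prod_nonneg) auto

lemma integrable_cbe_weight_mult:
  assumes "\<beta> > 0" "bounded_measurable N (\<lambda>x. complex_of_real (f x))"
  shows "integrable (cbe_ref N) (\<lambda>x. f x * cbe_weight N \<beta> x)"
proof -
  have "integrable (cbe_ref N) (\<lambda>x. complex_of_real (f x) * complex_of_real (reg_weight N \<beta> 0 x))"
    using assms by (intro bounded_measurable_integrable bounded_measurable_mult bounded_measurable_reg_weight) auto
  from integrable_Re[OF this] show ?thesis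
    by (simp add: reg_weight_0)
qed

text \<open>Put the angle \<open>j\<close> into the open arc \<open>J j\<close>, one of
  \<open>N\<close> equal disjoint arcs. The points are then distinct and the weight is nonzero, on a
  box of positive measure.\<close>

lemma cbe_norm_pos:
  assumes "\<beta> > 0"
  shows "cbe_norm N \<beta> > 0"
proof -
  let ?w = "cbe_weight N \<beta>"
  have int: "integrable (cbe_ref N) ?w"
    using integrable_cbe_weight_mult[OF assms, of N "\<lambda>_. 1"] bounded_measurable_const by simp
  define J where "J j = {2 * pi * real j / real N <..< 2 * pi * real (Suc j) / real N}" for j
  define B where "B = Pi\<^sub>E {..<N} J"
  have Jsub: "J j \<subseteq> {0..<2*pi}" if "j < N" for j
  proof
    fix t assume t: "t \<in> J j"
    have "0 \<le> 2 * pi * real j / real N" by simp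
    moreover have "2 * pi * real (Suc j) / real N \<le> 2 * pi * 1"
      using that unfolding times_divide_eq_right[symmetric] by (intro mult_left_mono) auto
    moreover have "2 * pi * real j / real N < t" "t < 2 * pi * real (Suc j) / real N" using t by (auto simp: J_def)
    ultimately show "t \<in> {0..<2*pi}" unfolding atLeastLessThan_iff by linarith
  qed
  have Jsets: "J j \<in> sets arc_measure" if "j < N" for j
    using Jsub[OF that] by (auto simp: sets_restrict_space J_def)
  have "emeasure (cbe_ref N) B = (\<Prod>j<N. emeasure arc_measure (J j))"
    unfolding cbe_ref_def B_def using Jsets by (intro arcs.emeasure_PiM) auto
  also have "\<dots> \<noteq> 0"
  proof -
    have "emeasure arc_measure (J j) \<noteq> 0" if "j < N" for j
    proof -
      have "2 * pi * real j / real N < 2 * pi * real (Suc j) / real N"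
        using that by (intro divide_strict_right_mono) auto
      then show ?thesis
        unfolding emeasure_arc[OF Jsets[OF that]] using that by (simp add: J_def)
    qed
    then show ?thesis by (simp add: prod_zero_iff)
  qed
  finally have B0: "emeasure (cbe_ref N) B \<noteq> 0" .
  have Bsets: "B \<in> sets (cbe_ref N)"
    unfolding cbe_ref_def B_def using Jsets by (intro sets_PiM_I_finite) auto
  have w: "?w x \<noteq> 0" if "x \<in> B" for x
  proof -
    have "cis (x j) \<noteq> cis (x k)" if jk: "j < N" "k < N" "j < k" for j k
    proof
      assume eq: "cis (x j) = cis (x k)"
      have xj: "x j \<in> J j" and xk: "x k \<in> J k" using \<open>x \<in> B\<close> jk by (auto simp: B_def PiE_iff)
      have "2 * pi * real (Suc j) / real N \<le> 2 * pi * real k / real N"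
        using jk by (intro divide_right_mono mult_left_mono) auto
      with xj xk have lt: "x j < x k" by (auto simp: J_def)
      have bounds: "0 \<le> x j" "x k < 2 * pi" using xj xk Jsub[OF jk(1)] Jsub[OF jk(2)] by auto
      have "cos (x k - x j) = 1"
        using cmod_cis_diff_squared[of "x k" "x j"] eq by simp
      then obtain n :: int where n: "x k - x j = of_int n * 2 * pi"
        by (auto simp: cos_one_2pi_int)
      with lt bounds have "0 < of_int n * (2 * pi)" "of_int n * (2 * pi) < 1 * (2 * pi)"
        unfolding mult.assoc by linarith+
      then have "0 < real_of_int n" "real_of_int n < 1"
        by (auto simp: zero_less_mult_iff mult_less_cancel_right)
      then show False by simp
    qed
    then show ?thesis by (auto simp: cbe_weight_def)
  qed
  have "integral\<^sup>L (cbe_ref N) ?w \<noteq> 0"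
  proof
    assume "integral\<^sup>L (cbe_ref N) ?w = 0"
    then have "AE x in cbe_ref N. ?w x = 0"
      using integral_nonneg_eq_0_iff_AE[OF int] cbe_weight_nonneg by simp
    then have "AE x in cbe_ref N. x \<notin> B" by eventually_elim (use w in auto)
    then have "B \<in> null_sets (cbe_ref N)" using AE_iff_null_sets[OF Bsets] by simp
    then show False using B0 by auto
  qed
  moreover have "integral\<^sup>L (cbe_ref N) ?w \<ge> 0"
    by (intro integral_nonneg_AE AE_I2 cbe_weight_nonneg)
  ultimately show ?thesis unfolding cbe_norm_def by simp
qed

lemma sets_cbe [simp]: "sets (cbe N \<beta>) = sets (cbe_ref N)"
  and space_cbe [simp]: "space (cbe N \<beta>) = space (cbe_ref N)"
  by (simp_all add: cbe_def)

lemma measurable_cbe_weight: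
  assumes "\<beta> > 0"
  shows "cbe_weight N \<beta> \<in> borel_measurable (cbe_ref N)"
  using integrable_cbe_weight_mult[OF assms, of N "\<lambda>_. 1"] bounded_measurable_const
  by (simp add: borel_measurable_integrable)

lemma integral_cbe:
  fixes f :: "(nat \<Rightarrow> real) \<Rightarrow> real"
  assumes "\<beta> > 0" "f \<in> borel_measurable (cbe_ref N)"
  shows "integral\<^sup>L (cbe N \<beta>) f = (\<integral>x. f x * cbe_weight N \<beta> x \<partial>cbe_ref N) / cbe_norm N \<beta>"
proof -
  have "integral\<^sup>L (cbe N \<beta>) f = (\<integral>x. (cbe_weight N \<beta> x / cbe_norm N \<beta>) *\<^sub>R f x \<partial>cbe_ref N)"
    unfolding cbe_def using assms cbe_norm_pos[OF assms(1), of N] measurable_cbe_weight[OF assms(1), of N]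
    by (intro integral_density) (auto intro!: divide_nonneg_pos cbe_weight_nonneg)
  also have "\<dots> = (\<integral>x. (f x * cbe_weight N \<beta> x) / cbe_norm N \<beta> \<partial>cbe_ref N)"
    by (simp add: mult_ac)
  finally show ?thesis by simp
qed

lemma prob_space_cbe:
  assumes "\<beta> > 0"
  shows "prob_space (cbe N \<beta>)"
proof
  have pos: "cbe_norm N \<beta> > 0" by (rule cbe_norm_pos[OF assms])
  have int: "integrable (cbe_ref N) (\<lambda>x. cbe_weight N \<beta> x / cbe_norm N \<beta>)"
    using integrable_cbe_weight_mult[OF assms, of N "\<lambda>_. 1"] bounded_measurable_const by simp
  have "emeasure (cbe N \<beta>) (space (cbe N \<beta>)) = (\<integral>\<^sup>+x. ennreal (cbe_weight N \<beta> x / cbe_norm N \<beta>) \<partial>cbe_ref N)"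
    unfolding space_cbe unfolding cbe_def using measurable_cbe_weight[OF assms, of N]
    by (subst emeasure_density) (auto intro!: nn_integral_cong)
  also have "\<dots> = ennreal (\<integral>x. cbe_weight N \<beta> x / cbe_norm N \<beta> \<partial>cbe_ref N)"
    using pos by (intro nn_integral_eq_integral int) (auto intro!: divide_nonneg_pos cbe_weight_nonneg)
  also have "(\<integral>x. cbe_weight N \<beta> x / cbe_norm N \<beta> \<partial>cbe_ref N) = 1"
    using pos by (simp add: cbe_norm_def[symmetric])
  finally show "emeasure (cbe N \<beta>) (space (cbe N \<beta>)) = 1" by simp
qed

definition char_ratio :: "nat \<Rightarrow> real \<Rightarrow> (nat \<Rightarrow> real) \<Rightarrow> real" where
  "char_ratio N \<theta> x = (cmod (char_poly N \<theta> x))\<^sup>2 / 4 ^ N"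

lemma measurable_char_ratio [measurable]: "char_ratio N \<theta> \<in> borel_measurable (cbe_ref N)"
proof -
  have "bounded_measurable N (\<lambda>x. \<Prod>j<N. cis \<theta> - cis (x j - 0))"
    by (intro bounded_measurable_intros bounded_measurable_cis) auto
  then have "char_poly N \<theta> \<in> borel_measurable (cbe_ref N)"
    by (simp add: bounded_measurable_def char_poly_def[abs_def])
  then show ?thesis unfolding char_ratio_def[abs_def] by measurable
qed

lemma char_ratio_bounds: "0 \<le> char_ratio N \<theta> x" "char_ratio N \<theta> x \<le> 1"
proof -
  have "cmod (char_poly N \<theta> x) \<le> (\<Prod>j<N. 2)"
    unfolding char_poly_def prod_norm[symmetric]
    by (intro prod_mono conjI norm_ge_zero order_trans[OF norm_triangle_ineq4]) auto
  then have "(cmod (char_poly N \<theta> x))\<^sup>2 \<le> (2 ^ N)\<^sup>2"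
    by (intro power_mono) auto
  also have "(2 ^ N)\<^sup>2 = (4 :: real) ^ N"
    by (simp add: power2_eq_square flip: power_mult_distrib)
  finally show "char_ratio N \<theta> x \<le> 1" by (simp add: char_ratio_def)
qed (simp add: char_ratio_def)

text \<open>With equal exponents every factor meets its conjugate, so the diagonal charge integrals
  are the unnormalised even moments of |D|.\<close>

lemma charge_diag:
  "charge N \<theta> k k 0 x = complex_of_real ((cmod (char_poly N \<theta> x))\<^sup>2 ^ k)"
proof -
  have 1: "(1 - cis (t - \<theta>)) * (1 - cis (\<theta> - t)) = complex_of_real ((cmod (cis \<theta> - cis t))\<^sup>2)" for t
  proof -
    have "1 - cis (t - \<theta>) = (cis \<theta> - cis t) * cis (- \<theta>)" "1 - cis (\<theta> - t) = cnj (cis \<theta> - cis t) * cis \<theta>"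
      by (simp_all add: left_diff_distrib cis_mult cis_cnj)
    then have "(1 - cis (t - \<theta>)) * (1 - cis (\<theta> - t)) = ((cis \<theta> - cis t) * cnj (cis \<theta> - cis t)) * (cis (- \<theta>) * cis \<theta>)"
      by (simp only: mult_ac)
    also have "cis (- \<theta>) * cis \<theta> = 1" by (simp add: cis_mult)
    finally show ?thesis by (simp only: complex_norm_square mult_1_right)
  qed
  have "charge N \<theta> k k 0 x = (\<Prod>j<N. complex_of_real ((cmod (cis \<theta> - cis (x j)))\<^sup>2) ^ k)"
    unfolding charge_def by (simp add: 1 flip: power_mult_distrib)
  then show ?thesis
    by (simp add: char_poly_def prod_power_distrib flip: prod_norm)
qed

text \<open>In the step from \<open>k\<close> to \<open>k + 1\<close> the two numerators are 2
  (\<xi>/2 + k) and 2 ((\<xi>+1)/2 + k). The factor 4 per point is absorbed by \<open>4 ^ N\<close>,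
  and the remaining quotients are those of the moments of two beta variables.\<close>

lemma moment_char_ratio:
  assumes "\<beta> > 0"
  defines "\<xi> \<equiv> \<lambda>j::nat. 1 + \<beta> / 2 * real j"
  shows "(\<integral>x. char_ratio N \<theta> x ^ k \<partial>cbe N \<beta>)
     = (\<Prod>i<k. \<Prod>j<N. (\<xi> j / 2 + real i) * ((\<xi> j + 1) / 2 + real i) / (\<xi> j + real i)\<^sup>2)"
proof -
  define P where "P k = (\<integral>x. (cmod (char_poly N \<theta> x))\<^sup>2 ^ k * cbe_weight N \<beta> x \<partial>cbe_ref N)" for k
  have P: "complex_of_real (P k) = charge_integral N \<beta> \<theta> k k" for k
    unfolding charge_integral_def charge_diag P_def by (simp flip: of_real_mult of_real_power)
  define s where "s k j = (\<xi> j / 2 + real k) * ((\<xi> j + 1) / 2 + real k) / (\<xi> j + real k)\<^sup>2" for k j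
  have step: "P (Suc k) / 4 ^ (N * Suc k) = (\<Prod>j<N. s k j) * (P k / 4 ^ (N * k))" for k
  proof -
    have "(real (2 * k + 1) + \<beta> / 2 * real j) * (real (2 * k + 2) + \<beta> / 2 * real j) / (real (k + 1) + \<beta> / 2 * real j)\<^sup>2 = 4 * s k j" for j
    proof -
      have "real (2 * k + 1) + \<beta> / 2 * real j = 2 * (\<xi> j / 2 + real k)"
           "real (2 * k + 2) + \<beta> / 2 * real j = 2 * ((\<xi> j + 1) / 2 + real k)"
           "real (k + 1) + \<beta> / 2 * real j = \<xi> j + real k"
        by (simp_all add: \<xi>_def)
      then show ?thesis unfolding s_def by (simp only:)
    qed
    then have "complex_of_real (P (Suc k)) = complex_of_real ((\<Prod>j<N. 4 * s k j) * P k)"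
      unfolding P charge_integral_diag_Suc[OF assms(1)] of_real_mult by simp
    then have "P (Suc k) = 4 ^ N * (\<Prod>j<N. s k j) * P k"
      unfolding of_real_eq_iff by (simp add: prod.distrib)
    then show ?thesis by (simp add: power_add field_simps)
  qed
  have "P k / 4 ^ (N * k) = (\<Prod>i<k. \<Prod>j<N. s i j) * P 0"
    by (induction k) (simp_all add: step mult_ac del: mult_Suc_right)
  moreover have "P 0 = cbe_norm N \<beta>" by (simp add: P_def cbe_norm_def)
  moreover have "(\<integral>x. char_ratio N \<theta> x ^ k \<partial>cbe N \<beta>) = P k / 4 ^ (N * k) / cbe_norm N \<beta>"
  proof -
    have "(\<integral>x. char_ratio N \<theta> x ^ k \<partial>cbe N \<beta>) = (\<integral>x. char_ratio N \<theta> x ^ k * cbe_weight N \<beta> x \<partial>cbe_ref N) / cbe_norm N \<beta>"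
      by (intro integral_cbe assms) measurable
    also have "(\<lambda>x. char_ratio N \<theta> x ^ k * cbe_weight N \<beta> x) = (\<lambda>x. (cmod (char_poly N \<theta> x))\<^sup>2 ^ k * cbe_weight N \<beta> x / 4 ^ (N * k))"
      by (simp add: char_ratio_def power_divide power_mult fun_eq_iff)
    finally show ?thesis by (simp add: P_def)
  qed
  ultimately show ?thesis
    using cbe_norm_pos[OF assms(1), of N] by (simp add: s_def)
qed

text \<open>The pattern \<open>\<lambda>x. x j\<close> of this rule matches every application and misleads the measurability prover.\<close>

declare measurable_component_cbe_ref [measurable del]

section \<open>Laws on the half line with prescribed Laplace transform\<close>

text \<open>Support in the unit interval bounds the k-th term of the exponential series by |t|^k /
  k!, so sum and integral may be exchanged. The moments then fix the characteristic function, hence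
  the law.\<close>

lemma char_eq_moment_series:
  assumes "real_distribution M" "AE x in M. 0 \<le> x \<and> x \<le> 1"
  shows "char M t = (\<Sum>k. (\<i> * of_real t) ^ k / fact k * of_real (\<integral>x. x ^ k \<partial>M))"
proof -
  interpret real_distribution M by fact
  define f where "f k x = (\<i> * of_real t) ^ k / fact k * complex_of_real (x ^ k)" for k and x :: real
  have norm_f: "AE x in M. norm (f k x) \<le> norm t ^ k / fact k" for k
    using assms(2)
  proof eventually_elim
    fix x :: real assume x: "0 \<le> x \<and> x \<le> 1"
    then have "\<bar>t\<bar> ^ k / fact k * x ^ k \<le> \<bar>t\<bar> ^ k / fact k * 1"
      by (intro mult_left_mono power_le_one) auto
    with x show "norm (f k x) \<le> norm t ^ k / fact k"
      by (simp add: f_def norm_mult norm_divide norm_power)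
  qed
  have int: "integrable M (f k)" for k
    by (rule integrable_const_bound[OF norm_f]) (simp add: f_def)
  have sum: "summable (\<lambda>k. norm t ^ k / fact k)" for t :: real
    using summable_exp[of "norm t"] by (simp add: divide_inverse mult.commute)
  have "char M t = (\<integral>x. (\<Sum>k. f k x) \<partial>M)"
    unfolding char_def
  proof (intro Bochner_Integration.integral_cong refl)
    fix x
    have "iexp (t * x) = (\<Sum>k. (\<i> * of_real (t * x)) ^ k /\<^sub>R fact k)"
      by (simp add: exp_def)
    also have "(\<lambda>k. (\<i> * of_real (t * x)) ^ k /\<^sub>R fact k) = (\<lambda>k. f k x)"
      by (simp add: f_def fun_eq_iff power_mult_distrib scaleR_conv_of_real divide_inverse mult_ac)
    finally show "iexp (t * x) = (\<Sum>k. f k x)" .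
  qed
  also have "\<dots> = (\<Sum>k. integral\<^sup>L M (f k))"
  proof (rule integral_suminf[OF int])
    show "AE x in M. summable (\<lambda>k. norm (f k x))"
    proof (rule AE_I2)
      fix x
      show "summable (\<lambda>k. norm (f k x))"
        using sum[of "t * x"]
        by (rule summable_cong[THEN iffD1, rotated])
           (auto simp: f_def norm_mult norm_divide norm_power power_mult_distrib abs_mult)
    qed
    show "summable (\<lambda>k. \<integral>x. norm (f k x) \<partial>M)"
    proof (rule summable_comparison_test'[OF sum[of t], of 0])
      fix k
      have "(\<integral>x. norm (f k x) \<partial>M) \<le> (\<integral>x. norm t ^ k / fact k \<partial>M)"
        by (rule integral_mono_AE[OF integrable_norm[OF int] _ norm_f]) simp
      then show "norm (\<integral>x. norm (f k x) \<partial>M) \<le> norm t ^ k / fact k"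
        using prob_space by (simp add: integral_nonneg_AE)
    qed
  qed
  also have "\<dots> = (\<Sum>k. (\<i> * of_real t) ^ k / fact k * of_real (\<integral>x. x ^ k \<partial>M))"
    unfolding f_def[abs_def] by (simp only: integral_mult_right_zero integral_complex_of_real)
  finally show ?thesis .
qed

lemma moments_determine_law:
  assumes "real_distribution M" "AE x in M. 0 \<le> x \<and> x \<le> 1"
    and "real_distribution N" "AE x in N. 0 \<le> x \<and> x \<le> 1"
    and "\<And>k. (\<integral>x. x ^ k \<partial>M) = (\<integral>x. x ^ k \<partial>N)"
  shows "M = N"
  by (rule Levy_uniqueness)
     (use assms in \<open>auto simp: char_eq_moment_series[OF assms(1,2)] char_eq_moment_series[OF assms(3,4)]\<close>)

text \<open>Only natural arguments of the Laplace transform are recorded: they are the moments of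
  \<open>exp (- y)\<close>, a variable in the unit interval, and so determine the law.\<close>

definition has_laplace :: "real measure \<Rightarrow> (nat \<Rightarrow> real) \<Rightarrow> bool" where
  "has_laplace \<mu> c \<longleftrightarrow> real_distribution \<mu> \<and> (AE y in \<mu>. 0 \<le> y) \<and> (\<forall>k. (\<integral>y. exp (- (real k * y)) \<partial>\<mu>) = c k)"

text \<open>The bound is asked for almost everywhere only, because
  \<open>exp (- (real k * y))\<close> is bounded just on the half line that carries the
  laws.\<close>

lemma integral_convolution:
  fixes f :: "real \<Rightarrow> real"
  assumes "real_distribution M" "real_distribution N"
    and [measurable]: "f \<in> borel_measurable borel"
    and bounded: "AE x in M. AE y in N. \<bar>f (x + y)\<bar> \<le> C"
  shows "(\<integral>x. f x \<partial>(M \<star> N)) = (\<integral>x. (\<integral>y. f (x + y) \<partial>N) \<partial>M)"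
proof -
  interpret M: real_distribution M by fact
  interpret N: real_distribution N by fact
  interpret pair_prob_space M N ..
  have "{z \<in> space (M \<Otimes>\<^sub>M N). \<bar>f (fst z + snd z)\<bar> \<le> C} \<in> sets (M \<Otimes>\<^sub>M N)"
    by measurable
  from AE_pair_iff[OF this] bounded have "AE z in M \<Otimes>\<^sub>M N. \<bar>f (fst z + snd z)\<bar> \<le> C"
    by simp
  then have int: "integrable (M \<Otimes>\<^sub>M N) (\<lambda>(x, y). f (x + y))"
    by (intro integrable_const_bound[of _ C]) (auto simp: case_prod_unfold)
  have "(\<integral>x. f x \<partial>(M \<star> N)) = (\<integral>z. f (fst z + snd z) \<partial>(M \<Otimes>\<^sub>M N))"
    unfolding convolution_def by (subst integral_distr) (auto simp: case_prod_unfold)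
  also have "\<dots> = (\<integral>x. (\<integral>y. f (x + y) \<partial>N) \<partial>M)"
    using integral_fst[OF int] by (simp add: case_prod_unfold)
  finally show ?thesis .
qed

lemma real_distribution_convolution:
  assumes "real_distribution M" "real_distribution N"
  shows "real_distribution (M \<star> N)"
proof -
  interpret M: real_distribution M by fact
  interpret N: real_distribution N by fact
  interpret pair_prob_space M N ..
  show ?thesis
    unfolding convolution_def by (intro real_distribution_distr) simp
qed

lemma has_laplace_convolution:
  assumes "has_laplace M c" "has_laplace N d"
  shows "has_laplace (M \<star> N) (\<lambda>k. c k * d k)"
proof -
  interpret M: real_distribution M using assms by (simp add: has_laplace_def)
  interpret N: real_distribution N using assms by (simp add: has_laplace_def)
  interpret pair_prob_space M N ..
  have M: "AE x in M. 0 \<le> x" and N: "AE x in N. 0 \<le> x" using assms by (auto simp: has_laplace_def)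
  have MN: "AE x in M. AE y in N. 0 \<le> x + y"
    using M
  proof eventually_elim
    fix x :: real assume "0 \<le> x"
    then show "AE y in N. 0 \<le> x + y" using N by (auto elim!: eventually_mono)
  qed
  have "{z \<in> space (M \<Otimes>\<^sub>M N). 0 \<le> fst z + snd z} \<in> sets (M \<Otimes>\<^sub>M N)"
    by measurable
  from AE_pair_iff[OF this] MN have "AE z in M \<Otimes>\<^sub>M N. 0 \<le> fst z + snd z"
    by simp
  then have "AE z in M \<star> N. 0 \<le> z"
    unfolding convolution_def by (subst AE_distr_iff) (auto simp: case_prod_unfold)
  moreover have "(\<integral>y. exp (- (real k * y)) \<partial>(M \<star> N)) = c k * d k" for k
  proof -
    have "AE x in M. AE y in N. \<bar>exp (- (real k * (x + y)))\<bar> \<le> 1"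
      using MN by eventually_elim (auto elim!: eventually_mono)
    then have "(\<integral>y. exp (- (real k * y)) \<partial>(M \<star> N)) = (\<integral>x. (\<integral>y. exp (- (real k * (x + y))) \<partial>N) \<partial>M)"
      by (intro integral_convolution[where C = 1] M.real_distribution_axioms N.real_distribution_axioms) auto
    also have "\<dots> = (\<integral>x. exp (- (real k * x)) * (\<integral>y. exp (- (real k * y)) \<partial>N) \<partial>M)"
    proof -
      have "exp (- (real k * (x + y))) = exp (- (real k * x)) * exp (- (real k * y))" for x y
        by (simp add: mult_exp_exp algebra_simps)
      then show ?thesis by simp
    qed
    also have "\<dots> = c k * d k" using assms by (simp add: has_laplace_def)
    finally show ?thesis .
  qed
  ultimately show ?thesis
    by (simp add: has_laplace_def real_distribution_convolution M.real_distribution_axioms N.real_distribution_axioms)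
qed

section \<open>Exponential and beta laws\<close>

definition exp_law :: "real \<Rightarrow> real measure" where
  "exp_law \<rho> = density lborel (exponential_density \<rho>)"

lemma real_distribution_exp_law: "\<rho> > 0 \<Longrightarrow> real_distribution (exp_law \<rho>)"
  unfolding exp_law_def real_distribution_def real_distribution_axioms_def
  by (auto intro!: prob_space_exponential_density)

lemma AE_exp_law: "AE y in exp_law \<rho>. 0 \<le> y"
  unfolding exp_law_def by (subst AE_density) (auto simp: exponential_density_def)

lemma integral_exp_law:
  fixes f :: "real \<Rightarrow> real"
  assumes "\<rho> > 0" "f \<in> borel_measurable borel"
  shows "(\<integral>y. f y \<partial>exp_law \<rho>) = (\<integral>y. exponential_density \<rho> y * f y \<partial>lborel)"
  unfolding exp_law_def using assms exponential_density_nonneg[OF assms(1)]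
  by (subst integral_density) auto

text \<open>Multiplying the exponential density of rate \<rho> by
  \<open>exp (- (real k * y))\<close> gives a multiple of the density of rate \<rho> + k, whose mass
  is one.\<close>

lemma has_laplace_exp_law:
  assumes "\<rho> > 0"
  shows "has_laplace (exp_law \<rho>) (\<lambda>k. \<rho> / (\<rho> + real k))"
proof -
  have "(\<integral>y. exp (- (real k * y)) \<partial>exp_law \<rho>) = \<rho> / (\<rho> + real k)" for k
  proof -
    interpret E: real_distribution "exp_law (\<rho> + real k)"
      using assms by (intro real_distribution_exp_law) simp
    have "(\<integral>y. exp (- (real k * y)) \<partial>exp_law \<rho>) = (\<integral>y. exponential_density \<rho> y * exp (- (real k * y)) \<partial>lborel)"
      using assms by (intro integral_exp_law) auto
    also have "(\<lambda>y. exponential_density \<rho> y * exp (- (real k * y))) = (\<lambda>y. \<rho> / (\<rho> + real k) * (exponential_density (\<rho> + real k) y * 1))"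
    proof
      fix y
      have "\<rho> + real k \<noteq> 0" using assms by linarith
      moreover have "exp (- y * \<rho>) * exp (- (real k * y)) = exp (- y * (\<rho> + real k))"
        by (simp add: mult_exp_exp algebra_simps)
      ultimately show "exponential_density \<rho> y * exp (- (real k * y)) = \<rho> / (\<rho> + real k) * (exponential_density (\<rho> + real k) y * 1)"
        by (simp only: exponential_density_def mult.assoc if_distrib) simp
    qed
    also have "(\<integral>y. \<rho> / (\<rho> + real k) * (exponential_density (\<rho> + real k) y * 1) \<partial>lborel) = \<rho> / (\<rho> + real k) * (\<integral>y. 1 \<partial>exp_law (\<rho> + real k))"
      using assms by (subst integral_exp_law) auto
    finally show ?thesis using E.prob_space by simp
  qed
  then show ?thesis
    using assms by (simp add: has_laplace_def real_distribution_exp_law AE_exp_law)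
qed

text \<open>The witness is the law of - ln t for t distributed as Beta(p, q). Its transform at
  \<open>k\<close> is the moment \<open>Beta (p + real k) q / Beta p q\<close>, which the functional
  equation of the beta function expands into the product.\<close>

lemma has_laplace_beta:
  assumes "p > 0" "q > 0"
  shows "\<exists>\<mu>. has_laplace \<mu> (\<lambda>k. \<Prod>i<k. (p + real i) / (p + q + real i))"
proof -
  define g where "g t = indicator {0<..<1} t * (t powr (p - 1) * (1 - t) powr (q - 1))" for t :: real
  have g_nonneg: "g t \<ge> 0" for t by (simp add: g_def)
  have [measurable]: "g \<in> borel_measurable borel" unfolding g_def by measurable
  have "Gamma p * Gamma q / Gamma (p + q) > 0" using assms by (intro divide_pos_pos mult_pos_pos Gamma_real_pos) auto
  then have Bpos: "Beta p q > 0" by (simp add: Beta_def)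
  have mom: "has_bochner_integral lborel (\<lambda>t. g t * t ^ k) (Beta (p + real k) q)" for k
  proof -
    have "((\<lambda>t. t powr (p + real k - 1) * (1 - t) powr (q - 1)) has_integral Beta (p + real k) q) {0..1}"
      using assms by (intro has_integral_Beta_real) auto
    then have "((\<lambda>t. t powr (p + real k - 1) * (1 - t) powr (q - 1)) has_integral Beta (p + real k) q) {0<..<1}"
      by (simp add: has_integral_Icc_iff_Ioo)
    then have "((\<lambda>t. if t \<in> {0<..<1} then t powr (p + real k - 1) * (1 - t) powr (q - 1) else 0) has_integral Beta (p + real k) q) UNIV"
      by (simp only: has_integral_restrict_UNIV)
    moreover have "(\<lambda>t. if t \<in> {0<..<1} then t powr (p + real k - 1) * (1 - t) powr (q - 1) else 0) = (\<lambda>t. g t * t ^ k)"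
      by (auto simp: fun_eq_iff g_def indicator_def powr_add powr_diff powr_realpow)
    ultimately have "((\<lambda>t. g t * t ^ k) has_integral Beta (p + real k) q) UNIV" by simp
    moreover have "g t * t ^ k \<ge> 0" for t by (auto simp: g_def indicator_def)
    ultimately show ?thesis
      by (intro has_bochner_integral_nn_integral nn_integral_has_integral_lborel AE_I2
          has_integral_nonneg[of "\<lambda>t. g t * t ^ k" "Beta (p + real k) q" UNIV]) simp_all
  qed
  define \<nu> where "\<nu> = density lborel (\<lambda>t. ennreal (g t / Beta p q))"
  have \<nu>_int: "(\<integral>t. t ^ k \<partial>\<nu>) = Beta (p + real k) q / Beta p q" for k
  proof -
    have "(\<integral>t. t ^ k \<partial>\<nu>) = (\<integral>t. (g t / Beta p q) *\<^sub>R t ^ k \<partial>lborel)"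
      unfolding \<nu>_def using g_nonneg Bpos by (intro integral_density) auto
    also have "\<dots> = (\<integral>t. g t * t ^ k \<partial>lborel) / Beta p q" by simp
    finally show ?thesis using has_bochner_integral_integral_eq[OF mom[of k]] by simp
  qed
  have "prob_space \<nu>"
  proof
    have "emeasure \<nu> (space \<nu>) = (\<integral>\<^sup>+t. ennreal (g t / Beta p q) \<partial>lborel)"
      unfolding \<nu>_def by (subst emeasure_density) (auto intro!: nn_integral_cong)
    also have "\<dots> = ennreal (\<integral>t. g t / Beta p q \<partial>lborel)"
      using mom[of 0] g_nonneg Bpos by (intro nn_integral_eq_integral) (auto simp: has_bochner_integral_iff)
    also have "(\<integral>t. g t / Beta p q \<partial>lborel) = 1"
      using has_bochner_integral_integral_eq[OF mom[of 0]] Bpos by simp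
    finally show "emeasure \<nu> (space \<nu>) = 1" by simp
  qed
  then interpret \<nu>: prob_space \<nu> .
  have AE_\<nu>: "AE t in \<nu>. 0 < t \<and> t < 1"
    unfolding \<nu>_def by (subst AE_density) (auto simp: g_def indicator_def)
  have [measurable_cong]: "sets \<nu> = sets borel" by (simp add: \<nu>_def)
  have ratio: "Beta (p + real k) q / Beta p q = (\<Prod>i<k. (p + real i) / (p + q + real i))" for k
  proof (induction k)
    case (Suc k)
    have "(p + real k + q) * Beta (p + real k + 1) q = (p + real k) * Beta (p + real k) q"
      using assms by (intro Beta_plus1_left) (auto elim!: nonpos_Ints_cases)
    then have "Beta (p + real (Suc k)) q = (p + real k) / (p + q + real k) * Beta (p + real k) q"
      using assms by (simp add: field_simps)
    then have "Beta (p + real (Suc k)) q / Beta p q = (Beta (p + real k) q / Beta p q) * ((p + real k) / (p + q + real k))"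
      by (simp add: mult.commute)
    then show ?case unfolding Suc prod.lessThan_Suc .
  qed (use Bpos in simp)
  have "has_laplace (distr \<nu> borel (\<lambda>t. - ln t)) (\<lambda>k. \<Prod>i<k. (p + real i) / (p + q + real i))"
    unfolding has_laplace_def
  proof (intro conjI allI)
    show "real_distribution (distr \<nu> borel (\<lambda>t. - ln t))" by (intro \<nu>.real_distribution_distr) measurable
    show "AE y in distr \<nu> borel (\<lambda>t. - ln t). 0 \<le> y"
    proof -
      have "AE t in \<nu>. 0 \<le> - ln t" using AE_\<nu> by eventually_elim simp
      then show ?thesis by (subst AE_distr_iff) auto
    qed
    fix k
    have "(\<integral>y. exp (- (real k * y)) \<partial>distr \<nu> borel (\<lambda>t. - ln t)) = (\<integral>t. exp (real k * ln t) \<partial>\<nu>)"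
      by (subst integral_distr) auto
    also have "\<dots> = (\<integral>t. t ^ k \<partial>\<nu>)"
    proof (rule integral_cong_AE)
      show "AE t in \<nu>. exp (real k * ln t) = t ^ k"
        using AE_\<nu> by eventually_elim (simp add: exp_of_nat_mult)
    qed auto
    finally show "(\<integral>y. exp (- (real k * y)) \<partial>distr \<nu> borel (\<lambda>t. - ln t)) = (\<Prod>i<k. (p + real i) / (p + q + real i))"
      using \<nu>_int ratio by simp
  qed
  then show ?thesis by blast
qed

lemma has_laplace_one: "\<exists>\<mu>. has_laplace \<mu> (\<lambda>_. 1)"
proof
  show "has_laplace (return borel 0) (\<lambda>_. 1)"
    unfolding has_laplace_def real_distribution_def real_distribution_axioms_def
    by (auto simp: prob_space_return AE_return integral_return)
qed

text \<open>At \<open>q = 0\<close> the beta law degenerates to the point 1, so its negative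
  logarithm is the point mass at 0. This case occurs: Beta((\<xi>+1)/2, (\<xi>-1)/2) has it for
  \<xi> = 1.\<close>

lemma has_laplace_beta_nonneg:
  assumes "p > 0" "q \<ge> 0"
  shows "\<exists>\<mu>. has_laplace \<mu> (\<lambda>k. \<Prod>i<k. (p + real i) / (p + q + real i))"
proof (cases "q = 0")
  case True
  have "(\<Prod>i<k. (p + real i) / (p + q + real i)) = 1" for k
    using True assms by (intro prod.neutral) (auto simp: add_pos_nonneg less_imp_neq[symmetric])
  then show ?thesis using has_laplace_one by simp
qed (use assms has_laplace_beta in auto)

section \<open>Smoothing of periodic functions by exponential variables\<close>

definition smooth_exp :: "real \<Rightarrow> (real \<Rightarrow> real) \<Rightarrow> real \<Rightarrow> real" where
  "smooth_exp \<rho> f y = (\<integral>e. f (y + e) \<partial>exp_law \<rho>)"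

definition periodic_bounded :: "real \<Rightarrow> real \<Rightarrow> (real \<Rightarrow> real) \<Rightarrow> bool" where
  "periodic_bounded T C f \<longleftrightarrow>
     f \<in> borel_measurable borel \<and> (\<forall>y. f (y + T) = f y) \<and> (\<forall>y. \<bar>f y\<bar> \<le> C)"

lemma set_integrable_bounded:
  fixes f :: "real \<Rightarrow> real"
  assumes "f \<in> borel_measurable borel" "\<And>y. \<bar>f y\<bar> \<le> C"
  shows "set_integrable lborel {a..b} f"
  unfolding set_integrable_def using assms
  by (intro integrableI_bounded_set_indicator[where B = C]) (auto simp: emeasure_lborel_Icc_eq)

lemma periodic_bounded_integrable:
  assumes "periodic_bounded T C f"
  shows "f integrable_on {a..b}"
  using set_integrable_bounded[of f C a b] assms
  by (intro set_borel_integral_eq_integral(1)) (auto simp: periodic_bounded_def)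

lemma periodic_nat: "(\<And>y. f (y + T) = f y) \<Longrightarrow> f (y + real n * T) = f y" for f :: "real \<Rightarrow> 'a"
proof (induction n)
  case (Suc n)
  have "f (y + real (Suc n) * T) = f ((y + real n * T) + T)" by (simp add: algebra_simps)
  then show ?case using Suc by simp
qed simp

lemma periodic_int:
  fixes f :: "real \<Rightarrow> 'a"
  assumes "\<And>y. f (y + T) = f y"
  shows "f (y + real_of_int n * T) = f y"
proof (cases "n \<ge> 0")
  case True
  then show ?thesis using periodic_nat[of f T y "nat n"] assms by simp
next
  case False
  then show ?thesis using periodic_nat[of f T "y + real_of_int n * T" "nat (- n)"] assms by simp
qed

lemma integral_shift_Icc:
  fixes f :: "real \<Rightarrow> real"
  assumes "f integrable_on {a..b}"
  shows "integral {a - c..b - c} (\<lambda>y. f (y + c)) = integral {a..b} f"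
  using has_integral_affinity'[of f "integral {a..b} f" a b 1 c] assms
  by (intro integral_unique) (auto simp: has_integral_integral[symmetric])

lemma integral_periodic_shift:
  assumes f: "periodic_bounded T C f" and T: "T > 0"
  shows "integral {0..T} (\<lambda>y. f (y + e)) = integral {0..T} f"
proof -
  define n where "n = \<lfloor>e / T\<rfloor>"
  define r where "r = e - of_int n * T"
  have "of_int n * T \<le> e" "e < (of_int n + 1) * T"
    using T floor_divide_lower[of T e] floor_divide_upper[of T e] by (auto simp: n_def)
  then have r: "0 \<le> r" "r \<le> T" by (auto simp: r_def algebra_simps)
  have per: "f (y + T) = f y" for y using f by (simp add: periodic_bounded_def)
  note int = periodic_bounded_integrable[OF f]
  have "f (y + e) = f (y + r)" for y
    using periodic_int[of f T "y + r" n] per by (simp add: r_def algebra_simps)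
  then have "integral {0..T} (\<lambda>y. f (y + e)) = integral {r - r..T + r - r} (\<lambda>y. f (y + r))" by simp
  also have "\<dots> = integral {r..T + r} f" by (rule integral_shift_Icc[OF int])
  also have "\<dots> = integral {r..T} f + integral {T..T + r} f"
    using r by (intro Henstock_Kurzweil_Integration.integral_combine[symmetric] int) auto
  also have "integral {T..T + r} f = integral {T - T..T + r - T} (\<lambda>y. f (y + T))"
    by (rule integral_shift_Icc[OF int, symmetric])
  also have "\<dots> = integral {0..r} f" by (simp add: per)
  also have "integral {r..T} f + integral {0..r} f = integral {0..T} f"
    using Henstock_Kurzweil_Integration.integral_combine[OF r int] by simp
  finally show ?thesis .
qed

lemma periodic_bounded_smooth_exp:
  assumes f: "periodic_bounded T C f" and \<rho>: "\<rho> > 0"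
  shows "periodic_bounded T C (smooth_exp \<rho> f)"
proof -
  interpret E: real_distribution "exp_law \<rho>" using \<rho> by (rule real_distribution_exp_law)
  have [measurable]: "f \<in> borel_measurable borel" and per: "\<And>y. f (y + T) = f y" and C: "\<And>y. \<bar>f y\<bar> \<le> C"
    using f by (auto simp: periodic_bounded_def)
  have "smooth_exp \<rho> f \<in> borel_measurable borel"
    unfolding smooth_exp_def by measurable
  moreover have "smooth_exp \<rho> f (y + T) = smooth_exp \<rho> f y" for y
    unfolding smooth_exp_def using per[of "y + _"] by (simp add: add_ac)
  moreover have "\<bar>smooth_exp \<rho> f y\<bar> \<le> C" for y
  proof -
    have "\<bar>smooth_exp \<rho> f y\<bar> \<le> (\<integral>e. \<bar>f (y + e)\<bar> \<partial>exp_law \<rho>)"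
      unfolding smooth_exp_def by (rule integral_abs_bound)
    also have "\<dots> \<le> C"
      using C by (intro E.integral_le_const E.integrable_const_bound[of _ C]) auto
    finally show ?thesis .
  qed
  ultimately show ?thesis by (simp add: periodic_bounded_def)
qed

text \<open>By Fubini the period is integrated first, and that integral does not see the shift
  \<open>e\<close>. Mean zero, which Poincare's inequality needs, thus survives every
  smoothing.\<close>

lemma integral_smooth_exp:
  assumes f: "periodic_bounded T C f" and \<rho>: "\<rho> > 0" and T: "T > 0"
  shows "integral {0..T} (smooth_exp \<rho> f) = integral {0..T} f"
proof -
  interpret E: real_distribution "exp_law \<rho>" using \<rho> by (rule real_distribution_exp_law)
  define L where "L = restrict_space lborel {0..T}"
  interpret L: finite_measure L
    unfolding L_def by (rule finite_measureI) (auto simp: emeasure_restrict_space space_restrict_space emeasure_lborel_Icc_eq)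
  interpret P: pair_sigma_finite L "exp_law \<rho>" ..
  interpret PF: finite_measure "L \<Otimes>\<^sub>M exp_law \<rho>"
    by (intro finite_measure_pair_measure) unfold_locales
  have f_meas [measurable]: "f \<in> borel_measurable borel" and C: "\<And>y. \<bar>f y\<bar> \<le> C"
    using f by (auto simp: periodic_bounded_def)
  have id [measurable]: "(\<lambda>x. x) \<in> measurable L borel" unfolding L_def by (rule measurable_restrict_space1) simp
  have L_int: "(\<integral>y. g y \<partial>L) = integral {0..T} g" if "g \<in> borel_measurable borel" "\<And>y. \<bar>g y\<bar> \<le> C" for g :: "real \<Rightarrow> real"
    using set_borel_integral_eq_integral(2)[OF set_integrable_bounded[OF that]]
    unfolding L_def by (subst integral_restrict_space) (auto simp: set_lebesgue_integral_def)
  have int: "integrable (L \<Otimes>\<^sub>M exp_law \<rho>) (\<lambda>(y, e). f (y + e))"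
    using C by (intro PF.integrable_const_bound[of _ C]) auto
  have "integral {0..T} (smooth_exp \<rho> f) = (\<integral>y. (\<integral>e. f (y + e) \<partial>exp_law \<rho>) \<partial>L)"
    using periodic_bounded_smooth_exp[OF f \<rho>] unfolding smooth_exp_def
    by (subst L_int) (auto simp: periodic_bounded_def)
  also have "\<dots> = (\<integral>e. (\<integral>y. f (y + e) \<partial>L) \<partial>exp_law \<rho>)"
    using P.Fubini_integral[OF int] by simp
  also have "\<dots> = (\<integral>e. integral {0..T} f \<partial>exp_law \<rho>)"
    using C by (subst L_int) (auto simp: integral_periodic_shift[OF f T])
  also have "\<dots> = integral {0..T} f" using E.prob_space by simp
  finally show ?thesis .
qed

text \<open>Substituting v = y + e turns the smoothing into an exponential times the tail integral
  from \<open>y\<close> on, and \<open>K\<close> is the tail from 0. Continuity can be read off for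
  merely bounded measurable \<open>f\<close>, and the differential equation for continuous
  \<open>f\<close>.\<close>

lemma smooth_exp_rep:
  assumes f: "periodic_bounded T C f" and \<rho>: "\<rho> > 0"
  shows "\<exists>K. \<forall>y\<ge>0. smooth_exp \<rho> f y = \<rho> * exp (\<rho> * y) * (K - integral {0..y} (\<lambda>v. exp (- \<rho> * v) * f v))"
proof -
  interpret E: real_distribution "exp_law \<rho>" using \<rho> by (rule real_distribution_exp_law)
  have [measurable]: "f \<in> borel_measurable borel" and C: "\<And>y. \<bar>f y\<bar> \<le> C"
    using f by (auto simp: periodic_bounded_def)
  define \<phi> where "\<phi> v = exp (- \<rho> * v) * f v" for v
  define K where "K = (\<integral>v. indicator {0..} v * \<phi> v \<partial>lborel)"
  have [measurable]: "\<phi> \<in> borel_measurable borel" unfolding \<phi>_def by measurable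
  have "integrable (exp_law \<rho>) f"
    using C by (intro E.integrable_const_bound[of _ C]) auto
  then have "integrable lborel (\<lambda>v. exponential_density \<rho> v * f v)"
    unfolding exp_law_def using exponential_density_nonneg[OF \<rho>]
    by (subst (asm) integrable_density) auto
  then have "integrable lborel (\<lambda>v. exponential_density \<rho> v * f v / \<rho>)" by simp
  moreover have "(\<lambda>v. exponential_density \<rho> v * f v / \<rho>) = (\<lambda>v. indicator {0..} v * \<phi> v)"
    using \<rho> by (auto simp: fun_eq_iff exponential_density_def \<phi>_def indicator_def mult.commute)
  ultimately have int0: "integrable lborel (\<lambda>v. indicator {0..} v * \<phi> v)" by simp
  have "smooth_exp \<rho> f y = \<rho> * exp (\<rho> * y) * (K - integral {0..y} \<phi>)" if y: "y \<ge> 0" for y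
  proof -
    have int1: "integrable lborel (\<lambda>v. indicator {y..} v * \<phi> v)"
      using integrable_mult_indicator[OF _ int0, of "{y..}"] y
      by (auto elim!: Bochner_Integration.integrable_cong[THEN iffD1, rotated -1] simp: indicator_def)
    have int2: "integrable lborel (\<lambda>v. indicator {0..y} v * \<phi> v)"
      using integrable_mult_indicator[OF _ int0, of "{0..y}"] y
      by (auto elim!: Bochner_Integration.integrable_cong[THEN iffD1, rotated -1] simp: indicator_def)
    have "smooth_exp \<rho> f y = (\<integral>e. exponential_density \<rho> e * f (y + e) \<partial>lborel)"
      unfolding smooth_exp_def using \<rho> by (intro integral_exp_law) auto
    \<comment> \<open>\<open>1 * e\<close> is kept to match the affine change of variables in the
      next step.\<close>
    also have "\<dots> = (\<integral>e. \<rho> * exp (\<rho> * y) * (indicator {y..} (y + 1 * e) * \<phi> (y + 1 * e)) \<partial>lborel)"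
      by (intro Bochner_Integration.integral_cong refl)
         (auto simp: exponential_density_def \<phi>_def indicator_def mult_exp_exp algebra_simps simp flip: exp_minus)
    also have "\<dots> = (\<integral>v. \<rho> * exp (\<rho> * y) * (indicator {y..} v * \<phi> v) \<partial>lborel)"
      by (subst (2) lborel_integral_real_affine[of 1 _ y]) auto
    also have "\<dots> = \<rho> * exp (\<rho> * y) * (\<integral>v. indicator {y..} v * \<phi> v \<partial>lborel)"
      by simp
    also have "(\<integral>v. indicator {y..} v * \<phi> v \<partial>lborel) = K - integral {0..y} \<phi>"
    proof -
      have "K = (\<integral>v. indicator {0..y} v * \<phi> v + indicator {y..} v * \<phi> v \<partial>lborel)"
        unfolding K_def
      proof (rule integral_cong_AE)
        show "AE v in lborel. indicator {0..} v * \<phi> v = indicator {0..y} v * \<phi> v + indicator {y..} v * \<phi> v"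
          using AE_lborel_singleton[of y] by eventually_elim (use y in \<open>auto simp: indicator_def\<close>)
      qed auto
      also have "\<dots> = (\<integral>v. indicator {0..y} v * \<phi> v \<partial>lborel) + (\<integral>v. indicator {y..} v * \<phi> v \<partial>lborel)"
        by (rule Bochner_Integration.integral_add[OF int2 int1])
      also have "(\<integral>v. indicator {0..y} v * \<phi> v \<partial>lborel) = integral {0..y} \<phi>"
        using set_borel_integral_eq_integral(2)[of "{0..y}" \<phi>] int2
        by (simp add: set_lebesgue_integral_def set_integrable_def)
      finally show ?thesis by simp
    qed
    finally show ?thesis .
  qed
  then show ?thesis unfolding \<phi>_def by blast
qed

lemma continuous_on_smooth_exp:
  assumes f: "periodic_bounded T C f" and \<rho>: "\<rho> > 0"
  shows "continuous_on {0..T} (smooth_exp \<rho> f)"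
proof -
  obtain K where K: "\<And>y. y \<ge> 0 \<Longrightarrow> smooth_exp \<rho> f y = \<rho> * exp (\<rho> * y) * (K - integral {0..y} (\<lambda>v. exp (- \<rho> * v) * f v))"
    using smooth_exp_rep[OF f \<rho>] by blast
  have "set_integrable lborel {0..T} (\<lambda>v. exp (- \<rho> * v) * f v)"
    unfolding set_integrable_def
  proof (rule integrableI_bounded_set_indicator[where B = C])
    show "AE v in lborel. v \<in> {0..T} \<longrightarrow> norm (exp (- \<rho> * v) * f v) \<le> C"
    proof (intro AE_I2 impI)
      fix v assume "v \<in> {0..T}"
      then have "exp (- \<rho> * v) * \<bar>f v\<bar> \<le> 1 * C"
        using \<rho> f by (intro mult_mono) (auto simp: periodic_bounded_def)
      then show "norm (exp (- \<rho> * v) * f v) \<le> C" by (simp add: abs_mult)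
    qed
  qed (use f in \<open>auto simp: periodic_bounded_def emeasure_lborel_Icc_eq\<close>)
  then have "(\<lambda>v. exp (- \<rho> * v) * f v) integrable_on {0..T}"
    by (rule set_borel_integral_eq_integral(1))
  then have "continuous_on {0..T} (\<lambda>y. \<rho> * exp (\<rho> * y) * (K - integral {0..y} (\<lambda>v. exp (- \<rho> * v) * f v)))"
    by (intro continuous_intros indefinite_integral_continuous_1)
  then show ?thesis by (rule continuous_on_cong[THEN iffD1, rotated 2]) (auto simp: K)
qed

lemma has_real_derivative_smooth_exp:
  assumes f: "periodic_bounded T C f" and \<rho>: "\<rho> > 0" and cont: "continuous_on {0..T} f" and y: "y \<in> {0..T}"
  shows "(smooth_exp \<rho> f has_real_derivative \<rho> * (smooth_exp \<rho> f y - f y)) (at y within {0..T})"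
proof -
  obtain K where K: "\<And>y. y \<ge> 0 \<Longrightarrow> smooth_exp \<rho> f y = \<rho> * exp (\<rho> * y) * (K - integral {0..y} (\<lambda>v. exp (- \<rho> * v) * f v))"
    using smooth_exp_rep[OF f \<rho>] by blast
  define I where "I y = integral {0..y} (\<lambda>v. exp (- \<rho> * v) * f v)" for y
  have I: "(I has_real_derivative exp (- \<rho> * y) * f y) (at y within {0..T})"
    unfolding I_def using cont y by (intro integral_has_real_derivative continuous_intros) auto
  have "((\<lambda>y. \<rho> * exp (\<rho> * y) * (K - I y)) has_real_derivative
      \<rho> * (\<rho> * exp (\<rho> * y) * (K - I y) - f y)) (at y within {0..T})"
    by (rule derivative_eq_intros I refl)+ (simp add: algebra_simps mult_exp_exp)
  then have "((\<lambda>y. \<rho> * exp (\<rho> * y) * (K - I y)) has_real_derivative \<rho> * (smooth_exp \<rho> f y - f y)) (at y within {0..T})"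
    using y by (simp add: K I_def)
  then show ?thesis
    by (rule has_field_derivative_transform_within[OF _ zero_less_one y]) (use K in \<open>auto simp: I_def\<close>)
qed

section \<open>Poincare's inequality and the energy identity\<close>

lemma square_integral_abs_le:
  fixes d :: "real \<Rightarrow> real"
  assumes "T > 0" "continuous_on {0..T} d"
  shows "(integral {0..T} (\<lambda>x. \<bar>d x\<bar>))\<^sup>2 \<le> T * integral {0..T} (\<lambda>x. (d x)\<^sup>2)"
proof -
  define D where "D = integral {0..T} (\<lambda>x. \<bar>d x\<bar>)"
  have int: "(\<lambda>x. \<bar>d x\<bar>) integrable_on {0..T}" "(\<lambda>x. (d x)\<^sup>2) integrable_on {0..T}"
    using assms(2) by (auto intro!: integrable_continuous_real continuous_intros)
  \<comment> \<open>Cauchy-Schwarz is obtained here as nonnegativity of the variance of |d| about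
    its mean \<open>D / T\<close>.\<close>
  have "0 \<le> integral {0..T} (\<lambda>x. (\<bar>d x\<bar> - D / T)\<^sup>2)"
    using assms(2) by (intro integral_nonneg integrable_continuous_real continuous_intros) auto
  also have "(\<lambda>x. (\<bar>d x\<bar> - D / T)\<^sup>2) = (\<lambda>x. ((d x)\<^sup>2 - 2 * (D / T) * \<bar>d x\<bar>) + (D / T)\<^sup>2)"
    by (simp add: fun_eq_iff power2_diff algebra_simps)
  also have "integral {0..T} \<dots> = (integral {0..T} (\<lambda>x. (d x)\<^sup>2) - 2 * (D / T) * D) + T * (D / T)\<^sup>2"
  proof (rule integral_unique)
    have "((\<lambda>x. (D / T)\<^sup>2) has_integral T * (D / T)\<^sup>2) {0..T}"
      using has_integral_const_real[of "(D / T)\<^sup>2" 0 T] assms(1) by simp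
    then show "((\<lambda>x. ((d x)\<^sup>2 - 2 * (D / T) * \<bar>d x\<bar>) + (D / T)\<^sup>2) has_integral
        (integral {0..T} (\<lambda>x. (d x)\<^sup>2) - 2 * (D / T) * D) + T * (D / T)\<^sup>2) {0..T}"
      unfolding D_def by (intro has_integral_add has_integral_diff has_integral_mult_right integrable_integral int)
  qed
  also have "T * (D / T)\<^sup>2 = D\<^sup>2 / T" using assms(1) by (simp add: power2_eq_square)
  finally have "D\<^sup>2 / T \<le> integral {0..T} (\<lambda>x. (d x)\<^sup>2)" by (simp add: power2_eq_square)
  then show ?thesis using assms(1) by (simp add: D_def field_simps)
qed

text \<open>As \<open>g\<close> has mean zero, \<open>g y * T\<close> is the integral of
  \<open>g y - g x\<close> over \<open>x\<close>, and each such difference is at most the integral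
  of |d|. The pointwise form serves twice: integrated over the period it is the \<open>L2\<close>
  inequality, and as it stands it gives the final supremum bound.\<close>

lemma poincare_sup:
  fixes g d :: "real \<Rightarrow> real"
  assumes T: "T > 0" and d: "continuous_on {0..T} d"
    and der: "\<And>y. y \<in> {0..T} \<Longrightarrow> (g has_real_derivative d y) (at y within {0..T})"
    and mean: "integral {0..T} g = 0" and y: "y \<in> {0..T}"
  shows "(g y)\<^sup>2 \<le> T * integral {0..T} (\<lambda>x. (d x)\<^sup>2)"
proof -
  define D where "D = integral {0..T} (\<lambda>x. \<bar>d x\<bar>)"
  have int_abs: "(\<lambda>x. \<bar>d x\<bar>) integrable_on {0..T}"
    using d by (intro integrable_continuous_real continuous_intros)
  have g: "continuous_on {0..T} g"
    using der by (intro DERIV_continuous_on)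
  have le: "\<bar>g v - g u\<bar> \<le> D" if "0 \<le> u" "u \<le> v" "v \<le> T" for u v
  proof -
    have sub: "{u..v} \<subseteq> {0..T}" using that by auto
    have "(d has_integral (g v - g u)) {u..v}"
    proof (rule fundamental_theorem_of_calculus)
      fix x assume "x \<in> {u..v}"
      with der[of x] sub have "(g has_real_derivative d x) (at x within {u..v})"
        by (blast intro: has_field_derivative_subset)
      then show "(g has_vector_derivative d x) (at x within {u..v})"
        by (simp add: has_real_derivative_iff_has_vector_derivative)
    qed (use that in auto)
    then have "\<bar>g v - g u\<bar> = \<bar>integral {u..v} d\<bar>" by (simp add: integral_unique)
    also have "\<dots> \<le> integral {u..v} (\<lambda>x. \<bar>d x\<bar>)"
      using integral_norm_bound_integral[of d "{u..v}" "\<lambda>x. \<bar>d x\<bar>"] continuous_on_subset[OF d sub]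
      by (auto intro!: integrable_continuous_real continuous_intros)
    also have "\<dots> \<le> D"
      unfolding D_def using sub int_abs integrable_on_subinterval[OF int_abs, of u v] by (intro integral_subset_le) auto
    finally show ?thesis .
  qed
  have dist: "\<bar>g y - g x\<bar> \<le> D" if "x \<in> {0..T}" for x
    using le[of x y] le[of y x] y that by (cases "x \<le> y") (auto simp: abs_minus_commute)
  have "g y * T = integral {0..T} (\<lambda>x. g y - g x)"
    using g T mean by (subst Henstock_Kurzweil_Integration.integral_diff) (auto intro!: integrable_continuous_real)
  then have "\<bar>g y * T\<bar> \<le> integral {0..T} (\<lambda>x. D)"
  proof -
    have "(\<lambda>x. g y - g x) integrable_on {0..T}"
      by (intro integrable_continuous_real continuous_intros g)
    then have "norm (integral {0..T} (\<lambda>x. g y - g x)) \<le> integral {0..T} (\<lambda>x. D)"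
      by (rule integral_norm_bound_integral) (use dist in auto)
    with \<open>g y * T = _\<close> show ?thesis by simp
  qed
  then have "\<bar>g y\<bar> \<le> D" using T by (simp add: abs_mult)
  then have "(g y)\<^sup>2 \<le> D\<^sup>2" by (simp add: abs_le_square_iff[symmetric])
  then show ?thesis using square_integral_abs_le[OF T d] by (simp add: D_def)
qed

text \<open>Expand the square of f = g - g'/\<rho>. The cross term integrates g g', the derivative
  of g^2/2, so periodicity kills it and |f|^2 = |g|^2 + |g'|^2/\<rho>^2 in \<open>L2\<close>.
  Poincare's inequality bounds the last term from below by a multiple of |g|^2, and the same
  identity bounds |g'| by \<rho> |f|, hence also \<open>g\<close> pointwise.\<close>

lemma smoothing_energy:
  fixes f g :: "real \<Rightarrow> real"
  assumes T: "T > 0" and \<rho>: "\<rho> > 0" and f: "continuous_on {0..T} f"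
    and der: "\<And>y. y \<in> {0..T} \<Longrightarrow> (g has_real_derivative \<rho> * (g y - f y)) (at y within {0..T})"
    and mean: "integral {0..T} g = 0" and per: "g T = g 0"
  shows "(1 + 1 / (\<rho> * T)\<^sup>2) * integral {0..T} (\<lambda>y. (g y)\<^sup>2) \<le> integral {0..T} (\<lambda>y. (f y)\<^sup>2)"
    and "\<And>y. y \<in> {0..T} \<Longrightarrow> (g y)\<^sup>2 \<le> T * \<rho>\<^sup>2 * integral {0..T} (\<lambda>y. (f y)\<^sup>2)"
proof -
  define d where "d y = \<rho> * (g y - f y)" for y
  have g: "continuous_on {0..T} g" using der by (intro DERIV_continuous_on)
  have d: "continuous_on {0..T} d" unfolding d_def by (intro continuous_intros f g)
  have der': "(g has_real_derivative d y) (at y within {0..T})" if "y \<in> {0..T}" for y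
    using der[OF that] by (simp add: d_def)
  define If where "If = integral {0..T} (\<lambda>y. (f y)\<^sup>2)"
  define Ig where "Ig = integral {0..T} (\<lambda>y. (g y)\<^sup>2)"
  define Id where "Id = integral {0..T} (\<lambda>y. (d y)\<^sup>2)"
  have int: "(\<lambda>y. (g y)\<^sup>2) integrable_on {0..T}" "(\<lambda>y. g y * d y) integrable_on {0..T}" "(\<lambda>y. (d y)\<^sup>2) integrable_on {0..T}"
    by (intro integrable_continuous_real continuous_intros g d)+
  have "((\<lambda>y. g y * d y) has_integral ((g T)\<^sup>2 / 2 - (g 0)\<^sup>2 / 2)) {0..T}"
  proof (rule fundamental_theorem_of_calculus)
    fix y assume "y \<in> {0..T}"
    then have "((\<lambda>y. (g y)\<^sup>2 / 2) has_real_derivative g y * d y) (at y within {0..T})"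
      by (auto intro!: derivative_eq_intros der')
    then show "((\<lambda>y. (g y)\<^sup>2 / 2) has_vector_derivative g y * d y) (at y within {0..T})"
      by (simp add: has_real_derivative_iff_has_vector_derivative)
  qed (use T in simp)
  then have cross: "integral {0..T} (\<lambda>y. g y * d y) = 0" using per by (simp add: integral_unique)
  have "(f y)\<^sup>2 = ((g y)\<^sup>2 - 2 / \<rho> * (g y * d y)) + 1 / \<rho>\<^sup>2 * (d y)\<^sup>2" for y
  proof -
    have "f y = g y - d y / \<rho>" using \<rho> by (simp add: d_def)
    then show ?thesis by (simp add: power2_diff power_divide)
  qed
  then have "If = integral {0..T} (\<lambda>y. ((g y)\<^sup>2 - 2 / \<rho> * (g y * d y)) + 1 / \<rho>\<^sup>2 * (d y)\<^sup>2)"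
    unfolding If_def by simp
  also have "\<dots> = (Ig - 2 / \<rho> * integral {0..T} (\<lambda>y. g y * d y)) + 1 / \<rho>\<^sup>2 * Id"
    unfolding Ig_def Id_def
    by (intro integral_unique has_integral_add has_integral_diff has_integral_mult_right integrable_integral int)
  finally have energy: "If = Ig + Id / \<rho>\<^sup>2" using cross by simp
  have sup: "(g y)\<^sup>2 \<le> T * Id" if "y \<in> {0..T}" for y
    unfolding Id_def by (rule poincare_sup[OF T d der' mean that])
  have "Ig \<le> integral {0..T} (\<lambda>y. T * Id)"
    unfolding Ig_def by (intro integral_le int integrable_const_ivl sup)
  then have "Ig \<le> T\<^sup>2 * Id" using T by (simp add: power2_eq_square)
  then have "Ig / (\<rho> * T)\<^sup>2 \<le> T\<^sup>2 * Id / (\<rho> * T)\<^sup>2" by (rule divide_right_mono) simp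
  also have "\<dots> = Id / \<rho>\<^sup>2" using T by (simp add: power_mult_distrib)
  finally show "(1 + 1 / (\<rho> * T)\<^sup>2) * integral {0..T} (\<lambda>y. (g y)\<^sup>2) \<le> integral {0..T} (\<lambda>y. (f y)\<^sup>2)"
    using energy by (simp add: If_def Ig_def algebra_simps)
  have "0 \<le> Ig" unfolding Ig_def by (intro integral_nonneg int) auto
  then have "Id \<le> \<rho>\<^sup>2 * If" using energy \<rho> by (simp add: field_simps)
  then have "T * Id \<le> T * (\<rho>\<^sup>2 * If)" using T by (intro mult_left_mono) auto
  then show "(g y)\<^sup>2 \<le> T * \<rho>\<^sup>2 * integral {0..T} (\<lambda>y. (f y)\<^sup>2)" if "y \<in> {0..T}" for y
    using sup[OF that] by (simp add: If_def mult.assoc)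
qed

section \<open>Successive smoothing by a list of rates\<close>

text \<open>The head of the list acts last on \<open>f\<close>; its rate is the one that enters the supremum bound.\<close>

primrec smooth_exps :: "real list \<Rightarrow> (real \<Rightarrow> real) \<Rightarrow> real \<Rightarrow> real" where
  "smooth_exps [] f = f"
| "smooth_exps (\<rho> # rs) f = smooth_exp \<rho> (smooth_exps rs f)"

text \<open>The measure is an accumulator: the head joins it first, while on the function side it is
  smoothed last. Integrating out one summand at a time therefore matches \<open>smooth_exps\<close>
  by induction on the list.\<close>

primrec conv_exps :: "real measure \<Rightarrow> real list \<Rightarrow> real measure" where
  "conv_exps \<mu> [] = \<mu>"
| "conv_exps \<mu> (\<rho> # rs) = conv_exps (\<mu> \<star> exp_law \<rho>) rs"

lemma periodic_bounded_smooth_exps: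
  assumes "periodic_bounded T C f" "\<forall>\<rho>\<in>set rs. \<rho> > 0"
  shows "periodic_bounded T C (smooth_exps rs f)"
  using assms(2) by (induction rs) (auto simp: assms(1) periodic_bounded_smooth_exp)

lemma integral_smooth_exps:
  assumes "periodic_bounded T C f" "\<forall>\<rho>\<in>set rs. \<rho> > 0" "T > 0"
  shows "integral {0..T} (smooth_exps rs f) = integral {0..T} f"
  using assms(2)
proof (induction rs)
  case (Cons \<rho> rs)
  have "integral {0..T} (smooth_exps (\<rho> # rs) f) = integral {0..T} (smooth_exps rs f)"
    using Cons.prems assms by (simp add: integral_smooth_exp[OF periodic_bounded_smooth_exps])
  then show ?case using Cons by simp
qed simp

lemma integral_conv_exps:
  assumes "periodic_bounded T C f" "\<forall>\<rho>\<in>set rs. \<rho> > 0" "real_distribution \<mu>"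
  shows "(\<integral>y. f y \<partial>conv_exps \<mu> rs) = (\<integral>y. smooth_exps rs f y \<partial>\<mu>)"
  using assms(2,3)
proof (induction rs arbitrary: \<mu>)
  case (Cons \<rho> rs)
  have \<rho>: "\<rho> > 0" using Cons.prems by simp
  have pb: "periodic_bounded T C (smooth_exps rs f)"
    using Cons.prems by (intro periodic_bounded_smooth_exps assms(1)) auto
  have "(\<integral>y. f y \<partial>conv_exps \<mu> (\<rho> # rs)) = (\<integral>y. smooth_exps rs f y \<partial>(\<mu> \<star> exp_law \<rho>))"
    using Cons.prems by (simp add: Cons.IH real_distribution_convolution real_distribution_exp_law \<rho>)
  also have "\<dots> = (\<integral>y. (\<integral>e. smooth_exps rs f (y + e) \<partial>exp_law \<rho>) \<partial>\<mu>)"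
    using pb Cons.prems(2) by (intro integral_convolution[where C = C] real_distribution_exp_law \<rho>) (auto simp: periodic_bounded_def)
  finally show ?case by (simp add: smooth_exp_def[abs_def])
qed simp

lemma has_laplace_conv_exps:
  assumes "has_laplace \<mu> c" "\<forall>\<rho>\<in>set rs. \<rho> > 0"
  shows "has_laplace (conv_exps \<mu> rs) (\<lambda>k. c k * (\<Prod>\<rho>\<leftarrow>rs. \<rho> / (\<rho> + real k)))"
  using assms
proof (induction rs arbitrary: \<mu> c)
  case (Cons \<rho> rs)
  have "has_laplace (\<mu> \<star> exp_law \<rho>) (\<lambda>k. c k * (\<rho> / (\<rho> + real k)))"
    using Cons.prems by (intro has_laplace_convolution has_laplace_exp_law) auto
  from Cons.IH[OF this] show ?case using Cons.prems by (simp add: mult.assoc)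
qed simp

text \<open>The last rate meets \<open>f\<close> itself, which need not be continuous, so the energy
  identity does not apply there. That rate is spent on continuity, with the bound \<open>C\<close>
  kept; each other rate earns its factor, whence \<open>butlast\<close>.\<close>

lemma smooth_exps_L2:
  assumes f: "periodic_bounded T C f" and pos: "\<forall>\<rho>\<in>set rs. \<rho> > 0" and T: "T > 0" and mean: "integral {0..T} f = 0"
    and "rs \<noteq> []"
  shows "continuous_on {0..T} (smooth_exps rs f) \<and>
    (\<Prod>\<rho>\<leftarrow>butlast rs. 1 + 1 / (\<rho> * T)\<^sup>2) * integral {0..T} (\<lambda>y. (smooth_exps rs f y)\<^sup>2) \<le> T * C\<^sup>2"
  using \<open>rs \<noteq> []\<close> pos
proof (induction rs rule: list_nonempty_induct)
  case (single \<rho>)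
  have cont: "continuous_on {0..T} (smooth_exp \<rho> f)"
    using single f by (intro continuous_on_smooth_exp) auto
  have "\<bar>smooth_exp \<rho> f y\<bar> \<le> \<bar>C\<bar>" for y
    using periodic_bounded_smooth_exp[OF f, of \<rho>] single by (auto simp: periodic_bounded_def intro: order_trans[OF _ abs_ge_self])
  then have "(smooth_exp \<rho> f y)\<^sup>2 \<le> C\<^sup>2" for y by (simp add: abs_le_square_iff[symmetric])
  then have "integral {0..T} (\<lambda>y. (smooth_exp \<rho> f y)\<^sup>2) \<le> integral {0..T} (\<lambda>y. C\<^sup>2)"
    using cont by (intro integral_le integrable_continuous_real continuous_intros) auto
  with cont T show ?case by simp
next
  case (cons \<rho> rs)
  define h where "h = smooth_exps rs f"
  have \<rho>: "\<rho> > 0" and h: "continuous_on {0..T} h"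
    and IH: "(\<Prod>\<rho>\<leftarrow>butlast rs. 1 + 1 / (\<rho> * T)\<^sup>2) * integral {0..T} (\<lambda>y. (h y)\<^sup>2) \<le> T * C\<^sup>2"
    using cons by (auto simp: h_def)
  have pb: "periodic_bounded T C h" unfolding h_def using cons.prems by (intro periodic_bounded_smooth_exps f) auto
  have mean_h: "integral {0..T} h = 0" unfolding h_def using cons.prems mean by (simp add: integral_smooth_exps[OF f _ T])
  have per: "smooth_exp \<rho> h T = smooth_exp \<rho> h 0"
  proof -
    have "smooth_exp \<rho> h (0 + T) = smooth_exp \<rho> h 0"
      using periodic_bounded_smooth_exp[OF pb \<rho>] unfolding periodic_bounded_def by blast
    then show ?thesis by simp
  qed
  have "(1 + 1 / (\<rho> * T)\<^sup>2) * integral {0..T} (\<lambda>y. (smooth_exp \<rho> h y)\<^sup>2) \<le> integral {0..T} (\<lambda>y. (h y)\<^sup>2)"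
    by (rule smoothing_energy(1)[OF T \<rho> h has_real_derivative_smooth_exp[OF pb \<rho> h] _ per])
       (simp_all add: integral_smooth_exp[OF pb \<rho> T] mean_h)
  then have "(\<Prod>\<rho>\<leftarrow>butlast rs. 1 + 1 / (\<rho> * T)\<^sup>2) * ((1 + 1 / (\<rho> * T)\<^sup>2) * integral {0..T} (\<lambda>y. (smooth_exp \<rho> h y)\<^sup>2))
      \<le> (\<Prod>\<rho>\<leftarrow>butlast rs. 1 + 1 / (\<rho> * T)\<^sup>2) * integral {0..T} (\<lambda>y. (h y)\<^sup>2)"
    by (intro mult_left_mono prod_list_nonneg) auto
  then have "(\<Prod>\<rho>\<leftarrow>butlast (\<rho> # rs). 1 + 1 / (\<rho> * T)\<^sup>2) * integral {0..T} (\<lambda>y. (smooth_exp \<rho> h y)\<^sup>2) \<le> T * C\<^sup>2"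
    using IH cons.hyps by (simp add: mult_ac)
  moreover have "continuous_on {0..T} (smooth_exp \<rho> h)" by (rule continuous_on_smooth_exp[OF pb \<rho>])
  ultimately show ?case by (simp add: h_def)
qed

text \<open>The head rate is spent on passing from \<open>L2\<close> to a bound at every point. The
  energy estimate costs \<open>T * \<rho>\<^sup>2\<close>, and the remaining
  \<open>T * C\<^sup>2\<close> bounds the square integral over one period before any shrinking.
  Periodicity moves \<open>y\<close> into that period.\<close>

lemma smooth_exps_sup:
  assumes f: "periodic_bounded T C f" and pos: "\<forall>\<rho>\<in>set (\<rho> # rs). \<rho> > 0" and T: "T > 0" and mean: "integral {0..T} f = 0"
    and "rs \<noteq> []"
  shows "(smooth_exps (\<rho> # rs) f y)\<^sup>2 \<le> (T * \<rho> * C)\<^sup>2 / (\<Prod>\<rho>\<leftarrow>butlast rs. 1 + 1 / (\<rho> * T)\<^sup>2)"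
proof -
  define h where "h = smooth_exps rs f"
  define P where "P = (\<Prod>\<rho>\<leftarrow>butlast rs. 1 + 1 / (\<rho> * T)\<^sup>2)"
  have "0 < (\<Prod>\<rho>\<leftarrow>xs. 1 + 1 / (\<rho> * T)\<^sup>2)" for xs
    by (induction xs) (auto intro!: mult_pos_pos add_pos_nonneg)
  then have P: "P > 0" unfolding P_def .
  have \<rho>: "\<rho> > 0" and h: "continuous_on {0..T} h" and L2: "P * integral {0..T} (\<lambda>y. (h y)\<^sup>2) \<le> T * C\<^sup>2"
    using smooth_exps_L2[OF f _ T mean \<open>rs \<noteq> []\<close>] pos by (auto simp: h_def P_def)
  have pb: "periodic_bounded T C h" unfolding h_def using pos by (intro periodic_bounded_smooth_exps f) auto
  have mean_h: "integral {0..T} h = 0" unfolding h_def using pos mean by (simp add: integral_smooth_exps[OF f _ T])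
  have per: "smooth_exp \<rho> h (y + T) = smooth_exp \<rho> h y" for y
    using periodic_bounded_smooth_exp[OF pb \<rho>] unfolding periodic_bounded_def by blast
  define y' where "y' = y - of_int \<lfloor>y / T\<rfloor> * T"
  have "of_int \<lfloor>y / T\<rfloor> * T \<le> y" "y < (of_int \<lfloor>y / T\<rfloor> + 1) * T"
    using T floor_divide_lower[of T y] floor_divide_upper[of T y] by auto
  then have y': "y' \<in> {0..T}" by (auto simp: y'_def algebra_simps)
  have "smooth_exp \<rho> h y = smooth_exp \<rho> h y'"
    using periodic_int[of "smooth_exp \<rho> h" T y' "\<lfloor>y / T\<rfloor>"] per by (simp add: y'_def)
  moreover have "(smooth_exp \<rho> h y')\<^sup>2 \<le> T * \<rho>\<^sup>2 * integral {0..T} (\<lambda>y. (h y)\<^sup>2)"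
    using per[of 0]
    by (intro smoothing_energy(2)[OF T \<rho> h has_real_derivative_smooth_exp[OF pb \<rho> h] _ _ y'])
       (simp_all add: integral_smooth_exp[OF pb \<rho> T] mean_h)
  moreover have "T * \<rho>\<^sup>2 * integral {0..T} (\<lambda>y. (h y)\<^sup>2) \<le> T * \<rho>\<^sup>2 * (T * C\<^sup>2 / P)"
    using L2 P T by (intro mult_left_mono) (auto simp: field_simps)
  ultimately show ?thesis
    by (simp add: h_def P_def power_mult_distrib power2_eq_square[of T] mult_ac)
qed

section \<open>Digits of a log-uniform variable\<close>

text \<open>Split off the top digit, r = d b^S + r'. The lower digits do not see \<open>d\<close>,
  which is either free, giving a factor \<open>b\<close>, or prescribed, giving a factor 1.\<close>

lemma sum_digits_prescribed:
  fixes b :: nat and \<kappa> :: "nat \<Rightarrow> nat"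
  assumes "b \<ge> 2" "P \<subseteq> {..<S}" "\<And>p. p \<in> P \<Longrightarrow> \<kappa> p < b"
  shows "(\<Sum>r<b ^ S. of_bool (\<forall>p\<in>P. r div b ^ p mod b = \<kappa> p) :: real) = real b ^ S / real b ^ card P"
  using assms(2,3)
proof (induction S arbitrary: P)
  case 0
  then have "P = {}" by auto
  then show ?case by simp
next
  case (Suc S)
  have finP: "finite P" using Suc.prems(1) finite_subset by blast
  have iff: "(\<forall>p\<in>P. (d * b ^ S + r) div b ^ p mod b = \<kappa> p) \<longleftrightarrow>
      (S \<in> P \<longrightarrow> d = \<kappa> S) \<and> (\<forall>p\<in>P - {S}. r div b ^ p mod b = \<kappa> p)" if "d < b" "r < b ^ S" for d r
  proof -
    have top: "(d * b ^ S + r) div b ^ S mod b = d" using that assms(1) by simp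
    have low: "(d * b ^ S + r) div b ^ p mod b = r div b ^ p mod b" if "p \<in> P - {S}" for p
    proof -
      have p: "p < S" using that Suc.prems(1) by (auto simp: less_Suc_eq)
      then have "b ^ S = b ^ (S - Suc p) * b * b ^ p"
        by (simp add: mult.assoc flip: power_Suc power_add)
      then have "d * b ^ S + r = r + (d * b ^ (S - Suc p) * b) * b ^ p" by (simp add: mult_ac)
      moreover have "b ^ p \<noteq> 0" using assms(1) by simp
      ultimately have "(d * b ^ S + r) div b ^ p = (d * b ^ (S - Suc p)) * b + r div b ^ p"
        by (metis div_mult_self1)
      then show ?thesis by simp
    qed
    have "P = (if S \<in> P then insert S (P - {S}) else P - {S})" by auto
    then have "(\<forall>p\<in>P. R p) \<longleftrightarrow> (S \<in> P \<longrightarrow> R S) \<and> (\<forall>p\<in>P - {S}. R p)" for R by (metis Ball_def Diff_iff singletonD)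
    then show ?thesis using top low by simp
  qed
  have "(\<Sum>r<b ^ Suc S. of_bool (\<forall>p\<in>P. r div b ^ p mod b = \<kappa> p) :: real)
      = (\<Sum>d<b. \<Sum>r\<in>{d * b ^ S..<d * b ^ S + b ^ S}. of_bool (\<forall>p\<in>P. r div b ^ p mod b = \<kappa> p))"
    by (simp only: sum.nat_group power_Suc)
  also have "\<dots> = (\<Sum>d<b. \<Sum>r<b ^ S. of_bool (\<forall>p\<in>P. (d * b ^ S + r) div b ^ p mod b = \<kappa> p))"
  proof (rule sum.cong[OF refl])
    fix d
    show "(\<Sum>r\<in>{d * b ^ S..<d * b ^ S + b ^ S}. of_bool (\<forall>p\<in>P. r div b ^ p mod b = \<kappa> p) :: real)
        = (\<Sum>r<b ^ S. of_bool (\<forall>p\<in>P. (d * b ^ S + r) div b ^ p mod b = \<kappa> p))"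
      by (rule sum.reindex_bij_witness[of _ "\<lambda>r. d * b ^ S + r" "\<lambda>r. r - d * b ^ S"]) auto
  qed
  also have "\<dots> = (\<Sum>d<b. of_bool (S \<in> P \<longrightarrow> d = \<kappa> S) * (\<Sum>r<b ^ S. of_bool (\<forall>p\<in>P - {S}. r div b ^ p mod b = \<kappa> p)))"
    unfolding sum_distrib_left by (intro sum.cong refl) (subst iff, auto)
  also have "\<dots> = (\<Sum>d<b. of_bool (S \<in> P \<longrightarrow> d = \<kappa> S)) * (real b ^ S / real b ^ card (P - {S}))"
    unfolding sum_distrib_right using Suc.prems by (subst Suc.IH) (auto simp: less_Suc_eq)
  also have "\<dots> = real b ^ Suc S / real b ^ card P"
  proof (cases "S \<in> P")
    case True
    have "(\<Sum>d<b. of_bool (d = \<kappa> S) :: real) = 1"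
      using Suc.prems(2)[OF True] by (simp add: of_bool_def)
    moreover have "real b ^ card P = real b * real b ^ card (P - {S})"
      unfolding card.remove[OF finP True] by (rule power_Suc)
    ultimately show ?thesis using True assms(1) by (simp only: power_Suc simp_thms) simp
  qed simp
  finally show ?case .
qed

text \<open>Since \<open>g\<close> sums to zero over the block, the constant \<open>w q\<close> may
  be subtracted from the weights; what remains is at most the drop of \<open>w\<close> over the
  block.\<close>

lemma block_sum_le:
  fixes w g :: "nat \<Rightarrow> real"
  assumes mono: "\<And>i j. i \<le> j \<Longrightarrow> q \<le> i \<Longrightarrow> w j \<le> w i"
    and g: "\<And>r. r < B \<Longrightarrow> \<bar>g r\<bar> \<le> 1" and sum0: "(\<Sum>r<B. g r) = 0"
  shows "\<bar>\<Sum>r<B. g r * w (q + r)\<bar> \<le> real B * (w q - w (q + B))"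
proof -
  have "(\<Sum>r<B. g r * w (q + r)) = (\<Sum>r<B. g r * (w (q + r) - w q)) + (\<Sum>r<B. g r) * w q"
    unfolding sum_distrib_right sum.distrib[symmetric] by (intro sum.cong refl) (simp add: algebra_simps)
  then have "\<bar>\<Sum>r<B. g r * w (q + r)\<bar> = \<bar>\<Sum>r<B. g r * (w (q + r) - w q)\<bar>" using sum0 by simp
  also have "\<dots> \<le> (\<Sum>r<B. \<bar>g r * (w (q + r) - w q)\<bar>)" by (rule sum_abs)
  also have "\<dots> \<le> (\<Sum>r<B. w q - w (q + B))"
  proof (rule sum_mono)
    fix r assume r: "r \<in> {..<B}"
    have "\<bar>g r * (w (q + r) - w q)\<bar> \<le> 1 * (w q - w (q + r))"
      unfolding abs_mult using g r mono[of q "q + r"] by (intro mult_mono) auto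
    also have "\<dots> \<le> w q - w (q + B)" using r mono[of "q + r" "q + B"] by simp
    finally show "\<bar>g r * (w (q + r) - w q)\<bar> \<le> w q - w (q + B)" .
  qed
  finally show ?thesis by simp
qed

text \<open>The drops of consecutive blocks telescope, so the bound does not grow with the number of
  blocks. \<open>Q = c * B\<close> makes every block start in phase with \<open>g\<close>.\<close>

lemma periodic_sum_le:
  fixes w g :: "nat \<Rightarrow> real"
  assumes mono: "\<And>i j. i \<le> j \<Longrightarrow> Q \<le> i \<Longrightarrow> w j \<le> w i"
    and g: "\<And>r. \<bar>g r\<bar> \<le> 1" and per: "\<And>r. g (r + B) = g r"
    and sum0: "(\<Sum>r<B. g r) = 0" and Q: "Q = c * B"
  shows "\<bar>\<Sum>q\<in>{Q..<Q + n * B}. g q * w q\<bar> \<le> real B * (w Q - w (Q + n * B))"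
proof (induction n)
  case (Suc n)
  define q where "q = Q + n * B"
  have per': "g (r + i * B) = g r" for r i
  proof (induction i)
    case (Suc i)
    have "g (r + Suc i * B) = g ((r + i * B) + B)" by (simp add: algebra_simps)
    then show ?case using per Suc by simp
  qed simp
  have eq: "(\<Sum>p\<in>{q..<q + B}. g p * w p) = (\<Sum>r<B. g r * w (q + r))"
  proof (rule sum.reindex_bij_witness[of _ "\<lambda>r. q + r" "\<lambda>p. p - q"])
    fix p assume "p \<in> {q..<q + B}"
    then have "g p = g ((p - q) + (c + n) * B)" by (simp add: q_def Q algebra_simps)
    then show "g (p - q) * w (q + (p - q)) = g p * w p" using \<open>p \<in> _\<close> per' by simp
  qed auto
  have "(\<Sum>p\<in>{Q..<Q + Suc n * B}. g p * w p) = (\<Sum>p\<in>{Q..<q}. g p * w p) + (\<Sum>p\<in>{q..<q + B}. g p * w p)"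
    by (subst sum.atLeastLessThan_concat) (auto simp: q_def algebra_simps)
  then have "\<bar>\<Sum>p\<in>{Q..<Q + Suc n * B}. g p * w p\<bar> \<le> \<bar>\<Sum>p\<in>{Q..<q}. g p * w p\<bar> + \<bar>\<Sum>r<B. g r * w (q + r)\<bar>"
    unfolding eq by simp
  also have "\<dots> \<le> real B * (w Q - w q) + real B * (w q - w (q + B))"
    using Suc.IH unfolding q_def
    by (intro add_mono block_sum_le) (auto intro!: mono g sum0)
  also have "\<dots> = real B * (w Q - w (Q + Suc n * B))"
    by (simp add: q_def algebra_simps)
  finally show ?case .
qed simp

text \<open>Here \<open>M\<close> is the floor of \<open>u\<close>, and removing it leaves the
  fractional part: in the logarithm the digits have period one.\<close>

lemma digit_powr:
  assumes "b \<ge> 2"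
  shows "digit b n (real b powr u) = nat (\<lfloor>real b powr (frac u + real n - 1)\<rfloor> mod int b)"
  using assms by (simp add: digit_def frac_def log_powr_cancel algebra_simps flip: powr_add)

lemma integral_step_function:
  fixes h :: "real \<Rightarrow> real" and c :: "nat \<Rightarrow> real"
  assumes "Q \<le> n" and "\<And>q. Q \<le> q \<Longrightarrow> q < n \<Longrightarrow> c q \<le> c (Suc q)"
    and "\<And>q u. Q \<le> q \<Longrightarrow> q < n \<Longrightarrow> c q \<le> u \<Longrightarrow> u < c (Suc q) \<Longrightarrow> h u = G q"
  shows "(h has_integral (\<Sum>q\<in>{Q..<n}. G q * (c (Suc q) - c q))) {c Q..c n} \<and> c Q \<le> c n"
  using assms
proof (induction n rule: dec_induct)
  case (step n)
  have IH: "(h has_integral (\<Sum>q\<in>{Q..<n}. G q * (c (Suc q) - c q))) {c Q..c n}" "c Q \<le> c n"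
    using step.IH step.prems by auto
  have le: "c n \<le> c (Suc n)" using step by simp
  have "((\<lambda>_. G n) has_integral G n * (c (Suc n) - c n)) {c n..c (Suc n)}"
    using has_integral_const_real[of "G n" "c n" "c (Suc n)"] le by (simp add: mult.commute)
  \<comment> \<open>The right endpoint already belongs to the next piece; a single point is
    negligible.\<close>
  then have "(h has_integral G n * (c (Suc n) - c n)) {c n..c (Suc n)}"
    by (rule has_integral_spike_finite[of "{c (Suc n)}", rotated 2]) (use step in auto)
  from has_integral_combine[OF IH(2) le IH(1) this] show ?case
    using step.hyps le IH(2) by simp
qed auto

text \<open>Scaling by b^D, with \<open>D\<close> chosen so that the last requested digit becomes
  the units digit, makes every requested digit a digit of the integer part q, which runs from
  \<open>Q\<close> to \<open>b * Q\<close>. The u with integer part q form an interval of length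
  log_b(1 + 1/q), decreasing in q, and the pattern has period \<open>B = b ^ S\<close>. The error is
  at most \<open>B\<close> times the first weight, that is b^S / (b^D ln b), and D - S = n 0 - 2
  gives the constant.\<close>

lemma integral_digits:
  fixes b L :: nat and n k :: "nat \<Rightarrow> nat"
  assumes b: "b \<ge> 2" and L: "L \<ge> 1" and n0: "n 0 \<ge> 2"
    and mono: "\<And>i j. i < j \<Longrightarrow> j < L \<Longrightarrow> n i < n j" and k: "\<And>l. l < L \<Longrightarrow> k l < b"
  shows "\<bar>integral {0..1} (\<lambda>u. of_bool (\<forall>l<L. digit b (n l) (real b powr u) = k l)) - 1 / real b ^ L\<bar>
     \<le> (real b)\<^sup>2 / ln (real b) / real b ^ n 0"
proof -
  define h where "h u = (of_bool (\<forall>l<L. digit b (n l) (real b powr u) = k l) :: real)" for u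
  define D where "D = n (L - 1) - 1"
  define s where "s l = n (L - 1) - n l" for l
  define S where "S = Suc (s 0)"
  define Q where "Q = b ^ D"
  define B where "B = b ^ S"
  define P where "P = s ` {..<L}"
  \<comment> \<open>\<open>s l\<close> is the place of the l-th requested digit, counted from the
    units; \<kappa> transports the prescribed values from indices to places.\<close>
  define \<kappa> where "\<kappa> p = k (inv_into {..<L} s p)" for p
  define G where "G q = (of_bool (\<forall>p\<in>P. q div b ^ p mod b = \<kappa> p) :: real)" for q
  define c where "c q = log (real b) (real q) - real D" for q
  define w where "w q = c (Suc q) - c q" for q
  have mono': "n i \<le> n j" if "i \<le> j" "j < L" for i j
    using mono[of i j] that by (cases "i = j") auto
  have n_ge: "n 0 \<le> n l" "n l \<le> n (L - 1)" if "l < L" for l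
    using mono'[of 0 l] mono'[of l "L - 1"] that by auto
  have inj: "inj_on s {..<L}"
  proof (rule linorder_inj_onI)
    fix i j assume "i < j" "i \<in> {..<L}" "j \<in> {..<L}"
    then show "s i \<noteq> s j" using mono[of i j] n_ge[of j] by (auto simp: s_def)
  qed auto
  have \<kappa>: "\<kappa> (s l) = k l" if "l < L" for l
    using that inj by (simp add: \<kappa>_def)
  have cardP: "card P = L" unfolding P_def by (simp add: card_image[OF inj])
  have P_sub: "P \<subseteq> {..<S}" using n_ge by (force simp: P_def S_def s_def)
  have bpos: "real b > 1" using b by simp
  have Qpos: "Q > 0" using b by (simp add: Q_def)
  have n1: "n l \<ge> 2" if "l < L" for l using n_ge(1)[OF that] n0 by linarith
  have h_eq: "h u = G (nat \<lfloor>real b powr (u + real D)\<rfloor>)" if u: "0 \<le> u" "u < 1" for u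
  proof -
    have "digit b (n l) (real b powr u) = nat \<lfloor>real b powr (u + real D)\<rfloor> div b ^ s l mod b" if l: "l < L" for l
    proof -
      have e: "u + real (n l) - 1 = (u + real D) - real (s l)"
        using n_ge(2)[OF l] n1[OF l] by (simp add: D_def s_def of_nat_diff)
      have "real b powr (u + real (n l) - 1) = real b powr (u + real D) / real_of_int (int (b ^ s l))"
        unfolding e powr_diff using bpos by (simp add: powr_realpow)
      then have "\<lfloor>real b powr (u + real (n l) - 1)\<rfloor> = \<lfloor>real b powr (u + real D)\<rfloor> div int (b ^ s l)"
        by (simp only: floor_divide_real_eq_div)
      moreover have "\<lfloor>real b powr (u + real D)\<rfloor> = int (nat \<lfloor>real b powr (u + real D)\<rfloor>)" by simp
      moreover have "frac u = u" using u by (simp add: frac_eq)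
      ultimately have "digit b (n l) (real b powr u) = nat (int (nat \<lfloor>real b powr (u + real D)\<rfloor>) div int (b ^ s l) mod int b)"
        unfolding digit_powr[OF b] by metis
      then show ?thesis by (simp only: zdiv_int[symmetric] zmod_int[symmetric] nat_int)
    qed
    then show ?thesis unfolding h_def G_def P_def by (auto simp: \<kappa>)
  qed
  have c_Q: "c Q = 0" "c (b * Q) = 1"
    using bpos by (simp_all add: c_def Q_def log_nat_power log_mult)
  have c_bounds: "real b powr (c q + real D) = real q" if "q > 0" for q
    using bpos that by (simp add: c_def)
  have c_mono: "c q \<le> c (Suc q)" if "Q \<le> q" for q
    using that Qpos bpos by (simp add: c_def)
  have step: "h u = G q" if q: "Q \<le> q" "q < b * Q" and u: "c q \<le> u" "u < c (Suc q)" for q u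
  proof -
    have qpos: "q > 0" using q Qpos by linarith
    have "0 \<le> u"
    proof -
      have "c Q \<le> c q" using q Qpos bpos by (simp add: c_def)
      then show ?thesis using u c_Q by simp
    qed
    moreover have "u < 1"
    proof -
      have "c (Suc q) \<le> c (b * Q)" using q Qpos bpos unfolding c_def
        by (intro diff_right_mono log_mono bpos) (simp_all del: of_nat_Suc of_nat_mult)
      then show ?thesis using u c_Q by simp
    qed
    moreover have "nat \<lfloor>real b powr (u + real D)\<rfloor> = q"
    proof -
      have "real b powr (c q + real D) \<le> real b powr (u + real D)" "real b powr (u + real D) < real b powr (c (Suc q) + real D)"
        using u bpos by auto
      then have "real q \<le> real b powr (u + real D)" "real b powr (u + real D) < real q + 1"
        using c_bounds[of q] c_bounds[of "Suc q"] qpos by auto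
      then have "\<lfloor>real b powr (u + real D)\<rfloor> = int q" by (intro floor_unique) auto
      then show ?thesis by simp
    qed
    ultimately show ?thesis using h_eq by simp
  qed
  have QbQ: "Q \<le> b * Q" using b by simp
  have int_h: "(h has_integral (\<Sum>q\<in>{Q..<b * Q}. G q * w q)) {0..1}"
    using integral_step_function[OF QbQ, of c h G] c_mono step unfolding w_def c_Q by blast
  have sum_w: "(\<Sum>q\<in>{Q..<b * Q}. w q) = 1"
    unfolding w_def using sum_Suc_diff'[OF QbQ, of c] c_Q by simp
  have w_eq: "w q = ln (1 + 1 / real q) / ln (real b)" if "q > 0" for q
  proof -
    have "ln (real (Suc q)) - ln (real q) = ln (real (Suc q) / real q)" using that by (simp add: ln_div)
    also have "real (Suc q) / real q = 1 + 1 / real q" using that by (simp add: field_simps)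
    finally show ?thesis by (simp add: w_def c_def log_def del: of_nat_Suc flip: diff_divide_distrib)
  qed
  have w_mono: "w j \<le> w i" if "i \<le> j" "Q \<le> i" for i j
  proof -
    have "0 < i" "0 < j" using that Qpos by auto
    moreover have "ln (1 + 1 / real j) \<le> ln (1 + 1 / real i)"
      using that \<open>0 < i\<close> \<open>0 < j\<close> by (subst ln_le_cancel_iff) (auto intro!: add_pos_nonneg divide_left_mono)
    ultimately show ?thesis using bpos by (auto simp: w_eq intro!: divide_right_mono)
  qed
  define g where "g q = G q - 1 / real b ^ L" for q
  have L1: "1 / real b ^ L \<le> 1" "0 \<le> 1 / real b ^ L" using bpos by (auto intro!: one_le_power)
  have g_le: "\<bar>g r\<bar> \<le> 1" for r using L1 by (auto simp: g_def G_def)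
  have g_per: "g (r + B) = g r" for r
  proof -
    have "(r + B) div b ^ p mod b = r div b ^ p mod b" if "p \<in> P" for p
    proof -
      have "p < S" using that P_sub by auto
      then have "B = (b ^ (S - Suc p) * b) * b ^ p"
        unfolding B_def by (simp add: mult.assoc flip: power_Suc power_add)
      moreover have "b ^ p \<noteq> 0" using b by simp
      ultimately have "(r + B) div b ^ p = r div b ^ p + b ^ (S - Suc p) * b" by simp
      then show ?thesis by simp
    qed
    then show ?thesis by (simp add: g_def G_def)
  qed
  have g_sum: "(\<Sum>r<B. g r) = 0"
  proof -
    have "(\<Sum>r<B. G r) = real b ^ S / real b ^ L"
      unfolding B_def G_def cardP[symmetric]
      by (rule sum_digits_prescribed[OF b P_sub]) (auto simp: P_def \<kappa> k)
    then show ?thesis by (simp add: g_def sum_subtractf B_def)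
  qed
  have SD: "D = (n 0 - 2) + S" using n_ge(2)[of 0] n0 L by (simp add: D_def S_def s_def)
  have QB: "Q = b ^ (n 0 - 2) * B" unfolding Q_def B_def SD power_add ..
  \<comment> \<open>The range from \<open>Q\<close> to \<open>b * Q\<close> is a whole number of
    periods. \<open>n 0 \<ge> 2\<close> enters here: it makes \<open>Q\<close> itself a multiple of
    \<open>B\<close>.\<close>
  have bQ: "b * Q = Q + ((b - 1) * b ^ (n 0 - 2)) * B"
    using b unfolding QB by (simp add: algebra_simps)
  have "\<bar>\<Sum>q\<in>{Q..<b * Q}. g q * w q\<bar> \<le> real B * (w Q - w (b * Q))"
    unfolding bQ by (rule periodic_sum_le[OF w_mono g_le g_per g_sum QB])
  also have "\<dots> \<le> real B * w Q"
  proof (intro mult_left_mono)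
    have "0 < b * Q" using b Qpos by simp
    then have "w (b * Q) \<ge> 0"
      unfolding w_eq[OF \<open>0 < b * Q\<close>] using bpos by (intro divide_nonneg_pos) auto
    then show "w Q - w (b * Q) \<le> w Q" by simp
  qed simp
  also have "\<dots> \<le> real B * (1 / real Q / ln (real b))"
    unfolding w_eq[OF Qpos] using bpos ln_add_one_self_le_self[of "1 / real Q"] 
    by (intro mult_left_mono divide_right_mono) auto
  also have "\<dots> = (real b)\<^sup>2 / ln (real b) / real b ^ n 0"
  proof -
    have "real b ^ n 0 = real b ^ (n 0 - 2) * (real b)\<^sup>2"
      using n0 by (metis le_add_diff_inverse2 power_add)
    moreover have "Y * (1 / (X * Y) / l) = z / l / (X * z)" if "X > 0" "Y > 0" "z > 0" for X Y l z :: real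
      using that by simp
    ultimately show ?thesis
      using bpos unfolding QB by (simp add: B_def)
  qed
  finally have "\<bar>\<Sum>q\<in>{Q..<b * Q}. g q * w q\<bar> \<le> (real b)\<^sup>2 / ln (real b) / real b ^ n 0" .
  moreover have "(\<Sum>q\<in>{Q..<b * Q}. g q * w q) = integral {0..1} h - 1 / real b ^ L"
  proof -
    have "(\<Sum>q\<in>{Q..<b * Q}. g q * w q) = (\<Sum>q\<in>{Q..<b * Q}. G q * w q) - 1 / real b ^ L * (\<Sum>q\<in>{Q..<b * Q}. w q)"
      by (simp add: g_def sum_distrib_left left_diff_distrib sum_subtractf)
    then show ?thesis using integral_unique[OF int_h] sum_w by simp
  qed
  ultimately show ?thesis unfolding h_def by simp
qed

section \<open>Exponential components of the circular ensemble\<close>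

text \<open>The rates split off Beta(x/2, x/2) with the largest admissible number of them, the
  integer part of x/2; so all rates lie between x/2 and x.\<close>

definition beta_rates :: "real \<Rightarrow> real list" where
  "beta_rates x = map (\<lambda>i. x / 2 + real i) [0..<nat \<lfloor>x / 2\<rfloor>]"

text \<open>No rates come from a \<open>j\<close> with \<open>\<xi>\<^sub>j < 2\<close>, so every rate is at least \<open>1\<close>.\<close>

primrec cbe_rates :: "real \<Rightarrow> nat \<Rightarrow> real list" where
  "cbe_rates \<beta> 0 = []"
| "cbe_rates \<beta> (Suc N) = cbe_rates \<beta> N @ beta_rates (1 + \<beta> / 2 * real N)"

text \<open>Write p = x/2 and (p)_k for the rising factorial. The quotient of the transforms of
  Beta(p, p) and Beta(p+m, p-m) is (p)_k / (p+m)_k. Splitting (p)_(k+m) in both ways, this equals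
  (p)_m / (p+k)_m, which is the transform of a sum of exponentials with rates p, ..., p+m-1.\<close>

lemma has_laplace_beta_half:
  assumes "x \<ge> 1"
  shows "\<exists>\<mu> c. has_laplace \<mu> c \<and>
    (\<forall>k. c k * (\<Prod>\<rho>\<leftarrow>beta_rates x. \<rho> / (\<rho> + real k)) = (\<Prod>i<k. (x / 2 + real i) / (x + real i)))"
proof -
  define m where "m = nat \<lfloor>x / 2\<rfloor>"
  have "real m = of_int \<lfloor>x / 2\<rfloor>" using assms by (simp add: m_def)
  then have m: "real m \<le> x / 2" using of_int_floor_le[of "x / 2"] by linarith
  define p where "p = x / 2"
  have p: "p > 0" using assms by (simp add: p_def)
  obtain \<mu> where \<mu>: "has_laplace \<mu> (\<lambda>k. \<Prod>i<k. (p + real m + real i) / ((p + real m) + (p - real m) + real i))"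
    using has_laplace_beta_nonneg[of "p + real m" "p - real m"] m p by (auto simp: p_def)
  have "(\<Prod>i<k. (p + real m + real i) / ((p + real m) + (p - real m) + real i)) * (\<Prod>\<rho>\<leftarrow>beta_rates x. \<rho> / (\<rho> + real k))
      = (\<Prod>i<k. (x / 2 + real i) / (x + real i))" for k
  proof -
    have "(\<Prod>\<rho>\<leftarrow>beta_rates x. \<rho> / (\<rho> + real k)) = (\<Prod>i<m. (p + real i) / (p + real k + real i))"
      unfolding beta_rates_def m_def p_def map_map comp_def
      by (simp add: prod.list_conv_set_nth atLeast0LessThan add_ac)
    also have "\<dots> = pochhammer p m / pochhammer (p + real k) m"
      by (simp add: pochhammer_prod prod_dividef atLeast0LessThan)
    finally have 1: "(\<Prod>\<rho>\<leftarrow>beta_rates x. \<rho> / (\<rho> + real k)) = pochhammer p m / pochhammer (p + real k) m" .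
    have "pochhammer p m * pochhammer (p + real m) k = pochhammer p k * pochhammer (p + real k) m"
      using pochhammer_product'[of p m k] pochhammer_product'[of p k m] by (simp add: add.commute)
    moreover have "pochhammer (p + real k) m > 0" using p by (intro pochhammer_pos) simp
    ultimately have 2: "pochhammer (p + real m) k * (pochhammer p m / pochhammer (p + real k) m) = pochhammer p k"
      by (simp add: field_simps)
    have "(\<Prod>i<k. (p + real m + real i) / ((p + real m) + (p - real m) + real i))
        = pochhammer (p + real m) k / (\<Prod>i<k. x + real i)"
      by (simp add: pochhammer_prod prod_dividef atLeast0LessThan p_def)
    then have "(\<Prod>i<k. (p + real m + real i) / ((p + real m) + (p - real m) + real i)) * (\<Prod>\<rho>\<leftarrow>beta_rates x. \<rho> / (\<rho> + real k))
       = pochhammer p k / (\<Prod>i<k. x + real i)"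
      unfolding 1 2[symmetric] by simp
    then show ?thesis
      by (simp add: pochhammer_prod prod_dividef atLeast0LessThan p_def)
  qed
  with \<mu> show ?thesis by blast
qed

text \<open>Only the first of the two beta factors gives up exponentials; the second goes whole into
  the remaining law.\<close>

lemma has_laplace_cbe_factor:
  assumes "x \<ge> 1"
  shows "\<exists>\<mu> c. has_laplace \<mu> c \<and>
    (\<forall>k. c k * (\<Prod>\<rho>\<leftarrow>beta_rates x. \<rho> / (\<rho> + real k)) = (\<Prod>i<k. (x / 2 + real i) * ((x + 1) / 2 + real i) / (x + real i)\<^sup>2))"
proof -
  obtain \<mu> c where \<mu>: "has_laplace \<mu> c"
    and c: "\<And>k. c k * (\<Prod>\<rho>\<leftarrow>beta_rates x. \<rho> / (\<rho> + real k)) = (\<Prod>i<k. (x / 2 + real i) / (x + real i))"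
    using has_laplace_beta_half[OF assms] by blast
  obtain \<nu> where \<nu>: "has_laplace \<nu> (\<lambda>k. \<Prod>i<k. ((x + 1) / 2 + real i) / ((x + 1) / 2 + (x - 1) / 2 + real i))"
    using has_laplace_beta_nonneg[of "(x + 1) / 2" "(x - 1) / 2"] assms by auto
  have half: "(x + 1) / 2 + (x - 1) / 2 = x" by (simp add: field_simps)
  have "(c k * (\<Prod>i<k. ((x + 1) / 2 + real i) / (x + real i))) * (\<Prod>\<rho>\<leftarrow>beta_rates x. \<rho> / (\<rho> + real k))
     = (\<Prod>i<k. (x / 2 + real i) * ((x + 1) / 2 + real i) / (x + real i)\<^sup>2)" for k
  proof -
    have "(c k * (\<Prod>i<k. ((x + 1) / 2 + real i) / (x + real i))) * (\<Prod>\<rho>\<leftarrow>beta_rates x. \<rho> / (\<rho> + real k))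
       = (c k * (\<Prod>\<rho>\<leftarrow>beta_rates x. \<rho> / (\<rho> + real k))) * (\<Prod>i<k. ((x + 1) / 2 + real i) / (x + real i))"
      by (simp only: mult_ac)
    also have "\<dots> = (\<Prod>i<k. (x / 2 + real i) * ((x + 1) / 2 + real i) / (x + real i)\<^sup>2)"
      unfolding c prod.distrib[symmetric] times_divide_times_eq power2_eq_square ..
    finally show ?thesis .
  qed
  with has_laplace_convolution[OF \<mu> \<nu>[unfolded half]] show ?thesis by blast
qed

lemma has_laplace_cbe:
  assumes "\<beta> > 0"
  defines "\<xi> \<equiv> \<lambda>j::nat. 1 + \<beta> / 2 * real j"
  shows "\<exists>\<mu> c. has_laplace \<mu> c \<and> (\<forall>k. c k * (\<Prod>\<rho>\<leftarrow>cbe_rates \<beta> N. \<rho> / (\<rho> + real k))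
    = (\<Prod>i<k. \<Prod>j<N. (\<xi> j / 2 + real i) * ((\<xi> j + 1) / 2 + real i) / (\<xi> j + real i)\<^sup>2))"
proof (induction N)
  case 0
  then show ?case using has_laplace_one by auto
next
  case (Suc N)
  then obtain \<mu> c where \<mu>: "has_laplace \<mu> c"
    and c: "\<And>k. c k * (\<Prod>\<rho>\<leftarrow>cbe_rates \<beta> N. \<rho> / (\<rho> + real k))
      = (\<Prod>i<k. \<Prod>j<N. (\<xi> j / 2 + real i) * ((\<xi> j + 1) / 2 + real i) / (\<xi> j + real i)\<^sup>2)" by blast
  have "\<xi> N \<ge> 1" using assms(1) by (simp add: \<xi>_def)
  then obtain \<nu> d where \<nu>: "has_laplace \<nu> d"
    and d: "\<And>k. d k * (\<Prod>\<rho>\<leftarrow>beta_rates (\<xi> N). \<rho> / (\<rho> + real k))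
      = (\<Prod>i<k. (\<xi> N / 2 + real i) * ((\<xi> N + 1) / 2 + real i) / (\<xi> N + real i)\<^sup>2)"
    using has_laplace_cbe_factor by blast
  have "(c k * d k) * (\<Prod>\<rho>\<leftarrow>cbe_rates \<beta> (Suc N). \<rho> / (\<rho> + real k))
      = (\<Prod>i<k. \<Prod>j<Suc N. (\<xi> j / 2 + real i) * ((\<xi> j + 1) / 2 + real i) / (\<xi> j + real i)\<^sup>2)" for k
  proof -
    have "(c k * d k) * (\<Prod>\<rho>\<leftarrow>cbe_rates \<beta> (Suc N). \<rho> / (\<rho> + real k))
        = (c k * (\<Prod>\<rho>\<leftarrow>cbe_rates \<beta> N. \<rho> / (\<rho> + real k))) * (d k * (\<Prod>\<rho>\<leftarrow>beta_rates (\<xi> N). \<rho> / (\<rho> + real k)))"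
      by (simp only: cbe_rates.simps \<xi>_def map_append prod_list.append mult_ac)
    then show ?thesis unfolding c d prod.distrib[symmetric] prod.lessThan_Suc .
  qed
  with has_laplace_convolution[OF \<mu> \<nu>] show ?case by blast
qed

lemma beta_rates_ge_1: "\<rho> \<in> set (beta_rates x) \<Longrightarrow> \<rho> \<ge> 1"
proof -
  assume "\<rho> \<in> set (beta_rates x)"
  then obtain i where i: "i < nat \<lfloor>x / 2\<rfloor>" "\<rho> = x / 2 + real i" by (auto simp: beta_rates_def)
  then have "1 \<le> \<lfloor>x / 2\<rfloor>" by linarith
  then have "1 \<le> x / 2" by (simp add: le_floor_iff)
  with i show ?thesis by simp
qed

lemma cbe_rates_ge_1: "\<rho> \<in> set (cbe_rates \<beta> N) \<Longrightarrow> \<rho> \<ge> 1"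
  by (induction N) (auto dest: beta_rates_ge_1)

lemma law_char_ratio:
  assumes "\<beta> > 0"
  shows "\<exists>\<mu>. real_distribution \<mu> \<and>
    distr (cbe N \<beta>) borel (char_ratio N \<theta>) = distr (conv_exps \<mu> (cbe_rates \<beta> N)) borel (\<lambda>y. exp (- y))"
proof -
  obtain \<mu> c where \<mu>: "has_laplace \<mu> c"
    and c: "\<And>k. c k * (\<Prod>\<rho>\<leftarrow>cbe_rates \<beta> N. \<rho> / (\<rho> + real k))
      = (\<Prod>i<k. \<Prod>j<N. ((1 + \<beta> / 2 * real j) / 2 + real i) * ((1 + \<beta> / 2 * real j + 1) / 2 + real i) / (1 + \<beta> / 2 * real j + real i)\<^sup>2)"
    using has_laplace_cbe[OF assms, of N] by blast
  have "has_laplace (conv_exps \<mu> (cbe_rates \<beta> N)) (\<lambda>k. c k * (\<Prod>\<rho>\<leftarrow>cbe_rates \<beta> N. \<rho> / (\<rho> + real k)))"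
    using cbe_rates_ge_1 by (intro has_laplace_conv_exps \<mu>) (fastforce intro: less_le_trans[OF zero_less_one])
  then have rd: "real_distribution (conv_exps \<mu> (cbe_rates \<beta> N))" and nonneg: "AE y in conv_exps \<mu> (cbe_rates \<beta> N). 0 \<le> y"
    and lap: "\<And>k. (\<integral>y. exp (- (real k * y)) \<partial>conv_exps \<mu> (cbe_rates \<beta> N)) = c k * (\<Prod>\<rho>\<leftarrow>cbe_rates \<beta> N. \<rho> / (\<rho> + real k))"
    by (auto simp: has_laplace_def)
  interpret C: real_distribution "conv_exps \<mu> (cbe_rates \<beta> N)" by fact
  interpret P: prob_space "cbe N \<beta>" by (rule prob_space_cbe[OF assms])
  have [measurable]: "char_ratio N \<theta> \<in> borel_measurable (cbe N \<beta>)"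
    using measurable_char_ratio by (simp cong: measurable_cong_sets)
  have "distr (cbe N \<beta>) borel (char_ratio N \<theta>) = distr (conv_exps \<mu> (cbe_rates \<beta> N)) borel (\<lambda>y. exp (- y))"
  proof (rule moments_determine_law)
    show "real_distribution (distr (cbe N \<beta>) borel (char_ratio N \<theta>))"
      by (intro P.real_distribution_distr) measurable
    show "real_distribution (distr (conv_exps \<mu> (cbe_rates \<beta> N)) borel (\<lambda>y. exp (- y)))"
      by (intro C.real_distribution_distr) measurable
    show "AE x in distr (cbe N \<beta>) borel (char_ratio N \<theta>). 0 \<le> x \<and> x \<le> 1"
      by (subst AE_distr_iff) (auto simp: char_ratio_bounds)
    have "AE y in conv_exps \<mu> (cbe_rates \<beta> N). 0 \<le> exp (- y) \<and> exp (- y) \<le> 1"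
      using nonneg by eventually_elim simp
    then show "AE x in distr (conv_exps \<mu> (cbe_rates \<beta> N)) borel (\<lambda>y. exp (- y)). 0 \<le> x \<and> x \<le> 1"
      by (subst AE_distr_iff) auto
    fix k
    have "(\<integral>x. x ^ k \<partial>distr (cbe N \<beta>) borel (char_ratio N \<theta>)) = (\<integral>x. char_ratio N \<theta> x ^ k \<partial>cbe N \<beta>)"
      by (subst integral_distr) auto
    also have "\<dots> = (\<integral>y. exp (- (real k * y)) \<partial>conv_exps \<mu> (cbe_rates \<beta> N))"
      unfolding lap c moment_char_ratio[OF assms] ..
    also have "\<dots> = (\<integral>x. x ^ k \<partial>distr (conv_exps \<mu> (cbe_rates \<beta> N)) borel (\<lambda>y. exp (- y)))"
      by (subst integral_distr) (auto simp flip: exp_of_nat_mult)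
    finally show "(\<integral>x. x ^ k \<partial>distr (cbe N \<beta>) borel (char_ratio N \<theta>))
        = (\<integral>x. x ^ k \<partial>distr (conv_exps \<mu> (cbe_rates \<beta> N)) borel (\<lambda>y. exp (- y)))" .
  qed
  then show ?thesis using \<mu> by (auto simp: has_laplace_def)
qed

section \<open>Growth of the total contraction\<close>

lemma powr_ratio_le:
  assumes "\<kappa> > 0" "j \<ge> 1"
  shows "((j + 1) / j) powr (\<kappa> / (1 + \<kappa>)) \<le> 1 + \<kappa> / (j::real)"
proof -
  define u where "u = \<kappa> / j"
  have u: "u > 0" using assms by (simp add: u_def)
  \<comment> \<open>The exponent \<kappa>/(1+\<kappa>) is chosen to meet this \<open>v\<close>: for
    j at least 1, \<kappa>/((1+\<kappa>) j) is at most \<kappa>/(j+\<kappa>) = v, and exp v is at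
    most 1 + u.\<close>
  define v where "v = u / (1 + u)"
  have "1 / (1 + u) = 1 - v" using u by (simp add: v_def field_simps)
  also have "\<dots> \<le> exp (- v)" using exp_ge_add_one_self[of "- v"] by simp
  finally have ev: "exp v \<le> 1 + u" using u by (simp add: exp_minus field_simps)
  have "ln (1 + 1 / j) \<le> 1 / j" using assms by (intro ln_add_one_self_le_self) simp
  then have "\<kappa> / (1 + \<kappa>) * ln (1 + 1 / j) \<le> \<kappa> / (1 + \<kappa>) * (1 / j)"
    using assms by (intro mult_left_mono) auto
  also have "\<dots> = \<kappa> / (j + \<kappa> * j)" using assms by (simp add: field_simps)
  also have "\<dots> \<le> \<kappa> / (j + \<kappa>)"
    using assms by (intro divide_left_mono add_left_mono) (auto intro!: mult_pos_pos add_pos_pos)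
  also have "\<dots> = v" using assms by (simp add: v_def u_def field_simps)
  finally have "exp (\<kappa> / (1 + \<kappa>) * ln (1 + 1 / j)) \<le> exp v" by simp
  moreover have "(j + 1) / j = 1 + 1 / j" using assms by (simp add: field_simps)
  moreover have "1 + 1 / j \<noteq> 0" using assms by (simp add: add_nonneg_eq_0_iff)
  ultimately have "((j + 1) / j) powr (\<kappa> / (1 + \<kappa>)) \<le> exp v"
    unfolding powr_def by (simp only: if_False)
  also note ev
  finally show ?thesis by (simp add: u_def)
qed

lemma prod_list_one_plus_ge:
  fixes f :: "'a \<Rightarrow> real"
  assumes "\<And>x. x \<in> set xs \<Longrightarrow> f x \<ge> 0"
  shows "1 + (\<Sum>x\<leftarrow>xs. f x) \<le> (\<Prod>x\<leftarrow>xs. 1 + f x)"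
  using assms
proof (induction xs)
  case (Cons a xs)
  have IH: "1 + (\<Sum>x\<leftarrow>xs. f x) \<le> (\<Prod>x\<leftarrow>xs. 1 + f x)" and a: "f a \<ge> 0" using Cons by auto
  have s: "(\<Sum>x\<leftarrow>xs. f x) \<ge> 0" using Cons.prems by (intro sum_list_nonneg) auto
  have "1 + (f a + (\<Sum>x\<leftarrow>xs. f x)) \<le> (1 + f a) * (1 + (\<Sum>x\<leftarrow>xs. f x))"
    using a s by (simp add: algebra_simps)
  also have "\<dots> \<le> (1 + f a) * (\<Prod>x\<leftarrow>xs. 1 + f x)" using IH a by (intro mult_left_mono) auto
  finally show ?case by simp
qed simp

text \<open>The factor by which the squared \<open>L\<^sup>2\<close> norm shrinks.\<close>

definition gain :: "real \<Rightarrow> real list \<Rightarrow> real" where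
  "gain T rs = (\<Prod>\<rho>\<leftarrow>rs. 1 + 1 / (\<rho> * T)\<^sup>2)"

lemma gain_ge_1: "gain T rs \<ge> 1"
proof -
  have "0 \<le> (\<Sum>\<rho>\<leftarrow>rs. 1 / (\<rho> * T)\<^sup>2)" by (intro sum_list_nonneg) auto
  also have "1 + \<dots> \<le> gain T rs" unfolding gain_def by (rule prod_list_one_plus_ge) auto
  finally show ?thesis by simp
qed

text \<open>For \<open>x \<ge> 2\<close> there are at least x/4 rates, none larger than x, so the
  sum of 1/(\<rho>T)^2 is at least (x/4)/(xT)^2.\<close>

lemma gain_beta_rates:
  assumes "x \<ge> 2" "T > 0"
  shows "gain T (beta_rates x) \<ge> 1 + 1 / (4 * x * T\<^sup>2)"
proof -
  define m where "m = nat \<lfloor>x / 2\<rfloor>"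
  have "\<lfloor>x / 2\<rfloor> \<ge> 1" using assms(1) by (simp add: le_floor_iff)
  then have "real m = of_int \<lfloor>x / 2\<rfloor>" "real m \<ge> 1" by (auto simp: m_def)
  then have m: "x / 4 \<le> real m" "real m \<le> x / 2"
    using floor_correct[of "x / 2"] by linarith+
  have "1 / (4 * x * T\<^sup>2) = (x / 4) * (1 / (x * T)\<^sup>2)"
    using assms by (simp add: power2_eq_square)
  also have "\<dots> \<le> real m * (1 / (x * T)\<^sup>2)"
    using m by (intro mult_right_mono) auto
  also have "\<dots> = (\<Sum>\<rho>\<leftarrow>beta_rates x. 1 / (x * T)\<^sup>2)"
    unfolding beta_rates_def m_def[symmetric] by (simp add: comp_def sum_list_triv)
  also have "\<dots> \<le> (\<Sum>\<rho>\<leftarrow>beta_rates x. 1 / (\<rho> * T)\<^sup>2)"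
  proof (rule sum_list_mono)
    fix \<rho> assume \<rho>: "\<rho> \<in> set (beta_rates x)"
    then obtain i where "i < m" "\<rho> = x / 2 + real i" by (auto simp: beta_rates_def m_def)
    then have "\<rho> \<le> x" using m by linarith
    moreover have "\<rho> \<ge> 1" using \<rho> by (rule beta_rates_ge_1)
    ultimately show "1 / (x * T)\<^sup>2 \<le> 1 / (\<rho> * T)\<^sup>2"
      using assms by (intro divide_left_mono power_mono mult_right_mono) auto
  qed
  finally have "1 + 1 / (4 * x * T\<^sup>2) \<le> 1 + (\<Sum>\<rho>\<leftarrow>beta_rates x. 1 / (\<rho> * T)\<^sup>2)" by simp
  also have "\<dots> \<le> gain T (beta_rates x)"
    unfolding gain_def by (rule prod_list_one_plus_ge) auto
  finally show ?thesis .
qed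

lemma gain_cbe_rates:
  assumes \<beta>: "\<beta> > 0" and T: "T > 0"
  shows "\<exists>a>0. \<exists>J\<ge>1. \<forall>N\<ge>J. (real N / real J) powr a \<le> gain T (cbe_rates \<beta> N)"
proof -
  \<comment> \<open>This is the constant in the gain 1 + \<kappa>/N of block \<open>N\<close>, after
    bounding 1 + \<beta>N/2 by (1 + \<beta>/2) N.\<close>
  define \<kappa> where "\<kappa> = 1 / (4 * (1 + \<beta> / 2) * T\<^sup>2)"
  have \<kappa>: "\<kappa> > 0" using \<beta> T by (auto simp: \<kappa>_def intro!: divide_pos_pos mult_pos_pos add_pos_pos)
  define a where "a = \<kappa> / (1 + \<kappa>)"
  have a: "a > 0" using \<kappa> by (simp add: a_def)
  \<comment> \<open>From 2/\<beta> on, \<xi> is at least 2 and every block contributes. The ratios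
    (N+1)/N then telescope to \<open>N / J\<close>.\<close>
  define J where "J = Suc (nat \<lceil>2 / \<beta>\<rceil>)"
  have J: "J \<ge> 1" by (simp add: J_def)
  have "(real N / real J) powr a \<le> gain T (cbe_rates \<beta> N)" if "N \<ge> J" for N
    using that
  proof (induction N rule: dec_induct)
    case base
    then show ?case using J gain_ge_1 by simp
  next
    case (step N)
    have N: "real N \<ge> 1" using step J by simp
    have "2 / \<beta> \<le> real N" using step(1) unfolding J_def by linarith
    then have "1 + \<beta> / 2 * real N \<ge> 2" using \<beta> by (simp add: field_simps)
    then have "1 + 1 / (4 * (1 + \<beta> / 2 * real N) * T\<^sup>2) \<le> gain T (beta_rates (1 + \<beta> / 2 * real N))"
      using T by (rule gain_beta_rates)
    moreover have "\<kappa> / real N \<le> 1 / (4 * (1 + \<beta> / 2 * real N) * T\<^sup>2)"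
    proof -
      have "1 + \<beta> / 2 * real N \<le> (1 + \<beta> / 2) * real N" using N by (simp add: algebra_simps)
      then have "4 * (1 + \<beta> / 2 * real N) * T\<^sup>2 \<le> 4 * ((1 + \<beta> / 2) * real N) * T\<^sup>2"
        by (intro mult_right_mono mult_left_mono) auto
      then have "1 / (4 * ((1 + \<beta> / 2) * real N) * T\<^sup>2) \<le> 1 / (4 * (1 + \<beta> / 2 * real N) * T\<^sup>2)"
        using \<beta> T N by (intro divide_left_mono) (auto intro!: mult_pos_pos add_pos_nonneg)
      then show ?thesis by (simp add: \<kappa>_def mult_ac)
    qed
    ultimately have block: "1 + \<kappa> / real N \<le> gain T (beta_rates (1 + \<beta> / 2 * real N))" by linarith
    have "(real (Suc N) / real J) powr a = ((real N / real J) * ((real N + 1) / real N)) powr a"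
      using N by (simp add: add.commute)
    also have "\<dots> = (real N / real J) powr a * ((real N + 1) / real N) powr a"
      by (rule powr_mult)
    also have "\<dots> \<le> gain T (cbe_rates \<beta> N) * gain T (beta_rates (1 + \<beta> / 2 * real N))"
      using step.IH powr_ratio_le[OF \<kappa> N] block gain_ge_1[of T "cbe_rates \<beta> N"]
      by (intro mult_mono) (auto simp: a_def)
    also have "\<dots> = gain T (cbe_rates \<beta> (Suc N))" by (simp add: gain_def)
    finally show ?case .
  qed
  with a J show ?thesis by blast
qed

text \<open>The first rate, once present, stays the same for all larger \<open>N\<close>; it enters
  the supremum bound as a factor and must not grow.\<close>

lemma cbe_rates_prefix: "N \<le> N' \<Longrightarrow> \<exists>rs. cbe_rates \<beta> N' = cbe_rates \<beta> N @ rs"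
  by (induction N' rule: dec_induct) auto

text \<open>The two rates spent on the supremum and on continuity are at least 1, so losing them
  costs no more than a constant factor.\<close>

lemma gain_butlast_tl:
  assumes "T > 0" "\<And>\<rho>. \<rho> \<in> set (\<rho>0 # rs) \<Longrightarrow> \<rho> \<ge> 1" "rs \<noteq> []"
  shows "gain T (\<rho>0 # rs) \<le> (1 + 1 / T\<^sup>2)\<^sup>2 * gain T (butlast rs)"
proof -
  have le: "1 + 1 / (\<rho> * T)\<^sup>2 \<le> 1 + 1 / T\<^sup>2" if "\<rho> \<in> set (\<rho>0 # rs)" for \<rho>
  proof -
    have "T \<le> \<rho> * T" using assms(2)[OF that] assms(1) by simp
    then have "1 / (\<rho> * T)\<^sup>2 \<le> 1 / T\<^sup>2"
      using assms(1) assms(2)[OF that] by (intro divide_left_mono power_mono) auto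
    then show ?thesis by simp
  qed
  have "gain T rs = gain T (butlast rs) * (1 + 1 / (last rs * T)\<^sup>2)"
    using arg_cong[OF append_butlast_last_id[OF assms(3), symmetric], of "gain T"] by (simp add: gain_def)
  then have "gain T (\<rho>0 # rs) = (1 + 1 / (\<rho>0 * T)\<^sup>2) * (1 + 1 / (last rs * T)\<^sup>2) * gain T (butlast rs)"
    by (simp add: gain_def)
  also have "\<dots> \<le> (1 + 1 / T\<^sup>2) * (1 + 1 / T\<^sup>2) * gain T (butlast rs)"
    using assms(3) gain_ge_1[of T "butlast rs"] by (intro mult_right_mono mult_mono le) auto
  finally show ?thesis by (simp add: power2_eq_square)
qed

section \<open>Digits of the characteristic polynomial\<close>

lemma measurable_digit [measurable]: "digit b n \<in> measurable borel (count_space UNIV)"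
  unfolding digit_def Let_def by measurable

text \<open>As y runs through [0, T], c - y/T runs backwards through one full period, so reflection,
  shift and scaling give the mean of \<open>h\<close>.\<close>

lemma integral_digit_wave:
  fixes h :: "real \<Rightarrow> real"
  assumes h: "periodic_bounded 1 C h" and T: "T > 0"
  shows "integral {0..T} (\<lambda>y. h (c - y / T)) = T * integral {0..1} h"
proof -
  have [measurable]: "h \<in> borel_measurable borel" and per: "h (u + 1) = h u" for u
    using h by (simp_all add: periodic_bounded_def)
  define h' where "h' u = h (- u)" for u
  have h': "periodic_bounded 1 C h'"
    unfolding periodic_bounded_def
  proof (intro conjI allI)
    show "h' \<in> borel_measurable borel" unfolding h'_def by measurable
    show "h' (u + 1) = h' u" for u using per[of "- u - 1"] by (simp add: h'_def)
    show "\<bar>h' u\<bar> \<le> C" for u using h by (simp add: h'_def periodic_bounded_def)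
  qed
  define g where "g u = h' (u + - c)" for u
  have "integral {0..1} g = integral {0..1} h'"
    unfolding g_def by (rule integral_periodic_shift[OF h']) simp
  also have "\<dots> = integral {-1..0} h"
    using Henstock_Kurzweil_Integration.integral_reflect_real[of 0 "-1" h] by (simp add: h'_def[abs_def])
  also have "\<dots> = integral {0..1} h"
    using integral_shift_Icc[OF periodic_bounded_integrable[OF h], of 0 1 1] by (simp add: per)
  finally have g: "integral {0..1} g = integral {0..1} h" .
  have "g integrable_on {0..1}"
    using periodic_bounded_integrable[OF h', of "- c" "1 - c"]
      has_integral_affinity'[of h' "integral {- c..1 - c} h'" "- c" "1 - c" 1 "- c"]
    by (auto simp: g_def[abs_def] has_integral_integral integrable_on_def)
  then have "(g has_integral integral {0..1} h) {0..1}"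
    using g by (metis integrable_integral)
  from has_integral_affinity'[of g _ 0 1 "1 / T" 0] this T
  have "((\<lambda>y. g (y / T)) has_integral T * integral {0..1} h) {0..T}"
    by simp
  moreover have "(\<lambda>y. g (y / T)) = (\<lambda>y. h (c - y / T))" by (simp add: g_def h'_def fun_eq_iff)
  ultimately show ?thesis by (simp add: integral_unique)
qed

text \<open>Writing X = exp(-y), |D| = 2^N exp(-y/2) is \<open>b\<close> to the power c - y/T. The
  event becomes a \<open>T\<close>-periodic indicator in y, and after subtracting its mean the
  supremum bound with \<open>C = 1\<close> applies whatever the remaining law is.\<close>

lemma cbe_digit_probability:
  fixes b L N :: nat and n k :: "nat \<Rightarrow> nat"
  assumes \<beta>: "\<beta> > 0" and b: "b \<ge> 2"
    and rates: "cbe_rates \<beta> N = \<rho> # rs" "rs \<noteq> []"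
  defines "h \<equiv> \<lambda>u. of_bool (\<forall>l<L. digit b (n l) (real b powr u) = k l)"
    and "T \<equiv> 2 * ln (real b)"
  shows "\<bar>measure (cbe N \<beta>) {\<theta>s \<in> space (cbe N \<beta>). \<forall>l<L. digit b (n l) (cmod (char_poly N \<theta> \<theta>s)) = k l} - integral {0..1} h\<bar>
    \<le> T * \<rho> / sqrt (gain T (butlast rs))"
proof -
  have bpos: "real b > 1" using b by simp
  have T: "T > 0" using bpos by (simp add: T_def)
  have h: "periodic_bounded 1 1 h"
    unfolding periodic_bounded_def
  proof (intro conjI allI)
    show "h \<in> borel_measurable borel" unfolding h_def by measurable
    show "h (u + 1) = h u" for u by (simp add: h_def digit_powr[OF b] frac_1_eq)
    show "\<bar>h u\<bar> \<le> 1" for u by (simp add: h_def)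
  qed
  define \<alpha> where "\<alpha> = integral {0..1} h"
  have \<alpha>: "0 \<le> \<alpha>" "\<alpha> \<le> 1"
  proof -
    have int: "h integrable_on {0..1}" by (rule periodic_bounded_integrable[OF h])
    show "0 \<le> \<alpha>" unfolding \<alpha>_def by (intro integral_nonneg int) (simp add: h_def)
    have "\<alpha> \<le> integral {0..1} (\<lambda>_::real. 1 :: real)" unfolding \<alpha>_def by (intro integral_le int) (auto simp: h_def)
    then show "\<alpha> \<le> 1" by simp
  qed
  \<comment> \<open>\<open>c\<close> is the logarithm of 2^N to base \<open>b\<close>, undoing the
    normalisation by \<open>4 ^ N\<close> under the square root.\<close>
  define c where "c = real N * ln 2 / ln (real b)"
  define F where "F y = h (c - y / T)" for y
  have [measurable]: "h \<in> borel_measurable borel" using h by (simp add: periodic_bounded_def)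
  have [measurable]: "F \<in> borel_measurable borel" unfolding F_def by measurable
  have F_per: "F (y + T) = F y" for y
  proof -
    have "c - (y + T) / T + 1 = c - y / T" using T by (simp add: add_divide_distrib)
    moreover have "h (c - (y + T) / T + 1) = h (c - (y + T) / T)" using h by (simp add: periodic_bounded_def)
    ultimately show ?thesis unfolding F_def by (simp only:)
  qed
  have F01: "0 \<le> F y" "F y \<le> 1" for y by (auto simp: F_def h_def)
  have F: "periodic_bounded T 1 F"
    unfolding periodic_bounded_def using F_per F01 by auto
  define f where "f y = F y - \<alpha>" for y
  have f_abs: "\<bar>f y\<bar> \<le> 1" for y using \<alpha> F01[of y] unfolding f_def by linarith
  have f: "periodic_bounded T 1 f"
    unfolding periodic_bounded_def using f_abs F_per by (auto simp: f_def[abs_def])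
  have mean: "integral {0..T} f = 0"
  proof -
    have "integral {0..T} f = integral {0..T} F - integral {0..T} (\<lambda>_. \<alpha>)"
      unfolding f_def by (intro Henstock_Kurzweil_Integration.integral_diff periodic_bounded_integrable[OF F] integrable_const_ivl)
    also have "integral {0..T} F = T * \<alpha>"
      unfolding F_def \<alpha>_def by (rule integral_digit_wave[OF h T])
    finally show ?thesis using T by simp
  qed
  obtain \<mu> where \<mu>: "real_distribution \<mu>"
    and law: "distr (cbe N \<beta>) borel (char_ratio N \<theta>) = distr (conv_exps \<mu> (cbe_rates \<beta> N)) borel (\<lambda>y. exp (- y))"
    using law_char_ratio[OF \<beta>, of N \<theta>] by blast
  define \<nu> where "\<nu> = conv_exps \<mu> (cbe_rates \<beta> N)"
  have pos: "\<forall>\<rho>\<in>set (\<rho> # rs). \<rho> > 0"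
    using cbe_rates_ge_1[of _ \<beta> N] unfolding rates by (auto intro: less_le_trans[OF zero_less_one])
  have rd_conv: "real_distribution \<mu> \<Longrightarrow> \<forall>\<rho>\<in>set rs. \<rho> > 0 \<Longrightarrow> real_distribution (conv_exps \<mu> rs)" for \<mu> rs
    by (induction rs arbitrary: \<mu>) (auto simp: real_distribution_convolution real_distribution_exp_law)
  interpret V: real_distribution \<nu> unfolding \<nu>_def rates by (rule rd_conv[OF \<mu> pos])
  interpret M: real_distribution \<mu> by (rule \<mu>)
  interpret P: prob_space "cbe N \<beta>" by (rule prob_space_cbe[OF \<beta>])
  have meas_ratio: "char_ratio N \<theta> \<in> borel_measurable (cbe N \<beta>)"
    using measurable_char_ratio by (simp cong: measurable_cong_sets)
  define A where "A = {v::real. \<forall>l<L. digit b (n l) (sqrt (v * 4 ^ N)) = k l}"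
  have A: "A \<in> sets borel" unfolding A_def by measurable
  have "{\<theta>s \<in> space (cbe N \<beta>). \<forall>l<L. digit b (n l) (cmod (char_poly N \<theta> \<theta>s)) = k l}
      = char_ratio N \<theta> -` A \<inter> space (cbe N \<beta>)"
    by (auto simp: A_def char_ratio_def)
  then have "measure (cbe N \<beta>) {\<theta>s \<in> space (cbe N \<beta>). \<forall>l<L. digit b (n l) (cmod (char_poly N \<theta> \<theta>s)) = k l}
      = measure (distr (cbe N \<beta>) borel (char_ratio N \<theta>)) A"
    using A meas_ratio by (subst measure_distr) auto
  also have "\<dots> = measure \<nu> ((\<lambda>y. exp (- y)) -` A)"
    unfolding law \<nu>_def[symmetric] using A by (subst measure_distr) auto
  also have "\<dots> = (\<integral>y. indicator ((\<lambda>y. exp (- y)) -` A) y \<partial>\<nu>)"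
    by simp
  also have "\<dots> = (\<integral>y. F y \<partial>\<nu>)"
  proof (intro Bochner_Integration.integral_cong refl)
    fix y
    have "sqrt (exp (- y) * 4 ^ N) = exp (- y / 2) * 2 ^ N"
    proof (rule real_sqrt_unique)
      have "(exp (- y / 2))\<^sup>2 = exp (- y)" by (simp add: power2_eq_square flip: exp_add)
      moreover have "((2::real) ^ N)\<^sup>2 = 4 ^ N" by (simp add: power2_eq_square flip: power_mult_distrib)
      ultimately show "(exp (- y / 2) * 2 ^ N)\<^sup>2 = exp (- y) * 4 ^ N" by (simp add: power_mult_distrib)
    qed simp
    also have "\<dots> = real b powr (c - y / T)"
    proof -
      have "(c - y / T) * ln (real b) = - y / 2 + real N * ln 2"
        using bpos by (simp add: c_def T_def field_simps)
      then have "real b powr (c - y / T) = exp (- y / 2 + real N * ln 2)"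
        using bpos by (simp add: powr_def)
      also have "\<dots> = exp (- y / 2) * 2 ^ N" unfolding exp_add by (simp add: exp_of_nat_mult)
      finally show ?thesis ..
    qed
    finally show "indicator ((\<lambda>y. exp (- y)) -` A) y = F y"
      by (simp add: F_def h_def A_def indicator_def)
  qed
  finally have prob: "measure (cbe N \<beta>) {\<theta>s \<in> space (cbe N \<beta>). \<forall>l<L. digit b (n l) (cmod (char_poly N \<theta> \<theta>s)) = k l} = (\<integral>y. F y \<partial>\<nu>)" .
  have "(\<integral>y. F y \<partial>\<nu>) - \<alpha> = (\<integral>y. f y \<partial>\<nu>)"
  proof -
    have "integrable \<nu> F" using F01 by (intro V.integrable_const_bound[of _ 1]) auto
    then show ?thesis unfolding f_def using V.prob_space by simp
  qed
  also have "\<dots> = (\<integral>y. smooth_exps (\<rho> # rs) f y \<partial>\<mu>)"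
    unfolding \<nu>_def rates by (rule integral_conv_exps[OF f pos \<mu>])
  finally have eq: "(\<integral>y. F y \<partial>\<nu>) - \<alpha> = (\<integral>y. smooth_exps (\<rho> # rs) f y \<partial>\<mu>)" .
  define K where "K = T * \<rho> / sqrt (gain T (butlast rs))"
  have \<rho>: "\<rho> > 0" using pos by simp
  have sup: "\<bar>smooth_exps (\<rho> # rs) f y\<bar> \<le> K" for y
  proof (rule power2_le_imp_le)
    have "(smooth_exps (\<rho> # rs) f y)\<^sup>2 \<le> (T * \<rho> * 1)\<^sup>2 / gain T (butlast rs)"
      unfolding gain_def by (rule smooth_exps_sup[OF f pos T mean rates(2)])
    then show "\<bar>smooth_exps (\<rho> # rs) f y\<bar>\<^sup>2 \<le> K\<^sup>2"
      using gain_ge_1[of T "butlast rs"] by (simp add: K_def power_divide)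
    show "0 \<le> K" unfolding K_def using T \<rho> gain_ge_1[of T "butlast rs"] by (intro divide_nonneg_nonneg mult_nonneg_nonneg) auto
  qed
  have sm: "smooth_exps (\<rho> # rs) f \<in> borel_measurable borel"
    using periodic_bounded_smooth_exps[OF f pos] unfolding periodic_bounded_def by blast
  have "\<bar>\<integral>y. smooth_exps (\<rho> # rs) f y \<partial>\<mu>\<bar> \<le> (\<integral>y. \<bar>smooth_exps (\<rho> # rs) f y\<bar> \<partial>\<mu>)"
    by (rule integral_abs_bound)
  also have "\<dots> \<le> K"
    using sup sm by (intro M.integral_le_const M.integrable_const_bound[of _ K]) auto
  finally show ?thesis unfolding prob using eq by (simp add: \<alpha>_def K_def)
qed

text \<open>The exponent, the constant and the threshold for \<open>N\<close> are fixed before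
  \<open>L\<close>, the positions and the pattern, because in the application the positions move
  with \<open>N\<close>.\<close>

lemma cbe_digit_error:
  fixes b :: nat
  assumes \<beta>: "\<beta> > 0" and b: "b \<ge> 2"
  shows "\<exists>a>0. \<exists>C. \<forall>\<^sub>F N in at_top. \<forall>L n k.
    \<bar>measure (cbe N \<beta>) {\<theta>s \<in> space (cbe N \<beta>). \<forall>l<L. digit b (n l) (cmod (char_poly N \<theta> \<theta>s)) = k l}
      - integral {0..1} (\<lambda>u. of_bool (\<forall>l<(L::nat). digit b (n l) (real b powr u) = k l))\<bar> \<le> C * real N powr (- a)"
proof -
  define T where "T = 2 * ln (real b)"
  have T: "T > 0" using b by (simp add: T_def)
  obtain a J where a: "a > 0" and J: "J \<ge> 1"
    and g: "\<And>N. N \<ge> J \<Longrightarrow> (real N / real J) powr a \<le> gain T (cbe_rates \<beta> N)"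
    using gain_cbe_rates[OF \<beta> T] by blast
  have unbounded: "\<exists>N0. \<forall>N\<ge>N0. K < gain T (cbe_rates \<beta> N)" for K
  proof -
    have "filterlim (\<lambda>N. (real N / real J) powr a) at_top at_top"
      using J a by real_asymp
    then have "\<forall>\<^sub>F N in at_top. K < (real N / real J) powr a"
      by (simp add: filterlim_at_top_dense)
    then obtain N0 where N0: "\<And>N. N \<ge> N0 \<Longrightarrow> K < (real N / real J) powr a"
      by (auto simp: eventually_at_top_linorder)
    show ?thesis
      using N0 g by (intro exI[of _ "max N0 J"]) (auto intro: less_le_trans)
  qed
  obtain N0 where N0: "\<And>N. N \<ge> N0 \<Longrightarrow> 1 + 1 / T\<^sup>2 < gain T (cbe_rates \<beta> N)"
    using unbounded by blast
  \<comment> \<open>A single rate gains at most 1 + 1/T^2, so exceeding this value takes at least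
    two rates, as many as the supremum bound sets apart.\<close>
  have long: "length (cbe_rates \<beta> N0) \<ge> 2"
  proof (rule ccontr)
    assume "\<not> length (cbe_rates \<beta> N0) \<ge> 2"
    then consider "cbe_rates \<beta> N0 = []" | r where "cbe_rates \<beta> N0 = [r]"
      by (cases "cbe_rates \<beta> N0"; cases "tl (cbe_rates \<beta> N0)") auto
    then show False
    proof cases
      case 1
      then show False using N0[of N0] by (simp add: gain_def)
    next
      case (2 r)
      then have "r \<ge> 1" using cbe_rates_ge_1[of r \<beta> N0] by simp
      then have "1 / (r * T)\<^sup>2 \<le> 1 / T\<^sup>2" using T by (intro divide_left_mono power_mono) auto
      then show False using N0[of N0] 2 by (simp add: gain_def)
    qed
  qed
  then obtain \<rho> \<rho>' rs0 where r0: "cbe_rates \<beta> N0 = \<rho> # \<rho>' # rs0"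
    by (cases "cbe_rates \<beta> N0"; cases "tl (cbe_rates \<beta> N0)") auto
  \<comment> \<open>The gain concerns squared norms, so its square root is used and the exponent is
    halved; \<open>1 + 1 / T\<^sup>2\<close> pays for the two rates set apart.\<close>
  define C where "C = T * \<rho> * (1 + 1 / T\<^sup>2) * real J powr (a / 2)"
  have "\<bar>measure (cbe N \<beta>) {\<theta>s \<in> space (cbe N \<beta>). \<forall>l<L. digit b (n l) (cmod (char_poly N \<theta> \<theta>s)) = k l}
      - integral {0..1} (\<lambda>u. of_bool (\<forall>l<L. digit b (n l) (real b powr u) = k l))\<bar> \<le> C * real N powr (- (a / 2))"
    if N: "N \<ge> max N0 J" for N L :: nat and n k
  proof -
    obtain rs1 where "cbe_rates \<beta> N = cbe_rates \<beta> N0 @ rs1" using cbe_rates_prefix[of N0 N \<beta>] N by auto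
    then obtain rs where rs: "cbe_rates \<beta> N = \<rho> # rs" "rs \<noteq> []" using r0 by auto
    have Npos: "real N > 0" "real J > 0" using N J by auto
    have ge1: "r \<ge> 1" if "r \<in> set (\<rho> # rs)" for r using cbe_rates_ge_1[of r \<beta> N] that rs by simp
    then have \<rho>: "\<rho> \<ge> 1" by simp
    have "(real N / real J) powr a \<le> (1 + 1 / T\<^sup>2)\<^sup>2 * gain T (butlast rs)"
    proof -
      have "gain T (\<rho> # rs) \<le> (1 + 1 / T\<^sup>2)\<^sup>2 * gain T (butlast rs)"
        by (rule gain_butlast_tl[OF T _ rs(2)]) (rule ge1)
      then show ?thesis using g[of N] N unfolding rs(1) by simp
    qed
    then have "sqrt ((real N / real J) powr a) \<le> sqrt ((1 + 1 / T\<^sup>2)\<^sup>2 * gain T (butlast rs))" by simp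
    also have "\<dots> = (1 + 1 / T\<^sup>2) * sqrt (gain T (butlast rs))"
      by (simp add: real_sqrt_mult)
    also have "sqrt ((real N / real J) powr a) = real N powr (a / 2) / real J powr (a / 2)"
      using Npos by (simp add: powr_half_sqrt[symmetric] powr_powr powr_divide)
    finally have s: "real N powr (a / 2) \<le> (1 + 1 / T\<^sup>2) * real J powr (a / 2) * sqrt (gain T (butlast rs))"
      using Npos by (simp add: divide_le_eq mult_ac)
    have gpos: "sqrt (gain T (butlast rs)) > 0" using gain_ge_1[of T "butlast rs"] by simp
    have "T * \<rho> / sqrt (gain T (butlast rs)) \<le> C * real N powr (- (a / 2))"
    proof -
      have "T * \<rho> * real N powr (a / 2) \<le> T * \<rho> * ((1 + 1 / T\<^sup>2) * real J powr (a / 2) * sqrt (gain T (butlast rs)))"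
        using T \<rho> by (intro mult_left_mono s) auto
      then have "T * \<rho> * real N powr (a / 2) \<le> C * sqrt (gain T (butlast rs))"
        by (simp add: C_def mult_ac)
      then show ?thesis using gpos Npos by (simp add: powr_minus field_simps)
    qed
    then show ?thesis
      using cbe_digit_probability[OF \<beta> b rs, where L = L and n = n and k = k and \<theta> = \<theta>] unfolding T_def by linarith
  qed
  then show ?thesis
    using a by (intro exI[of _ "a / 2"] conjI exI[of _ C]) (auto simp: eventually_at_top_linorder intro!: exI[of _ "max N0 J"])
qed

theorem theorem1p2:
  fixes \<beta> \<theta> :: real and b L :: nat
    and m :: "nat \<Rightarrow> nat \<Rightarrow> nat" and k :: "nat \<Rightarrow> nat" and \<epsilon> :: real
  assumes "\<beta> > 0" and "b \<ge> 2" and "0 \<le> \<theta>" and "\<theta> < 2 * pi"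
    and "L \<ge> 1"
    and "\<And>l. l < L \<Longrightarrow> filterlim (m l) at_top at_top"
    and "\<And>i j N. i < j \<Longrightarrow> j < L \<Longrightarrow> m i N < m j N"
    and "\<And>l. l < L \<Longrightarrow> k l < b"
    and "\<epsilon> > 0"
  shows "(\<lambda>N. \<bar>measure (cbe N \<beta>)
             {\<theta>s \<in> space (cbe N \<beta>). \<forall>l<L. digit b (m l N) (cmod (char_poly N \<theta> \<theta>s)) = k l}
           - 1 / real b ^ L\<bar>)
         \<in> O(\<lambda>N. 1 / ln (real N) powr (3/2 - \<epsilon>) + 1 / real b ^ m 0 N)"
proof -
  obtain a C where a: "a > 0" and C: "\<forall>\<^sub>F N in at_top. \<forall>L n k.
    \<bar>measure (cbe N \<beta>) {\<theta>s \<in> space (cbe N \<beta>). \<forall>l<L. digit b (n l) (cmod (char_poly N \<theta> \<theta>s)) = k l}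
      - integral {0..1} (\<lambda>u. of_bool (\<forall>l<(L::nat). digit b (n l) (real b powr u) = k l))\<bar> \<le> C * real N powr (- a)"
    using cbe_digit_error[OF assms(1,2), of \<theta>] by blast
  define C' where "C' = (real b)\<^sup>2 / ln (real b)"
  \<comment> \<open>The sign of \<open>C\<close> is unknown, hence the absolute value.\<close>
  define D where "D = max \<bar>C\<bar> C'"
  have D: "D \<ge> 0" "C \<le> D" "C' \<le> D" unfolding D_def by linarith+
  have "filterlim (m 0) at_top at_top" using assms(5,6) by simp
  then have m0: "\<forall>\<^sub>F N in at_top. m 0 N \<ge> 2" by (simp add: filterlim_at_top)
  \<comment> \<open>Any negative power of \<open>N\<close> is below every power of 1 / ln N; the
    exponent 3/2 is needed only as a common bound for all \<epsilon>.\<close>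
  have "(\<lambda>N. real N powr (- a) * ln (real N) powr (3 / 2)) \<longlonglongrightarrow> 0"
    using a by real_asymp
  then have lim: "\<forall>\<^sub>F N in at_top. real N powr (- a) * ln (real N) powr (3 / 2) < 1"
    by (rule order_tendstoD) simp
  \<comment> \<open>From ln N at least 1 on, the power of ln N increases with its exponent, so 3/2 -
    \<epsilon> may be replaced by 3/2 even if it is negative.\<close>
  have ln1: "\<forall>\<^sub>F N in at_top. ln (real N) \<ge> 1" by real_asymp
  show ?thesis
  proof (rule bigoI[where c = D])
    show "\<forall>\<^sub>F N in at_top. norm \<bar>measure (cbe N \<beta>)
             {\<theta>s \<in> space (cbe N \<beta>). \<forall>l<L. digit b (m l N) (cmod (char_poly N \<theta> \<theta>s)) = k l} - 1 / real b ^ L\<bar>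
        \<le> D * norm (1 / ln (real N) powr (3 / 2 - \<epsilon>) + 1 / real b ^ m 0 N)"
      using C m0 lim ln1
    proof eventually_elim
      case (elim N)
      define I where "I = integral {0..1} (\<lambda>u. of_bool (\<forall>l<L. digit b (m l N) (real b powr u) = k l) :: real)"
      define p where "p = measure (cbe N \<beta>) {\<theta>s \<in> space (cbe N \<beta>). \<forall>l<L. digit b (m l N) (cmod (char_poly N \<theta> \<theta>s)) = k l}"
      have 1: "\<bar>p - I\<bar> \<le> C * real N powr (- a)"
        using elim(1)[rule_format, of L "\<lambda>l. m l N" k] unfolding p_def I_def .
      have 2: "\<bar>I - 1 / real b ^ L\<bar> \<le> C' * (1 / real b ^ m 0 N)"
        using integral_digits[OF assms(2,5), of "\<lambda>l. m l N" k] elim(2) assms(7,8) by (simp add: I_def C'_def)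
      have l: "ln (real N) powr (3 / 2 - \<epsilon>) \<le> ln (real N) powr (3 / 2)" "ln (real N) powr (3 / 2 - \<epsilon>) > 0"
        using elim(4) assms(9) by (auto intro!: powr_mono)
      have "real N powr (- a) * ln (real N) powr (3 / 2 - \<epsilon>) \<le> real N powr (- a) * ln (real N) powr (3 / 2)"
        using l by (intro mult_left_mono) auto
      then have 3: "real N powr (- a) \<le> 1 / ln (real N) powr (3 / 2 - \<epsilon>)"
        using elim(3) l(2) by (simp add: le_divide_eq)
      have "C * real N powr (- a) \<le> D * (1 / ln (real N) powr (3 / 2 - \<epsilon>))"
        using D 3 by (intro mult_mono) auto
      moreover have "C' * (1 / real b ^ m 0 N) \<le> D * (1 / real b ^ m 0 N)"
        using D by (intro mult_right_mono) auto
      ultimately have "\<bar>p - 1 / real b ^ L\<bar> \<le> D * (1 / ln (real N) powr (3 / 2 - \<epsilon>) + 1 / real b ^ m 0 N)"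
        using 1 2 unfolding distrib_left by linarith
      moreover have "1 / ln (real N) powr (3 / 2 - \<epsilon>) + 1 / real b ^ m 0 N \<ge> 0" by (intro add_nonneg_nonneg) auto
      ultimately show ?case unfolding p_def by simp
    qed
  qed
qed

end
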